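(* Let $0<\alpha<1$, $\mu>0$, $0<x_1^*<x_2^*<\dots<x_m^*<l$, and $|q_k(x,t)|<c_1$ for $k=1,\dots,m$. Consider the differential problem $$\partial_{0t}^{\alpha}u=u_{xx}+\mu u_{xxt}+\sum_{k=1}^m q_k(x,t)u(x_k^*,t)+f(x,t),\quad 0<x<l,\ 0<t\le T,$$ $$u(0,t)=u(l,t)=0\ (0\le t\le T),\qquad u(x,0)=u_0(x)\ (0\le x\le l),$$ and, on the uniform grid with steps $h=l/N$, $\tau=T/M$, where $h<\min\{x_1^*,l-x_m^*\}$, the compact difference scheme $$\Delta^{\alpha}_{0t_{j+1/2}}(\mathcal H_h y)_i=Y^{j+1}_{\bar xx,i}+\mu\,y^j_{\bar xxt,i}+\mathcal H_h\Big(\sum_{k=1}^m q_k(\cdot,t_{j+1/2})\,\bar Y^{j+1}_{i_k}\Big)_i+(\mathcal H_h\varphi^{j+1/2})_i,\quad 1\le i\le N-1,\ 0\le j\le M-1,$$ $$y_0^{j+1}=y_N^{j+1}=0\ (0\le j\le M-1),\qquad y_i^0=u_0(x_i)\ (0\le i\le N),\qquad \varphi_i^{j+1/2}=f(x_i,t_{j+1/2}),$$ which has order of approximation $\mathcal O(h^4+\tau^{2-\alpha})$. There is a $\tau_0$ such that for $\tau\le\tau_0$ the a priori estimate $$\|y^{j+1}_{\bar x}]|_0^2\le M(T)\Big(\sum_{j'=0}^j\|\mathcal H_h\varphi^{j'+1/2}\|_0^2\,\tau+\|y^0\|_0^2+\|y^0_{\bar x}]|_0^2\Big)$$ holds with a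 constant $M(T)>0$ not depending on $h$ and $\tau$. From this estimate there follow the uniqueness and stability of the solution of the difference problem, and also the convergence of the solution of the difference problem to the solution of the differential problem with the rate $\mathcal O(h^4+\tau^{2-\alpha})$.
   Context: $\partial_{0t}^{\alpha}u(x,t)=\frac1{\Gamma(1-\alpha)}\int_0^t\frac{\partial u(x,\eta)}{\partial\eta}(t-\eta)^{-\alpha}d\eta$ is the Caputo derivative. Grid: $x_i=ih$ ($0\le i\le N$), $t_j=j\tau$ ($0\le j\le M$), $t_{j+1/2}=(j+\tfrac12)\tau$. The points $x_k^*$ are the fixed loading points. (The number $M$ of time steps is unrelated to the constant $M(T)$.) Difference quotients: $y_{\bar x,i}=(y_i-y_{i-1})/h$; $y_{\bar xx,i}=(y_{i+1}-2y_i+y_{i-1})/h^2$; $y^j_{\bar xxt,i}=(y^{j+1}_{\bar xx,i}-y^{j}_{\bar xx,i})/\tau$. Time average: $Y^{j+1}=\tfrac12(y^{j+1}+y^j)$. Compact operator: $(\mathcal H_h v)_i=\tfrac1{12}(v_{i+1}+10v_i+v_{i-1})$ for $1\le i\le N-1$ (applied to functions of $x$ through their values at the nodes). Discrete fractional derivative at $t_{j+1/2}$: $$\Delta^\alpha_{0t_{j+1/2}}v=\frac{\tau^{1-\alpha}}{\Gamma(2-\alpha)}\sum_{s=0}^j c^{(\alpha)}_{j-s}\,\frac{v^{s+1}-v^s}{\tau},\qquad c_0^{(\alpha)}=\frac1{2^{1-\alpha}},\quad c_n^{(\alpha)}=(n+\tfrac12)^{1-\alpha}-(n-\tfrac12)^{1-\alpha}\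 (n\ge1).$$ Interpolation at loading points: for each $k$, $i_k$ is an index with $x_{i_k}\le x_k^*\le x_{i_k+1}$, and $\bar Y_{i_k}$ is the value at $x_k^*$ of the cubic Lagrange interpolation polynomial through the nodes $x_{i_k-1},\dots,x_{i_k+2}$ with values $Y_{i_k-1},\dots,Y_{i_k+2}$ (these nodes lie in the grid because of the condition on $h$). Norms: $\|v\|_0^2=\sum_{i=1}^{N-1}v_i^2h$, $\|v_{\bar x}]|_0^2=\sum_{i=1}^{N}v_{\bar x,i}^2h$. Stability and convergence are understood in the norm $\|\cdot_{\bar x}]|_0$ on the time layers, which is the norm on the left of the a priori estimate.
   Formalization: The order of approximation is claimed for solutions u with continuous derivatives up to order 6 in x and 3 in t and continuous f, q_k on the closed rectangle; convergence is claimed for every solution u on which the scheme has that order (without regularity both claims fail). *)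

theory Defs
  imports "HOL-Analysis.Analysis"
begin

text \<open>
  Conventions: functions of space and time are written \<open>u x t\<close>; a grid function on one time
  layer is a map from node indices to reals, and a grid function on all layers is \<open>y j i\<close>
  (layer \<open>j\<close>, node \<open>i\<close>).  \<open>N\<close> is the number of space steps and \<open>K\<close> the number of time steps.
  The loading points are \<open>xs 1, \<dots>, xs m\<close>, with coefficients \<open>q 1, \<dots>, q m\<close>.
\<close>

section \<open>The differential problem\<close>

text \<open>
  Partial derivatives are taken relative to the closed rectangle, hence one-sided on its boundary.
\<close>

definition partial_x :: "real \<Rightarrow> (real \<Rightarrow> real \<Rightarrow> real) \<Rightarrow> real \<Rightarrow> real \<Rightarrow> real" where
  "partial_x l u x t = vector_derivative (\<lambda>\<xi>. u \<xi> t) (at x within {0..l})"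

definition partial_t :: "real \<Rightarrow> (real \<Rightarrow> real \<Rightarrow> real) \<Rightarrow> real \<Rightarrow> real \<Rightarrow> real" where
  "partial_t T u x t = vector_derivative (\<lambda>\<eta>. u x \<eta>) (at t within {0..T})"

definition caputo :: "real \<Rightarrow> real \<Rightarrow> (real \<Rightarrow> real \<Rightarrow> real) \<Rightarrow> real \<Rightarrow> real \<Rightarrow> real" where
  "caputo \<alpha> T u x t =
     1 / Gamma (1 - \<alpha>) * integral {0..t} (\<lambda>\<eta>. partial_t T u x \<eta> * (t - \<eta>) powr (- \<alpha>))"

text \<open>
  Besides the equation and the initial and boundary conditions, a solution has all the derivatives
  occurring in the equation, and the Caputo integral converges: \<open>vector_derivative\<close> and
  \<open>integral\<close> are total, so this has to be said separately.
\<close>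

definition differential_solution ::
  "real \<Rightarrow> real \<Rightarrow> real \<Rightarrow> real \<Rightarrow> nat \<Rightarrow> (nat \<Rightarrow> real) \<Rightarrow> (nat \<Rightarrow> real \<Rightarrow> real \<Rightarrow> real) \<Rightarrow>
   (real \<Rightarrow> real \<Rightarrow> real) \<Rightarrow> (real \<Rightarrow> real) \<Rightarrow> (real \<Rightarrow> real \<Rightarrow> real) \<Rightarrow> bool" where
  "differential_solution \<alpha> \<mu> l T m xs q f u0 u \<longleftrightarrow>
     continuous_on ({0..l} \<times> {0..T}) (\<lambda>(x, t). u x t) \<and>
     (\<forall>x t. 0 < x \<and> x < l \<and> 0 < t \<and> t \<le> T \<longrightarrow>
        (\<lambda>\<eta>. u x \<eta>) differentiable (at t within {0..T}) \<and>
        (\<lambda>\<xi>. u \<xi> t) differentiable (at x within {0..l}) \<and>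
        (\<lambda>\<xi>. partial_x l u \<xi> t) differentiable (at x within {0..l}) \<and>
        (\<lambda>\<eta>. partial_x l (partial_x l u) x \<eta>) differentiable (at t within {0..T}) \<and>
        (\<lambda>\<eta>. partial_t T u x \<eta> * (t - \<eta>) powr (- \<alpha>)) absolutely_integrable_on {0..t} \<and>
        caputo \<alpha> T u x t =
          partial_x l (partial_x l u) x t
          + \<mu> * partial_t T (partial_x l (partial_x l u)) x t
          + (\<Sum>k = 1..m. q k x t * u (xs k) t) + f x t) \<and>
     (\<forall>t. 0 \<le> t \<and> t \<le> T \<longrightarrow> u 0 t = 0 \<and> u l t = 0) \<and>
     (\<forall>x. 0 \<le> x \<and> x \<le> l \<longrightarrow> u x 0 = u0 x)"

text \<open>
  The class \<open>C\<^sup>a\<^sup>,\<^sup>b\<close> of the closed rectangle: \<open>D p r\<close> is the derivative of order \<open>p\<close> in \<open>x\<close>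
  and of order \<open>r\<close> in \<open>t\<close>, all of them being continuous up to the boundary.
\<close>

definition smooth_class ::
  "nat \<Rightarrow> nat \<Rightarrow> real \<Rightarrow> real \<Rightarrow> (real \<Rightarrow> real \<Rightarrow> real) \<Rightarrow> bool" where
  "smooth_class a b l T u \<longleftrightarrow>
     (\<exists>D :: nat \<Rightarrow> nat \<Rightarrow> real \<Rightarrow> real \<Rightarrow> real.
        (\<forall>x\<in>{0..l}. \<forall>t\<in>{0..T}. D 0 0 x t = u x t) \<and>
        (\<forall>p\<le>a. \<forall>r\<le>b. continuous_on ({0..l} \<times> {0..T}) (\<lambda>(x, t). D p r x t)) \<and>
        (\<forall>p<a. \<forall>r\<le>b. \<forall>x\<in>{0..l}. \<forall>t\<in>{0..T}.
           ((\<lambda>\<xi>. D p r \<xi> t) has_real_derivative D (Suc p) r x t) (at x within {0..l})) \<and>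
        (\<forall>p\<le>a. \<forall>r<b. \<forall>x\<in>{0..l}. \<forall>t\<in>{0..T}.
           ((\<lambda>\<eta>. D p r x \<eta>) has_real_derivative D p (Suc r) x t) (at t within {0..T})))"

section \<open>Grid operators and norms\<close>

definition diff_x :: "real \<Rightarrow> (nat \<Rightarrow> real) \<Rightarrow> nat \<Rightarrow> real" where
  "diff_x h v i = (v i - v (i - 1)) / h"

definition diff_xx :: "real \<Rightarrow> (nat \<Rightarrow> real) \<Rightarrow> nat \<Rightarrow> real" where
  "diff_xx h v i = (v (i + 1) - 2 * v i + v (i - 1)) / h\<^sup>2"

definition compact_op :: "(nat \<Rightarrow> real) \<Rightarrow> nat \<Rightarrow> real" where
  "compact_op v i = (v (i + 1) + 10 * v i + v (i - 1)) / 12"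

definition norm0 :: "real \<Rightarrow> nat \<Rightarrow> (nat \<Rightarrow> real) \<Rightarrow> real" where
  "norm0 h N v = sqrt (\<Sum>i = 1..N - 1. (v i)\<^sup>2 * h)"

definition norm_x :: "real \<Rightarrow> nat \<Rightarrow> (nat \<Rightarrow> real) \<Rightarrow> real" where
  "norm_x h N v = sqrt (\<Sum>i = 1..N. (diff_x h v i)\<^sup>2 * h)"

definition frac_coeff :: "real \<Rightarrow> nat \<Rightarrow> real" where
  "frac_coeff \<alpha> n =
     (if n = 0 then 1 / 2 powr (1 - \<alpha>)
      else (real n + 1/2) powr (1 - \<alpha>) - (real n - 1/2) powr (1 - \<alpha>))"

definition frac_diff :: "real \<Rightarrow> real \<Rightarrow> (nat \<Rightarrow> real) \<Rightarrow> nat \<Rightarrow> real" where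
  "frac_diff \<alpha> \<tau> v j =
     \<tau> powr (1 - \<alpha>) / Gamma (2 - \<alpha>) *
     (\<Sum>s = 0..j. frac_coeff \<alpha> (j - s) * ((v (s + 1) - v s) / \<tau>))"

text \<open>\<open>time_avg y j\<close> is the average of layers \<open>j\<close> and \<open>j + 1\<close>, written \<open>Y\<close> with upper index \<open>j + 1\<close>.\<close>

definition time_avg :: "(nat \<Rightarrow> nat \<Rightarrow> real) \<Rightarrow> nat \<Rightarrow> nat \<Rightarrow> real" where
  "time_avg y j i = (y (j + 1) i + y j i) / 2"

definition lagrange :: "nat set \<Rightarrow> (nat \<Rightarrow> real) \<Rightarrow> (nat \<Rightarrow> real) \<Rightarrow> real \<Rightarrow> real" where
  "lagrange S X V x = (\<Sum>a\<in>S. V a * (\<Prod>b\<in>S - {a}. (x - X b) / (X a - X b)))"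

definition cubic_interp :: "real \<Rightarrow> (nat \<Rightarrow> real) \<Rightarrow> nat \<Rightarrow> real \<Rightarrow> real" where
  "cubic_interp h v i x = lagrange {i - 1..i + 2} (\<lambda>r. real r * h) v x"

section \<open>The difference scheme\<close>

definition admissible_grid ::
  "real \<Rightarrow> nat \<Rightarrow> (nat \<Rightarrow> real) \<Rightarrow> nat \<Rightarrow> nat \<Rightarrow> (nat \<Rightarrow> nat) \<Rightarrow> bool" where
  "admissible_grid l m xs N K ik \<longleftrightarrow>
     N \<ge> 1 \<and> K \<ge> 1 \<and> l / real N < min (xs 1) (l - xs m) \<and>
     (\<forall>k\<in>{1..m}. real (ik k) * (l / real N) \<le> xs k \<and> xs k \<le> real (ik k + 1) * (l / real N))"

definition scheme_lhs ::
  "real \<Rightarrow> real \<Rightarrow> (nat \<Rightarrow> nat \<Rightarrow> real) \<Rightarrow> nat \<Rightarrow> nat \<Rightarrow> real" where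
  "scheme_lhs \<alpha> \<tau> y j i = frac_diff \<alpha> \<tau> (\<lambda>s. compact_op (y s) i) j"

definition scheme_rhs ::
  "real \<Rightarrow> real \<Rightarrow> real \<Rightarrow> nat \<Rightarrow> (nat \<Rightarrow> real) \<Rightarrow> (nat \<Rightarrow> real \<Rightarrow> real \<Rightarrow> real) \<Rightarrow>
   (real \<Rightarrow> real \<Rightarrow> real) \<Rightarrow> (nat \<Rightarrow> nat) \<Rightarrow> (nat \<Rightarrow> nat \<Rightarrow> real) \<Rightarrow> nat \<Rightarrow> nat \<Rightarrow> real" where
  "scheme_rhs \<mu> h \<tau> m xs q f ik y j i =
     diff_xx h (time_avg y j) i
     + \<mu> * ((diff_xx h (y (j + 1)) i - diff_xx h (y j) i) / \<tau>)
     + compact_op (\<lambda>r. \<Sum>k = 1..m. q k (real r * h) ((real j + 1/2) * \<tau>)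
                        * cubic_interp h (time_avg y j) (ik k) (xs k)) i
     + compact_op (\<lambda>r. f (real r * h) ((real j + 1/2) * \<tau>)) i"

definition difference_solution ::
  "real \<Rightarrow> real \<Rightarrow> real \<Rightarrow> real \<Rightarrow> nat \<Rightarrow> (nat \<Rightarrow> real) \<Rightarrow> (nat \<Rightarrow> real \<Rightarrow> real \<Rightarrow> real) \<Rightarrow>
   (real \<Rightarrow> real \<Rightarrow> real) \<Rightarrow> (real \<Rightarrow> real) \<Rightarrow> nat \<Rightarrow> nat \<Rightarrow> (nat \<Rightarrow> nat) \<Rightarrow>
   (nat \<Rightarrow> nat \<Rightarrow> real) \<Rightarrow> bool" where
  "difference_solution \<alpha> \<mu> l T m xs q f u0 N K ik y \<longleftrightarrow>
     (let h = l / real N; \<tau> = T / real K in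
        (\<forall>j<K. \<forall>i\<in>{1..N - 1}.
           scheme_lhs \<alpha> \<tau> y j i = scheme_rhs \<mu> h \<tau> m xs q f ik y j i) \<and>
        (\<forall>j<K. y (j + 1) 0 = 0 \<and> y (j + 1) N = 0) \<and>
        (\<forall>i\<le>N. y 0 i = u0 (real i * h)))"

definition nodal_values :: "real \<Rightarrow> real \<Rightarrow> (real \<Rightarrow> real \<Rightarrow> real) \<Rightarrow> nat \<Rightarrow> nat \<Rightarrow> real" where
  "nodal_values h \<tau> u j i = u (real i * h) (real j * \<tau>)"

text \<open>
  On the solution \<open>u\<close> of the differential problem the scheme has order of approximation
  \<open>O(h\<^sup>4 + \<tau>\<^sup>2\<^sup>-\<^sup>\<alpha>)\<close>: the residual of \<open>u\<close> in the difference equations is of that order, uniformly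
  over the nodes.
\<close>

definition approximation_order ::
  "real \<Rightarrow> real \<Rightarrow> real \<Rightarrow> real \<Rightarrow> nat \<Rightarrow> (nat \<Rightarrow> real) \<Rightarrow> (nat \<Rightarrow> real \<Rightarrow> real \<Rightarrow> real) \<Rightarrow>
   (real \<Rightarrow> real \<Rightarrow> real) \<Rightarrow> (real \<Rightarrow> real \<Rightarrow> real) \<Rightarrow> bool" where
  "approximation_order \<alpha> \<mu> l T m xs q f u \<longleftrightarrow>
     (\<exists>C. \<forall>N K ik. admissible_grid l m xs N K ik \<longrightarrow>
        (let h = l / real N; \<tau> = T / real K in
           \<forall>j<K. \<forall>i\<in>{1..N - 1}.
             \<bar>scheme_lhs \<alpha> \<tau> (nodal_values h \<tau> u) j i
               - scheme_rhs \<mu> h \<tau> m xs q f ik (nodal_values h \<tau> u) j i\<bar>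
             \<le> C * (h ^ 4 + \<tau> powr (2 - \<alpha>))))"

end

theory Submission imports Defs begin

text \<open>
  Because of the term \<open>\<mu> u\<^sub>x\<^sub>x\<^sub>t\<close>, the energy norm of the time increments \<open>w\<close> of the scheme is controlled
  directly: testing the \<open>j\<close>-th equation with \<open>w\<^sup>j\<close> bounds \<open>\<mu>\<close> times the norm of the difference quotient
  of \<open>w\<^sup>j\<close> by a discrete convolution of the previous such norms with the weakly singular kernel
  \<open>\<tau> + \<tau>\<^sup>1\<^sup>-\<^sup>\<alpha> c\<^sub>n\<close>, plus data; no positivity of the discrete fractional derivative is needed.  With weights
  \<open>exp (- \<nu> j \<tau>)\<close> and \<open>\<nu>\<close> large, this kernel has total mass at most \<open>1/2\<close> once \<open>\<tau>\<close> is small, so the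
  weighted sum of the norms is absorbed.  The sums over the layers are \<open>\<ell>\<^sup>1\<close> rather than \<open>\<ell>\<^sup>2\<close>, since the
  contribution of an initial layer with nonzero boundary values is \<open>\<tau>\<^sup>-\<^sup>\<alpha> c\<^sub>j\<close>, which is summable
  uniformly in \<open>\<tau>\<close> but not square summable for \<open>\<alpha> > 1/2\<close>.
\<close>

section \<open>Grid norms and the energy identity\<close>

text \<open>The recursion is implicit: the convolution at layer \<open>j\<close> contains the
  unknown norm of layer \<open>j\<close> itself, with the factor
  \<open>\<tau> + \<tau> powr (1 - \<alpha>) * frac_coeff \<alpha> 0\<close> up to a constant. No
  exponential weight damps this diagonal term, whence the restriction
  \<open>\<tau> \<le> \<tau>0\<close>; the weight only controls the long memory. Returning from sums
  of norms to sums of squares costs Cauchy-Schwarz in time, applied to the residual alone.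

  The initial layer obeys no boundary condition, so its size cannot be read off its difference
  quotients; this is why its \<open>norm0\<close> stands next to its \<open>norm_x\<close> in the
  estimate.

  The estimate is proved for an arbitrary residual, measured in \<open>norm0\<close>. A priori
  bound, stability, uniqueness and convergence are then one inequality applied to the difference of
  two grid functions: the second is the zero solution, another solution, or the nodal values of
  \<open>u\<close>, whose residual is the truncation error up to sign. Smoothness of
  \<open>u\<close> enters only in the bound of that error.\<close>

lemma norm0_eq_L2_set: "h \<ge> 0 \<Longrightarrow> norm0 h N v = sqrt h * L2_set v {1..N - 1}"
  by (simp add: norm0_def L2_set_def real_sqrt_mult flip: sum_distrib_right)

lemma norm_x_eq_L2_set: "h \<ge> 0 \<Longrightarrow> norm_x h N v = sqrt h * L2_set (diff_x h v) {1..N}"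
  by (simp add: norm_x_def L2_set_def real_sqrt_mult flip: sum_distrib_right)

lemma norm0_nonneg: "h \<ge> 0 \<Longrightarrow> norm0 h N v \<ge> 0"
  by (simp add: norm0_eq_L2_set)

lemma norm_x_nonneg: "h \<ge> 0 \<Longrightarrow> norm_x h N v \<ge> 0"
  by (simp add: norm_x_eq_L2_set)

lemma norm0_cong: "(\<And>i. i \<in> {1..N - 1} \<Longrightarrow> u i = v i) \<Longrightarrow> norm0 h N u = norm0 h N v"
  by (simp add: norm0_def)

lemma norm_x_cong: "(\<And>i. i \<le> N \<Longrightarrow> u i = v i) \<Longrightarrow> norm_x h N u = norm_x h N v"
  by (auto simp: norm_x_def diff_x_def intro!: arg_cong[where f = sqrt] sum.cong)

lemma norm0_triangle: "h \<ge> 0 \<Longrightarrow> norm0 h N (\<lambda>i. u i + v i) \<le> norm0 h N u + norm0 h N v"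
  using mult_left_mono[OF L2_set_triangle_ineq[of u v "{1..N-1}"], of "sqrt h"]
  by (simp add: norm0_eq_L2_set algebra_simps)

lemma norm_x_triangle: "h \<ge> 0 \<Longrightarrow> norm_x h N (\<lambda>i. u i + v i) \<le> norm_x h N u + norm_x h N v"
proof -
  have "diff_x h (\<lambda>i. u i + v i) = (\<lambda>i. diff_x h u i + diff_x h v i)"
    by (simp add: diff_x_def fun_eq_iff add_divide_distrib diff_divide_distrib)
  then show "h \<ge> 0 \<Longrightarrow> ?thesis"
    using mult_left_mono[OF L2_set_triangle_ineq[of "diff_x h u" "diff_x h v" "{1..N}"], of "sqrt h"]
    by (simp add: norm_x_eq_L2_set algebra_simps)
qed

lemma norm0_scale: "norm0 h N (\<lambda>i. c * v i) = \<bar>c\<bar> * norm0 h N v"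
proof -
  have "(\<Sum>i = 1..N - 1. (c * v i)\<^sup>2 * h) = c\<^sup>2 * (\<Sum>i = 1..N - 1. (v i)\<^sup>2 * h)"
    by (simp add: sum_distrib_left power_mult_distrib algebra_simps)
  then show ?thesis by (simp add: norm0_def real_sqrt_mult)
qed

lemma norm_x_scale: "norm_x h N (\<lambda>i. c * v i) = \<bar>c\<bar> * norm_x h N v"
proof -
  have *: "diff_x h (\<lambda>i. c * v i) = (\<lambda>i. c * diff_x h v i)"
    by (simp add: diff_x_def fun_eq_iff right_diff_distrib)
  have "(\<Sum>i = 1..N. (diff_x h (\<lambda>i. c * v i) i)\<^sup>2 * h) = c\<^sup>2 * (\<Sum>i = 1..N. (diff_x h v i)\<^sup>2 * h)"
    by (simp add: * sum_distrib_left power_mult_distrib algebra_simps)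
  then show ?thesis by (simp add: norm_x_def real_sqrt_mult)
qed

lemma norm0_sum: "h \<ge> 0 \<Longrightarrow> norm0 h N (\<lambda>i. \<Sum>s\<in>A. v s i) \<le> (\<Sum>s\<in>A. norm0 h N (v s))"
proof (induction A rule: infinite_finite_induct)
  case (insert a A)
  then show ?case using norm0_triangle[of h N "v a" "\<lambda>i. \<Sum>s\<in>A. v s i"] by simp
qed (simp_all add: norm0_def)

lemma norm_x_sum: "h \<ge> 0 \<Longrightarrow> norm_x h N (\<lambda>i. \<Sum>s\<in>A. v s i) \<le> (\<Sum>s\<in>A. norm_x h N (v s))"
proof (induction A rule: infinite_finite_induct)
  case (insert a A)
  then show ?case using norm_x_triangle[of h N "v a" "\<lambda>i. \<Sum>s\<in>A. v s i"] by simp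
qed (simp_all add: norm_x_def diff_x_def)

section \<open>Discrete Sobolev embeddings\<close>

lemma oscillation_le_norm_x:
  assumes "h > 0" "i \<le> N" "k \<le> N"
  shows "\<bar>v i - v k\<bar> \<le> sqrt (real N * h) * norm_x h N v"
proof -
  have *: "\<bar>v i - v k\<bar> \<le> sqrt (real N * h) * norm_x h N v" if "k \<le> i" "i \<le> N" for i k
  proof -
    have "v i - v k = (\<Sum>r = k..<i. v (Suc r) - v r)"
      using \<open>k \<le> i\<close> by (simp add: sum_Suc_diff')
    also have "\<dots> = (\<Sum>r = Suc k..<Suc i. h * diff_x h v r)"
      unfolding sum.atLeast_Suc_lessThan_Suc_shift using \<open>h > 0\<close> by (simp add: diff_x_def)
    finally have "\<bar>v i - v k\<bar> \<le> (\<Sum>r = Suc k..<Suc i. \<bar>h\<bar> * \<bar>diff_x h v r\<bar>)"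
      using sum_abs[of "\<lambda>r. h * diff_x h v r" "{Suc k..<Suc i}"] by (simp only: abs_mult)
    also have "\<dots> \<le> (\<Sum>r \<in> {1..N}. \<bar>h\<bar> * \<bar>diff_x h v r\<bar>)"
      using that by (intro sum_mono2) auto
    \<comment> \<open>Cauchy-Schwarz against the constant \<open>h\<close> leaves
      \<open>sqrt (real N * h)\<close>, the root of the interval length, so the constant does not
      depend on the grid.\<close>
    also have "\<dots> \<le> L2_set (\<lambda>_. h) {1..N} * L2_set (diff_x h v) {1..N}"
      by (rule L2_set_mult_ineq)
    also have "L2_set (\<lambda>_. h) {1..N} = sqrt (real N * h) * sqrt h"
      using \<open>h > 0\<close> by (simp add: L2_set_def real_sqrt_mult)
    finally show ?thesis using \<open>h > 0\<close> by (simp add: norm_x_eq_L2_set algebra_simps)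
  qed
  show ?thesis using *[of k i] *[of i k] assms by (cases "k \<le> i") (auto simp: abs_minus_commute)
qed

lemma sup_le_norm_x:
  assumes "h > 0" "i \<le> N" "v 0 = 0"
  shows "\<bar>v i\<bar> \<le> sqrt (real N * h) * norm_x h N v"
  using oscillation_le_norm_x[of h i N 0 v] assms by simp

text \<open>No boundary condition: the initial layer of the scheme need not vanish at the end points.\<close>

lemma sup_le_norm0_norm_x:
  assumes "h > 0" "i \<le> N" "N \<ge> 2"
  shows "\<bar>v i\<bar> \<le> sqrt (2 / (real N * h)) * norm0 h N v + sqrt (real N * h) * norm_x h N v"
proof -
  \<comment> \<open>At the interior node where \<open>\<bar>v\<bar>\<close> is smallest, the value
    is at most the root mean square, hence controlled by \<open>norm0\<close>. The oscillation bound
    then carries this to every node, end points included.\<close>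
  obtain k where k: "k \<in> {1..N-1}" "\<And>i. i \<in> {1..N-1} \<Longrightarrow> \<bar>v k\<bar> \<le> \<bar>v i\<bar>"
  proof -
    have ne: "{1..N-1} \<noteq> {}" using assms(3) by auto
    show ?thesis
      using arg_min_if_finite(1)[OF _ ne, of "\<lambda>i. \<bar>v i\<bar>"] arg_min_least[OF _ ne, of _ "\<lambda>i. \<bar>v i\<bar>"]
      by (intro that[of "arg_min_on (\<lambda>i. \<bar>v i\<bar>) {1..N-1}"]) auto
  qed
  have "real N * h / 2 * (v k)\<^sup>2 \<le> real (N - 1) * (h * (v k)\<^sup>2)"
  proof -
    \<comment> \<open>The \<open>N - 1\<close> interior nodes represent at least half of the
      interval length; hence the factor 2 under the root in the statement.\<close>
    have "real N / 2 \<le> real (N - 1)" using assms(3) by (simp add: of_nat_diff)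
    then have "real N / 2 * (h * (v k)\<^sup>2) \<le> real (N - 1) * (h * (v k)\<^sup>2)"
      using assms(1) by (intro mult_right_mono) auto
    then show ?thesis by simp
  qed
  also have "\<dots> = (\<Sum>i = 1..N - 1. (v k)\<^sup>2 * h)" by simp
  also have "\<dots> \<le> (\<Sum>i = 1..N - 1. (v i)\<^sup>2 * h)"
    using k(2) assms(1) by (intro sum_mono mult_right_mono) (auto simp: abs_le_square_iff)
  finally have "(v k)\<^sup>2 \<le> 2 / (real N * h) * (\<Sum>i = 1..N - 1. (v i)\<^sup>2 * h)"
    using assms by (simp add: field_simps)
  then have "\<bar>v k\<bar> \<le> sqrt (2 / (real N * h)) * norm0 h N v"
    unfolding norm0_def real_sqrt_mult[symmetric] by (metis real_sqrt_abs real_sqrt_le_iff)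
  moreover have "\<bar>v i\<bar> \<le> \<bar>v k\<bar> + \<bar>v i - v k\<bar>" by linarith
  ultimately show ?thesis
    using oscillation_le_norm_x[of h i N k v] k(1) assms by fastforce
qed

lemma norm0_le_sup:
  assumes "h \<ge> 0" "B \<ge> 0" "\<And>i. i \<in> {1..N-1} \<Longrightarrow> \<bar>v i\<bar> \<le> B"
  shows "norm0 h N v \<le> sqrt (real N * h) * B"
proof -
  have "(\<Sum>i = 1..N - 1. (v i)\<^sup>2 * h) \<le> (\<Sum>i = 1..N - 1. B\<^sup>2 * h)"
    using assms by (intro sum_mono mult_right_mono) (auto simp: abs_le_square_iff[symmetric])
  also have "\<dots> \<le> real N * h * B\<^sup>2"
    using assms mult_right_mono[of "real (N - 1)" "real N" "B\<^sup>2 * h"] by (simp add: mult_ac)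
  finally have "norm0 h N v \<le> sqrt (real N * h * B\<^sup>2)"
    unfolding norm0_def by (rule real_sqrt_le_mono)
  then show ?thesis using assms by (simp add: real_sqrt_mult)
qed

lemma compact_op_le_sup:
  assumes "\<And>i. i \<le> N \<Longrightarrow> \<bar>v i\<bar> \<le> B" "i \<in> {1..N-1}"
  shows "\<bar>compact_op v i\<bar> \<le> B"
proof -
  have "\<bar>v (i+1)\<bar> \<le> B" "\<bar>v i\<bar> \<le> B" "\<bar>v (i-1)\<bar> \<le> B" using assms by auto
  then show ?thesis unfolding compact_op_def by simp
qed

lemma norm0_compact_op_le_sup:
  assumes "h \<ge> 0" "B \<ge> 0" "\<And>i. i \<le> N \<Longrightarrow> \<bar>v i\<bar> \<le> B"
  shows "norm0 h N (compact_op v) \<le> sqrt (real N * h) * B"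
  using assms by (intro norm0_le_sup compact_op_le_sup[of N v B]) auto

section \<open>Summation by parts and the energy inequality\<close>

lemma summation_by_parts:
  assumes "h > 0" "N \<ge> 1" "v 0 = 0" "v N = 0"
  shows "(\<Sum>i = 1..N - 1. diff_xx h w i * v i * h) = - (\<Sum>i = 1..N. diff_x h w i * diff_x h v i * h)"
proof -
  \<comment> \<open>The truncated sum keeps a flux at its right end, which for
    \<open>n = N - 1\<close> equals minus the last summand of the full sum because
    \<open>v N = 0\<close>. Nothing is asked of \<open>w\<close> at the end points, so the initial
    layer may later occur in the factor that is not the test function.\<close>
  have *: "(\<Sum>i = 1..n. diff_xx h w i * v i * h) =
     diff_x h w (Suc n) * v n - (\<Sum>i = 1..n. diff_x h w i * diff_x h v i * h)" for n
  proof (induction n)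
    case 0 then show ?case using assms by simp
  next
    case (Suc n)
    have "diff_xx h w (Suc n) * v (Suc n) * h
       = (diff_x h w (Suc (Suc n)) - diff_x h w (Suc n)) * v (Suc n)"
      using assms(1) by (simp add: diff_xx_def diff_x_def field_simps power2_eq_square)
    moreover have "diff_x h w (Suc n) * diff_x h v (Suc n) * h = diff_x h w (Suc n) * (v (Suc n) - v n)"
      using assms(1) by (simp add: diff_x_def)
    ultimately show ?case using Suc by (simp add: algebra_simps)
  qed
  obtain n where N: "N = Suc n" using assms(2) by (cases N) auto
  have "diff_x h w N * diff_x h v N * h = - diff_x h w N * v n"
    using assms(1,4) N by (simp add: diff_x_def)
  then show ?thesis using *[of n] by (simp add: N)
qed

lemma minus_prod_le:
  fixes x y h :: real
  assumes "h \<ge> 0"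
  shows "- (x * y * h) \<le> \<bar>x\<bar> * \<bar>y\<bar> * h"
proof -
  have "- (x * y) \<le> \<bar>x\<bar> * \<bar>y\<bar>" by (metis abs_ge_minus_self abs_mult)
  from mult_right_mono[OF this assms] show ?thesis by simp
qed

text \<open>The equation is tested with \<open>w\<close> itself. Summation by parts leaves only
  first differences of \<open>p\<close>, and the Friedrichs inequality bounds \<open>norm0\<close>
  of \<open>w\<close> by \<open>real N * h\<close> times its energy norm, so one factor of that norm
  cancels and the bound is linear.\<close>

lemma energy_step:
  assumes "h > 0" "N \<ge> 1" "w 0 = 0" "w N = 0" "\<mu> > 0"
    and eq: "\<And>i. i \<in> {1..N-1} \<Longrightarrow> g i = diff_xx h p i + \<mu> * diff_xx h w i"
  shows "\<mu> * norm_x h N w \<le> norm_x h N p + real N * h * norm0 h N g"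
proof -
  define a where "a = norm_x h N w"
  have a0: "a \<ge> 0" unfolding a_def using assms by (simp add: norm_x_nonneg)
  have sq: "(\<Sum>i = 1..N. diff_x h w i * diff_x h w i * h) = a\<^sup>2"
    using assms(1) by (simp add: a_def norm_x_def power2_eq_square sum_nonneg)
  have regroup: "h * (A * B) = sqrt h * A * (sqrt h * B)" for A B
  proof -
    have "sqrt h * A * (sqrt h * B) = (sqrt h * sqrt h) * (A * B)" by (simp only: mult_ac)
    then show ?thesis using assms(1) by simp
  qed
  have px: "- (\<Sum>i = 1..N. diff_x h p i * diff_x h w i * h) \<le> norm_x h N p * a"
  proof -
    have "- (\<Sum>i = 1..N. diff_x h p i * diff_x h w i * h)
       \<le> (\<Sum>i = 1..N. \<bar>diff_x h p i\<bar> * \<bar>diff_x h w i\<bar> * h)"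
      unfolding sum_negf[symmetric] using assms(1)
      by (intro sum_mono minus_prod_le) auto
    also have "\<dots> \<le> h * (L2_set (diff_x h p) {1..N} * L2_set (diff_x h w) {1..N})"
      using mult_left_mono[OF L2_set_mult_ineq[of "diff_x h p" "diff_x h w" "{1..N}"], of h] assms(1)
      by (simp add: sum_distrib_left mult_ac)
    also have "\<dots> = norm_x h N p * a"
      using assms(1) regroup by (simp add: a_def norm_x_eq_L2_set)
    finally show ?thesis .
  qed
  have gx: "- (\<Sum>i = 1..N-1. g i * w i * h) \<le> norm0 h N g * norm0 h N w"
  proof -
    have "- (\<Sum>i = 1..N-1. g i * w i * h) \<le> (\<Sum>i = 1..N-1. \<bar>g i\<bar> * \<bar>w i\<bar> * h)"
      unfolding sum_negf[symmetric] using assms(1)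
      by (intro sum_mono minus_prod_le) auto
    also have "\<dots> \<le> h * (L2_set g {1..N-1} * L2_set w {1..N-1})"
      using mult_left_mono[OF L2_set_mult_ineq[of "g" "w" "{1..N-1}"], of h] assms(1)
      by (simp add: sum_distrib_left mult_ac)
    also have "\<dots> = norm0 h N g * norm0 h N w"
      using assms(1) regroup by (simp add: norm0_eq_L2_set)
    finally show ?thesis .
  qed
  have "norm0 h N w \<le> sqrt (real N * h) * (sqrt (real N * h) * a)"
    unfolding a_def using assms by (intro norm0_le_sup sup_le_norm_x) (auto simp: norm_x_nonneg)
  then have w0: "norm0 h N w \<le> real N * h * a"
    using assms(1) by (simp flip: mult.assoc)
  have "(\<Sum>i = 1..N-1. g i * w i * h) =
     (\<Sum>i = 1..N-1. diff_xx h p i * w i * h) + \<mu> * (\<Sum>i = 1..N-1. diff_xx h w i * w i * h)"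
    unfolding sum_distrib_left sum.distrib[symmetric]
    by (intro sum.cong refl) (simp add: eq algebra_simps)
  then have "\<mu> * a\<^sup>2 = - (\<Sum>i = 1..N. diff_x h p i * diff_x h w i * h) - (\<Sum>i = 1..N-1. g i * w i * h)"
    unfolding summation_by_parts[OF assms(1-4)] sq mult_minus_right by linarith
  also have "\<dots> \<le> norm_x h N p * a + norm0 h N g * (real N * h * a)"
    using px gx mult_left_mono[OF w0 norm0_nonneg[of h N g]] assms(1) by linarith
  finally have "a * (\<mu> * a) \<le> a * (norm_x h N p + real N * h * norm0 h N g)"
    by (simp add: algebra_simps power2_eq_square)
  then show ?thesis
  proof (cases "a = 0")
    case True
    then show ?thesis using assms(1) by (simp flip: a_def add: norm_x_nonneg norm0_nonneg)
  next
    case False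
    then show ?thesis using \<open>a * (\<mu> * a) \<le> _\<close> a0 by (simp flip: a_def)
  qed
qed

section \<open>Weakly singular discrete convolutions\<close>

text \<open>A weighted Young inequality for discrete convolutions: since
  \<open>E ^ j = E ^ (j - s) * E ^ s\<close>, the weighted sum of the convolution is at most the
  weighted mass of \<open>k\<close> times that of \<open>a\<close>. Mass at most
  \<open>1 / 2\<close> lets it be absorbed into the left side, and the term \<open>s = j\<close> of
  the implicit recursion is absorbed along with the others.\<close>

lemma weighted_gronwall:
  fixes a b k :: "nat \<Rightarrow> real"
  assumes a: "\<And>j. a j \<ge> 0" and k: "\<And>n. k n \<ge> 0" and E: "E \<ge> 0"
    and le: "\<And>j. j \<le> J \<Longrightarrow> a j \<le> (\<Sum>s\<le>j. k (j - s) * a s) + b j"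
    and small: "(\<Sum>n\<le>J. k n * E ^ n) \<le> 1 / 2"
  shows "(\<Sum>j\<le>J. E ^ j * a j) \<le> 2 * (\<Sum>j\<le>J. E ^ j * b j)"
proof -
  let ?A = "\<Sum>j\<le>J. E ^ j * a j"
  have "?A \<le> (\<Sum>j\<le>J. E ^ j * ((\<Sum>s\<le>j. k (j - s) * a s) + b j))"
    using le E by (intro sum_mono mult_left_mono) auto
  also have "\<dots> = (\<Sum>j\<le>J. \<Sum>s\<le>j. (k (j - s) * E ^ (j - s)) * (E ^ s * a s)) + (\<Sum>j\<le>J. E ^ j * b j)"
  proof -
    have "E ^ j * (k (j - s) * a s) = (k (j - s) * E ^ (j - s)) * (E ^ s * a s)" if "s \<le> j" for s j
      using power_add[of E "j - s" s] that by simp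
    then have "(\<Sum>j\<le>J. \<Sum>s\<le>j. E ^ j * (k (j - s) * a s))
      = (\<Sum>j\<le>J. \<Sum>s\<le>j. (k (j - s) * E ^ (j - s)) * (E ^ s * a s))"
      by (intro sum.cong refl) auto
    then show ?thesis
      by (simp add: distrib_left sum.distrib sum_distrib_left)
  qed
  also have "(\<Sum>j\<le>J. \<Sum>s\<le>j. (k (j - s) * E ^ (j - s)) * (E ^ s * a s))
     = (\<Sum>s\<le>J. \<Sum>n\<le>J - s. (k n * E ^ n) * (E ^ s * a s))"
  proof -
    \<comment> \<open>The triangle \<open>s \<le> j \<le> J\<close> is summed along the lag
      \<open>n = j - s\<close>, with \<open>s\<close> held fixed.\<close>
    have "(\<Sum>j\<le>J. \<Sum>s\<le>j. (k (j - s) * E ^ (j - s)) * (E ^ s * a s))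
      = (\<Sum>(s, n) \<in> (SIGMA s:{..J}. {..J-s}). (k n * E ^ n) * (E ^ s * a s))"
      unfolding sum.Sigma[OF finite_atMost ballI[OF finite_atMost]]
      by (rule sum.reindex_bij_witness[where i = "\<lambda>(s, n). (s + n, s)" and j = "\<lambda>(j, s). (s, j - s)"]) auto
    then show ?thesis by (simp add: sum.Sigma)
  qed
  also have "\<dots> \<le> (\<Sum>s\<le>J. 1 / 2 * (E ^ s * a s))"
  proof (rule sum_mono)
    fix s
    have "(\<Sum>n\<le>J - s. k n * E ^ n) \<le> (\<Sum>n\<le>J. k n * E ^ n)"
      using k E by (intro sum_mono2) auto
    then have "(\<Sum>n\<le>J - s. k n * E ^ n) * (E ^ s * a s) \<le> 1 / 2 * (E ^ s * a s)"
      using small a[of s] E by (intro mult_right_mono) auto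
    then show "(\<Sum>n\<le>J - s. (k n * E ^ n) * (E ^ s * a s)) \<le> 1 / 2 * (E ^ s * a s)"
      by (simp add: sum_distrib_right)
  qed
  finally show ?thesis unfolding sum_distrib_left[symmetric] by linarith
qed

section \<open>The kernel of the discrete fractional derivative\<close>

lemma frac_coeff_nonneg:
  assumes "\<alpha> < 1"
  shows "frac_coeff \<alpha> n \<ge> 0"
proof (cases "n = 0")
  case False
  then show ?thesis using assms by (auto simp: frac_coeff_def intro!: powr_mono2)
qed (simp add: frac_coeff_def)

text \<open>The sum telescopes, the special value at 0 being
  \<open>(1/2) powr (1 - \<alpha>)\<close>. Multiplied by \<open>\<tau> powr (1 - \<alpha>)\<close>
  it becomes a power of elapsed time, which makes the kernel summable uniformly in
  \<open>\<tau>\<close>.\<close>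

lemma sum_frac_coeff:
  "(\<Sum>n\<le>p. frac_coeff \<alpha> n) = (real p + 1/2) powr (1 - \<alpha>)"
  by (induction p) (auto simp: frac_coeff_def powr_divide add.commute)

text \<open>The kernel mass accumulated up to time \<open>x\<close> is of the order
  \<open>x + x powr (1 - \<alpha>)\<close>, which is small for small \<open>x\<close>. Up to time
  \<open>\<delta>\<close> it is made at most \<open>1 / 4\<close> by the choice of
  \<open>\<delta>\<close> alone; beyond \<open>\<delta>\<close> the weight is at most
  \<open>exp (- \<nu> * \<delta>)\<close>, and a large \<open>\<nu>\<close> makes that part at most
  \<open>1 / 4\<close> as well.\<close>

lemma kernel_sum_small:
  fixes \<alpha> T C :: real
  assumes "0 < \<alpha>" "\<alpha> < 1" "T > 0" "C \<ge> 0"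
  shows "\<exists>\<tau>0>0. \<exists>\<nu>\<ge>0. \<forall>\<tau> J. 0 < \<tau> \<and> \<tau> \<le> \<tau>0 \<and> real J * \<tau> \<le> T \<longrightarrow>
    (\<Sum>n\<le>J. C * (\<tau> + \<tau> powr (1 - \<alpha>) * frac_coeff \<alpha> n) * exp (- \<nu> * \<tau>) ^ n) \<le> 1 / 2"
proof -
  define G where "G x = x + x powr (1 - \<alpha>)" for x :: real
  have G_mono: "G x \<le> G y" if "0 \<le> x" "x \<le> y" for x y
    unfolding G_def using that assms(2) by (intro add_mono powr_mono2) auto
  \<comment> \<open>The exponent \<open>1 / (1 - \<alpha>)\<close> inverts the power in
    \<open>G\<close>, and \<open>2 * \<delta> \<le> 1\<close> makes the linear part of
    \<open>G\<close> the smaller one. The argument is \<open>2 * \<delta>\<close> because the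
    indices \<open>n \<le> p\<close> with \<open>p * \<tau> \<le> \<delta>\<close> fill a time
    \<open>(p + 1) * \<tau> \<le> 2 * \<delta>\<close>.\<close>
  define \<delta> where "\<delta> = min 1 ((1 / (8 * (C + 1))) powr (1 / (1 - \<alpha>))) / 2"
  have \<delta>: "\<delta> > 0" using assms by (simp add: \<delta>_def)
  have G\<delta>: "C * G (2 * \<delta>) \<le> 1 / 4"
  proof -
    have "(2 * \<delta>) powr (1 - \<alpha>) \<le> ((1 / (8 * (C + 1))) powr (1 / (1 - \<alpha>))) powr (1 - \<alpha>)"
      using \<delta> assms by (intro powr_mono2) (auto simp: \<delta>_def)
    also have "\<dots> = 1 / (8 * (C + 1))" using assms by (simp add: powr_powr)
    finally have 1: "(2 * \<delta>) powr (1 - \<alpha>) \<le> 1 / (8 * (C + 1))" .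
    have "2 * \<delta> \<le> (2 * \<delta>) powr (1 - \<alpha>)"
      using \<delta> assms powr_mono'[of "1 - \<alpha>" 1 "2 * \<delta>"] by (auto simp: \<delta>_def)
    moreover have "1 / (4 * (C + 1)) = 2 * (1 / (8 * (C + 1)))" using assms by (simp add: field_simps)
    moreover have "u \<le> v \<Longrightarrow> v \<le> e \<Longrightarrow> e' = 2 * e \<Longrightarrow> u + v \<le> e'" for u v e e' :: real by simp
    ultimately have "G (2 * \<delta>) \<le> 1 / (4 * (C + 1))" using 1 unfolding G_def by blast
    then have "C * G (2 * \<delta>) \<le> C * (1 / (4 * (C + 1)))" using assms by (intro mult_left_mono) auto
    also have "\<dots> \<le> 1 / 4" using assms by (simp add: field_simps)
    finally show ?thesis .
  qed
  \<comment> \<open>\<open>B\<close> bounds the total unweighted mass, \<open>J + 1\<close> steps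
    taking a time of at most \<open>T + \<tau> \<le> 2 * T\<close>. With
    \<open>\<nu> * \<delta> = 4 * B\<close> the damping follows from
    \<open>4 * B \<le> exp (4 * B)\<close>.\<close>
  define B where "B = C * G (2 * T)"
  define \<nu> where "\<nu> = 4 * B / \<delta>"
  have B0: "B \<ge> 0" using assms by (simp add: B_def G_def)
  have \<nu>0: "\<nu> \<ge> 0" using B0 \<delta> by (simp add: \<nu>_def)
  have B\<nu>: "exp (- \<nu> * \<delta>) * B \<le> 1 / 4"
  proof -
    have "4 * B \<le> exp (4 * B)" using exp_ge_add_one_self[of "4 * B"] by linarith
    moreover have "\<nu> * \<delta> = 4 * B" using \<delta> by (simp add: \<nu>_def)
    ultimately show ?thesis by (simp add: exp_minus field_simps)
  qed
  have main: "(\<Sum>n\<le>J. C * (\<tau> + \<tau> powr (1 - \<alpha>) * frac_coeff \<alpha> n) * exp (- \<nu> * \<tau>) ^ n) \<le> 1 / 2"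
    if \<tau>: "0 < \<tau>" "\<tau> \<le> min \<delta> T" "real J * \<tau> \<le> T" for \<tau> J
  proof -
    define k where "k n = C * (\<tau> + \<tau> powr (1 - \<alpha>) * frac_coeff \<alpha> n)" for n
    have k0: "k n \<ge> 0" for n unfolding k_def using \<tau> assms frac_coeff_nonneg by simp
    have k_sum: "(\<Sum>n\<le>p. k n) \<le> C * G (real (p + 1) * \<tau>)" for p
    proof -
      have "(\<Sum>n\<le>p. k n) = C * (real (p + 1) * \<tau> + (\<tau> * (real p + 1/2)) powr (1 - \<alpha>))"
        using \<tau> by (simp add: k_def sum_frac_coeff powr_mult flip: sum_distrib_left)
          (simp add: sum.distrib sum_frac_coeff flip: sum_distrib_left)
      also have "\<dots> \<le> C * G (real (p + 1) * \<tau>)"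
        unfolding G_def using \<tau> assms
        by (intro mult_left_mono add_mono order_refl powr_mono2) (auto simp: field_simps)
      finally show ?thesis .
    qed
    \<comment> \<open>The last index whose time \<open>p * \<tau>\<close> does not exceed
      \<open>\<delta>\<close>: the near part of the sum keeps its full weight, the far part is
      damped.\<close>
    define p where "p = nat \<lfloor>\<delta> / \<tau>\<rfloor>"
    have p: "real p * \<tau> \<le> \<delta>" 
    proof -
      have "real p \<le> \<delta> / \<tau>" using \<delta> \<tau> by (simp add: p_def)
      then show ?thesis using \<tau> by (simp add: pos_le_divide_eq)
    qed
    have "k n * exp (- \<nu> * \<tau>) ^ n \<le> (if n \<le> p then k n else 0) + exp (- \<nu> * \<delta>) * k n" for n
    proof (cases "n \<le> p")
      case True
      have "exp (- \<nu> * \<tau>) ^ n \<le> 1" using \<nu>0 \<tau> by (intro power_le_one) auto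
      then have "k n * exp (- \<nu> * \<tau>) ^ n \<le> k n * 1" using k0 by (intro mult_left_mono) auto
      moreover have "0 \<le> exp (- \<nu> * \<delta>) * k n" using k0 by simp
      ultimately show ?thesis using True by simp
    next
      case False
      then have "\<delta> / \<tau> < real n" unfolding p_def by linarith
      then have "\<delta> \<le> real n * \<tau>" using \<tau> by (simp add: field_simps)
      then have "\<nu> * \<delta> \<le> \<nu> * (real n * \<tau>)" using \<nu>0 by (rule mult_left_mono)
      then have "exp (- \<nu> * \<tau>) ^ n \<le> exp (- \<nu> * \<delta>)"
        by (simp add: exp_of_nat_mult[symmetric] algebra_simps)
      from mult_left_mono[OF this k0[of n]] show ?thesis using False by (simp add: mult.commute)
    qed
    then have "(\<Sum>n\<le>J. k n * exp (- \<nu> * \<tau>) ^ n)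
      \<le> (\<Sum>n\<le>J. (if n \<le> p then k n else 0) + exp (- \<nu> * \<delta>) * k n)"
      by (intro sum_mono)
    also have "\<dots> = (\<Sum>n\<in>{..J} \<inter> {..p}. k n) + exp (- \<nu> * \<delta>) * (\<Sum>n\<le>J. k n)"
      by (simp add: sum.distrib sum_distrib_left sum.inter_restrict del: Int_atMost)
    also have "\<dots> \<le> (\<Sum>n\<le>p. k n) + exp (- \<nu> * \<delta>) * (\<Sum>n\<le>J. k n)"
      using k0 by (intro add_mono order_refl sum_mono2) auto
    also have "\<dots> \<le> C * G (2 * \<delta>) + exp (- \<nu> * \<delta>) * B"
    proof (intro add_mono mult_left_mono)
      show "(\<Sum>n\<le>p. k n) \<le> C * G (2 * \<delta>)"
        using p \<tau> assms G_mono[of "real (p + 1) * \<tau>" "2 * \<delta>"]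
        by (intro order_trans[OF k_sum] mult_left_mono) (auto simp: algebra_simps)
      show "(\<Sum>n\<le>J. k n) \<le> B"
        using \<tau> assms G_mono[of "real (J + 1) * \<tau>" "2 * T"] unfolding B_def
        by (intro order_trans[OF k_sum] mult_left_mono) (auto simp: algebra_simps)
    qed auto
    finally show ?thesis using G\<delta> B\<nu> by (simp add: k_def)
  qed
  show ?thesis
    using \<delta> assms(3) \<nu>0 main by (intro exI[of _ "min \<delta> T"] exI[of _ \<nu>] conjI) auto
qed

section \<open>The a priori estimate\<close>

text \<open>A bound for the Lebesgue constant: \<open>x\<close> lies in the middle cell, hence
  within \<open>2 * h\<close> of each node, while distinct nodes are at least \<open>h\<close>
  apart. Four basis polynomials with three factors of size at most 2 give
  \<open>4 * 2 ^ 3 = 32\<close>. The condition \<open>i \<ge> 1\<close> keeps the truncated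
  \<open>i - 1\<close> from merging two nodes.\<close>

lemma cubic_interp_le_sup:
  assumes "h > 0" "i \<ge> 1" "real i * h \<le> x" "x \<le> real (i + 1) * h"
    and V: "\<And>r. r \<in> {i - 1..i + 2} \<Longrightarrow> \<bar>V r\<bar> \<le> B"
  shows "\<bar>cubic_interp h V i x\<bar> \<le> 32 * B"
proof -
  define S where "S = {i - 1..i + 2}"
  have fac: "\<bar>(x - real b * h) / (real a * h - real b * h)\<bar> \<le> 2" if "a \<in> S" "b \<in> S - {a}" for a b
  proof -
    have "real i - 1 \<le> real b" "real b \<le> real i + 2" using that assms(2) by (auto simp: S_def)
    then have "(real i - 1) * h \<le> real b * h" "real b * h \<le> (real i + 2) * h"
      using assms(1) by (auto intro: mult_right_mono simp del: mult_le_cancel_right_pos)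
    then have "\<bar>x - real b * h\<bar> \<le> 2 * h" using assms(3,4) by (auto simp: abs_le_iff algebra_simps)
    moreover have "1 \<le> \<bar>real a - real b\<bar>" using that by auto
    then have "h \<le> \<bar>real a - real b\<bar> * h" using assms(1) by simp
    moreover have "\<bar>real a * h - real b * h\<bar> = \<bar>real a - real b\<bar> * h"
      using assms(1) by (simp add: abs_mult flip: left_diff_distrib)
    moreover have "u \<le> 2 * h \<Longrightarrow> h \<le> d \<Longrightarrow> e = d \<Longrightarrow> u \<le> 2 * e" for u d e :: real by simp
    ultimately have "\<bar>x - real b * h\<bar> \<le> 2 * \<bar>real a * h - real b * h\<bar>" by blast
    then show ?thesis by (auto simp: divide_le_eq)
  qed
  have "\<bar>cubic_interp h V i x\<bar> \<le> (\<Sum>a\<in>S. \<bar>V a\<bar> * (\<Prod>b\<in>S - {a}. \<bar>(x - real b * h) / (real a * h - real b * h)\<bar>))"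
    unfolding cubic_interp_def lagrange_def S_def[symmetric]
    by (rule order_trans[OF sum_abs]) (simp add: abs_mult abs_prod)
  also have "\<dots> \<le> (\<Sum>a\<in>S. B * (\<Prod>b\<in>S - {a}. 2))"
  proof (intro sum_mono mult_mono prod_mono conjI)
    fix a assume "a \<in> S"
    then show "\<bar>V a\<bar> \<le> B" by (intro V) (auto simp: S_def)
    show "0 \<le> B" using V[of i] by force
  qed (use fac in \<open>auto intro!: prod_nonneg\<close>)
  also have "\<dots> = 32 * B"
  proof -
    have "card S = 4" using assms(2) by (simp add: S_def)
    then have "(\<Prod>b\<in>S - {a}. 2) = (8::real)" if "a \<in> S" for a
      using that by (simp add: card_Diff_singleton)
    then show ?thesis using \<open>card S = 4\<close> by simp
  qed
  finally show ?thesis .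
qed

section \<open>Linearity of the operators and position of the loading points\<close>

lemma frac_diff_increments:
  "frac_diff \<alpha> \<tau> v j =
     \<tau> powr (1 - \<alpha>) / Gamma (2 - \<alpha>) * (\<Sum>s\<le>j. frac_coeff \<alpha> (j - s) * ((v (s + 1) - v s) / \<tau>))"
  by (simp add: frac_diff_def atLeast0AtMost)

lemma compact_op_lin:
  "compact_op (\<lambda>i. a * u i + b * v i) i = a * compact_op u i + b * compact_op v i"
  by (simp add: compact_op_def algebra_simps add_divide_distrib)

lemma diff_xx_lin:
  "diff_xx h (\<lambda>i. a * u i + b * v i) i = a * diff_xx h u i + b * diff_xx h v i"
  by (simp add: diff_xx_def algebra_simps add_divide_distrib diff_divide_distrib)

lemma xs_mono:
  assumes "\<forall>k\<in>{1..<m}. xs k < xs (k + 1 :: nat)" "1 \<le> i" "i \<le> j" "j \<le> m"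
  shows "xs i \<le> (xs j :: real)"
  using assms(3,4)
proof (induction j)
  case (Suc j)
  show ?case
  proof (cases "i = Suc j")
    case False
    then have "xs i \<le> xs j" "xs j < xs (j + 1)" using Suc assms by auto
    then show ?thesis by simp
  qed simp
qed (use assms in simp)

text \<open>The condition on \<open>h\<close> gives \<open>h < xs k < l - h\<close> for every
  loading point, by monotonicity from the first and the last one. The strict inequalities between
  multiples of \<open>h\<close> turn into \<open>ik k \<ge> 1\<close> and
  \<open>ik k + 2 \<le> N\<close>: all four interpolation nodes lie in the grid.\<close>

lemma admissible_gridD:
  assumes "admissible_grid l m xs N K ik" "l > 0" "m \<ge> 1" "\<forall>k\<in>{1..<m}. xs k < xs (k + 1)"
    and "k \<in> {1..m}"
  shows "ik k \<ge> 1" "ik k + 2 \<le> N" "N \<ge> 3" "K \<ge> 1"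
    "real (ik k) * (l / real N) \<le> xs k" "xs k \<le> real (ik k + 1) * (l / real N)"
proof -
  let ?h = "l / real N"
  have N: "N \<ge> 1" "K \<ge> 1" "?h < xs 1" "?h < l - xs m"
    and ik: "real (ik k) * ?h \<le> xs k" "xs k \<le> real (ik k + 1) * ?h"
    using assms unfolding admissible_grid_def by auto
  have h: "?h > 0" using assms N by simp
  have xk: "?h < xs k" "xs k < l - ?h" using N xs_mono[OF assms(4), of 1 k] xs_mono[OF assms(4), of k m] assms(5) by auto
  have lh: "l = real N * ?h" using N by simp
  have "1 * ?h < real (ik k + 1) * ?h" using xk ik by linarith
  then have 1: "ik k \<ge> 1" using mult_less_cancel_right_pos[OF h, of 1 "real (ik k + 1)"] by simp
  have "real (ik k + 1) * ?h < real N * ?h" using xk ik lh by (simp add: algebra_simps) 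
  then have 2: "ik k + 2 \<le> N" using mult_less_cancel_right_pos[OF h, of "real (ik k + 1)" "real N"] by simp
  show "ik k \<ge> 1" "ik k + 2 \<le> N" "N \<ge> 3" "K \<ge> 1"
    "real (ik k) * (l / real N) \<le> xs k" "xs k \<le> real (ik k + 1) * (l / real N)"
    using 1 2 N ik by auto
qed

text \<open>The index \<open>r\<close> runs up to \<open>N\<close> because \<open>compact_op\<close>
  next to the boundary also reads the load at the end points. Each of the \<open>m\<close> loads
  contributes \<open>c1\<close> times the interpolation constant 32.\<close>

lemma load_le_sup:
  assumes "l > 0" "T > 0" "m \<ge> 1" "\<forall>k\<in>{1..<m}. xs k < xs (k + 1)"
    and q: "\<forall>k\<in>{1..m}. \<forall>x\<in>{0..l}. \<forall>t\<in>{0..T}. \<bar>q k x t\<bar> < c1"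
    and adm: "admissible_grid l m xs N K ik" and "r \<le> N" "j < K"
    and V: "\<And>i. i \<le> N \<Longrightarrow> \<bar>V i\<bar> \<le> B"
  shows "\<bar>\<Sum>k = 1..m. q k (real r * (l / real N)) ((real j + 1/2) * (T / real K))
           * cubic_interp (l / real N) V (ik k) (xs k)\<bar> \<le> 32 * real m * c1 * B"
proof -
  have grid: "real r * (l / real N) \<in> {0..l}" "(real j + 1/2) * (T / real K) \<in> {0..T}"
  proof -
    have "N \<ge> 3" "K \<ge> 1" using admissible_gridD[OF adm assms(1,3,4), of 1] assms(3) by auto
    have "real r * l \<le> real N * l" using assms by (intro mult_right_mono) auto
    then show "real r * (l / real N) \<in> {0..l}" using \<open>N \<ge> 3\<close> assms(1) by (auto simp: field_simps)
    have "(real j + 1/2) * T \<le> real K * T" using assms by (intro mult_right_mono) auto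
    then show "(real j + 1/2) * (T / real K) \<in> {0..T}"
      using \<open>K \<ge> 1\<close> assms(2) by (auto simp: divide_le_eq mult.commute)
  qed
  have "\<bar>\<Sum>k = 1..m. q k (real r * (l / real N)) ((real j + 1/2) * (T / real K))
           * cubic_interp (l / real N) V (ik k) (xs k)\<bar> \<le> (\<Sum>k = 1..m. c1 * (32 * B))"
  proof (intro order_trans[OF sum_abs] sum_mono)
    fix k assume k: "k \<in> {1..m}"
    note g = admissible_gridD[OF adm assms(1,3,4) k]
    have "\<bar>q k (real r * (l / real N)) ((real j + 1/2) * (T / real K))\<bar> \<le> c1"
      using q k grid by (auto intro: less_imp_le)
    moreover have "\<bar>cubic_interp (l / real N) V (ik k) (xs k)\<bar> \<le> 32 * B"
      using g assms(1) by (intro cubic_interp_le_sup V) auto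
    ultimately show "\<bar>q k (real r * (l / real N)) ((real j + 1/2) * (T / real K))
           * cubic_interp (l / real N) V (ik k) (xs k)\<bar> \<le> c1 * (32 * B)"
      unfolding abs_mult by (intro mult_mono) auto
  qed
  then show ?thesis by (simp add: mult_ac)
qed

text \<open>
  The increments are taken with layer 0 replaced by zero, so that they vanish on the boundary
  although the initial layer need not; the initial layer enters as data instead.
\<close>

lemma increment_bound:
  fixes \<alpha> \<mu> l T c1 :: real
  assumes \<alpha>: "0 < \<alpha>" "\<alpha> < 1" and "\<mu> > 0" "l > 0" "T > 0" "m \<ge> 1"
    and xs: "\<forall>k\<in>{1..<m}. xs k < xs (k + 1)"
    and q: "\<forall>k\<in>{1..m}. \<forall>x\<in>{0..l}. \<forall>t\<in>{0..T}. \<bar>q k x t\<bar> < c1"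
    and adm: "admissible_grid l m xs N K ik"
    and h_def: "h = l / real N" and \<tau>_def: "\<tau> = T / real K"
    and eq: "\<And>i. i \<in> {1..N-1} \<Longrightarrow>
      scheme_lhs \<alpha> \<tau> y j i = scheme_rhs \<mu> h \<tau> m xs q (\<lambda>_ _. 0) ik y j i + \<rho> i"
    and bd: "\<And>j. j < K \<Longrightarrow> y (j + 1) 0 = 0 \<and> y (j + 1) N = 0"
    and j: "j < K"
    and S0: "\<And>i. i \<le> N \<Longrightarrow> \<bar>y 0 i\<bar> \<le> S0"
    and z_def: "z = (\<lambda>s. if s = 0 then (\<lambda>_. 0) else y s)"
    and a_def: "a = (\<lambda>s. norm_x h N (\<lambda>i. (z (s + 1) i - z s i) / \<tau>))"
    and \<kappa>_def: "\<kappa> = 1 / Gamma (2 - \<alpha>)"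
  shows "\<mu> * a j \<le> \<tau> * (\<Sum>s\<le>j. a s) + (if j = 0 then (1 / 2 + \<mu> / \<tau>) * norm_x h N (y 0) else 0)
    + l * (\<tau> powr (1 - \<alpha>) * \<kappa> * (l * (\<Sum>s\<le>j. frac_coeff \<alpha> (j - s) * a s) + sqrt l * S0 / \<tau> * frac_coeff \<alpha> j)
       + sqrt l * (32 * real m * c1 * (sqrt l * \<tau> * (\<Sum>s\<le>j. a s) + (if j = 0 then S0 / 2 else 0)))
       + norm0 h N \<rho>)"
proof -
  define w where "w s i = (z (s + 1) i - z s i) / \<tau>" for s i
  \<comment> \<open>\<open>\<iota>\<close> singles out layer 0:
    \<open>y s = z s + \<iota> s * y 0\<close>, so each operator splits into a part on
    \<open>z\<close>, which vanishes at the boundary, and a data term.\<close>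
  define \<iota> where "\<iota> s = (if s = 0 then 1 else 0 :: real)" for s :: nat
  define A where "A = (\<Sum>s\<le>j. a s)"
  have "N \<ge> 3" "K \<ge> 1" using admissible_gridD[OF adm \<open>l > 0\<close> \<open>m \<ge> 1\<close> xs, of 1] \<open>m \<ge> 1\<close> by auto
  have h: "h > 0" "real N * h = l" and \<tau>: "\<tau> > 0"
    using \<open>N \<ge> 3\<close> \<open>K \<ge> 1\<close> \<open>l > 0\<close> \<open>T > 0\<close> by (auto simp: h_def \<tau>_def)
  have h0: "h \<ge> 0" using h by simp
  have \<kappa>0: "\<kappa> > 0" unfolding \<kappa>_def using \<alpha> by (simp add: Gamma_real_pos)
  have c1: "c1 > 0" using q \<open>m \<ge> 1\<close> \<open>l > 0\<close> \<open>T > 0\<close>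
    by (metis abs_ge_zero atLeastAtMost_iff le_less_trans less_imp_le order_refl)
  have S0_nonneg: "S0 \<ge> 0" using S0[of 0] by simp
  have a_w: "a s = norm_x h N (w s)" for s by (simp add: a_def w_def[abs_def])
  have a0: "a s \<ge> 0" for s using h0 by (simp add: a_w norm_x_nonneg)
  have w_bd: "w s 0 = 0" "w s N = 0" if "s \<le> j" for s
    using bd[of s] bd[of "s - 1"] that j by (auto simp: w_def z_def)
  have yz: "y s i = z s i + \<iota> s * y 0 i" for s i by (simp add: z_def \<iota>_def)
  have z_sum: "z n i = (\<Sum>s<n. \<tau> * w s i)" for n i
    using \<tau> sum_lessThan_telescope[of "\<lambda>s. z s i" n] by (simp add: w_def z_def)
  have z_norm: "norm_x h N (z n) \<le> \<tau> * (\<Sum>s<n. a s)" for n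
  proof -
    have "norm_x h N (z n) = norm_x h N (\<lambda>i. \<Sum>s<n. \<tau> * w s i)" using z_sum[of n, abs_def] by metis
    also have "\<dots> \<le> (\<Sum>s<n. norm_x h N (\<lambda>i. \<tau> * w s i))" by (rule norm_x_sum[OF h0])
    also have "\<dots> = \<tau> * (\<Sum>s<n. a s)" using \<tau> by (simp add: norm_x_scale a_w sum_distrib_left)
    finally show ?thesis .
  qed
  have avg_norm: "norm_x h N (time_avg z j) \<le> \<tau> * A"
  proof -
    have "norm_x h N (time_avg z j) = norm_x h N (\<lambda>i. 1/2 * z (j + 1) i + 1/2 * z j i)"
      by (simp add: time_avg_def[abs_def] add_divide_distrib)
    also have "\<dots> \<le> norm_x h N (\<lambda>i. 1/2 * z (j + 1) i) + norm_x h N (\<lambda>i. 1/2 * z j i)"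
      by (rule norm_x_triangle[OF h0])
    also have "\<dots> \<le> 1/2 * (\<tau> * A) + 1/2 * (\<tau> * A)"
    proof (unfold norm_x_scale, intro add_mono)
      have "(\<Sum>s<j. a s) \<le> A" unfolding A_def using a0 by (intro sum_mono2) auto
      then have "norm_x h N (z j) \<le> \<tau> * A"
        using z_norm[of j] \<tau> by (meson mult_left_mono less_imp_le order_trans)
      then show "\<bar>1/2\<bar> * norm_x h N (z j) \<le> 1/2 * (\<tau> * A)" by simp
      show "\<bar>1/2\<bar> * norm_x h N (z (j + 1)) \<le> 1/2 * (\<tau> * A)"
        using z_norm[of "j + 1"] by (simp add: A_def lessThan_Suc_atMost)
    qed
    also have "\<dots> = \<tau> * A" by simp
    finally show ?thesis .
  qed
  have avg_y: "time_avg y j i = time_avg z j i + \<iota> j / 2 * y 0 i" for i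
    by (simp add: time_avg_def yz[of j] add_divide_distrib) (simp add: z_def)
  have avg_sup: "\<bar>time_avg y j i\<bar> \<le> sqrt l * \<tau> * A + \<iota> j * (S0 / 2)" if "i \<le> N" for i
  proof -
    have "time_avg z j 0 = 0" using bd[of j] bd[of "j - 1"] j by (auto simp: time_avg_def z_def)
    then have "\<bar>time_avg z j i\<bar> \<le> sqrt l * norm_x h N (time_avg z j)"
      using sup_le_norm_x[of h i N "time_avg z j"] h that by simp
    also have "\<dots> \<le> sqrt l * (\<tau> * A)" using \<open>l > 0\<close> avg_norm by (intro mult_left_mono) auto
    finally have "\<bar>time_avg z j i\<bar> \<le> sqrt l * \<tau> * A" by simp
    moreover have "\<bar>\<iota> j / 2 * y 0 i\<bar> \<le> \<iota> j * (S0 / 2)" using S0[OF that] by (simp add: \<iota>_def)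
    ultimately show ?thesis unfolding avg_y by linarith
  qed
  \<comment> \<open>For \<open>j = 0\<close> the time difference quotient of \<open>y\<close> is
    \<open>w 0\<close> minus \<open>y 0 / \<tau>\<close>. The surplus is shifted into
    \<open>p\<close>, so that the operator with the factor \<open>\<mu>\<close> acts on
    \<open>w\<close> alone.\<close>
  define p where "p i = time_avg y j i - \<iota> j * (\<mu> / \<tau>) * y 0 i" for i
  have p_norm: "norm_x h N p \<le> \<tau> * A + \<iota> j * ((1 / 2 + \<mu> / \<tau>) * norm_x h N (y 0))"
  proof -
    have "p = (\<lambda>i. time_avg z j i + \<iota> j * (1 / 2 - \<mu> / \<tau>) * y 0 i)"
      by (simp add: p_def fun_eq_iff avg_y algebra_simps)
    then have "norm_x h N p \<le> norm_x h N (time_avg z j) + \<bar>\<iota> j * (1 / 2 - \<mu> / \<tau>)\<bar> * norm_x h N (y 0)"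
      using norm_x_triangle[OF h0, of N "time_avg z j" "\<lambda>i. \<iota> j * (1 / 2 - \<mu> / \<tau>) * y 0 i"]
      by (simp add: norm_x_scale)
    moreover have "\<bar>\<iota> j * (1 / 2 - \<mu> / \<tau>)\<bar> \<le> \<iota> j * (1 / 2 + \<mu> / \<tau>)"
      using \<open>\<mu> > 0\<close> \<tau> by (simp add: \<iota>_def abs_le_iff)
    then have "\<bar>\<iota> j * (1 / 2 - \<mu> / \<tau>)\<bar> * norm_x h N (y 0) \<le> \<iota> j * (1 / 2 + \<mu> / \<tau>) * norm_x h N (y 0)"
      using h0 by (intro mult_right_mono) (auto simp: norm_x_nonneg)
    ultimately show ?thesis using avg_norm by (simp add: mult.assoc)
  qed
  define L where "L = compact_op (\<lambda>r. \<Sum>k = 1..m. q k (real r * h) ((real j + 1/2) * \<tau>)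
                        * cubic_interp h (time_avg y j) (ik k) (xs k))"
  define F where "F i = scheme_lhs \<alpha> \<tau> y j i" for i
  define g where "g i = F i + (-1) * (L i + \<rho> i)" for i
  have energy: "\<mu> * norm_x h N (w j) \<le> norm_x h N p + real N * h * norm0 h N g"
  proof (rule energy_step)
    show "w j 0 = 0" "w j N = 0" using w_bd by auto
    fix i assume i: "i \<in> {1..N-1}"
    have "diff_xx h p i + \<mu> * diff_xx h (w j) i
        = diff_xx h (time_avg y j) i + \<mu> * ((diff_xx h (y (j + 1)) i - diff_xx h (y j) i) / \<tau>)"
    proof -
      have "p = (\<lambda>i. 1 * time_avg y j i + (- \<iota> j * (\<mu> / \<tau>)) * y 0 i)" by (simp add: p_def fun_eq_iff)
      then have 1: "diff_xx h p i = diff_xx h (time_avg y j) i - \<iota> j * (\<mu> / \<tau>) * diff_xx h (y 0) i"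
        by (simp only: diff_xx_lin) 
      have "w j = (\<lambda>i. 1 / \<tau> * y (j + 1) i + 1 * (- 1 / \<tau> * y j i + \<iota> j / \<tau> * y 0 i))"
        by (simp add: w_def fun_eq_iff z_def \<iota>_def diff_divide_distrib)
      then have 2: "diff_xx h (w j) i = diff_xx h (y (j + 1)) i / \<tau> - diff_xx h (y j) i / \<tau> + \<iota> j / \<tau> * diff_xx h (y 0) i"
        by (simp only: diff_xx_lin) simp
      show ?thesis unfolding 1 2 by (simp add: field_simps diff_divide_distrib)
    qed
    moreover have "F i = scheme_rhs \<mu> h \<tau> m xs q (\<lambda>_ _. 0) ik y j i + \<rho> i"
      using eq[OF i] by (simp add: F_def)
    ultimately show "g i = diff_xx h p i + \<mu> * diff_xx h (w j) i"
      by (simp add: g_def scheme_rhs_def L_def compact_op_def)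
  qed (use h \<open>N \<ge> 3\<close> \<open>\<mu> > 0\<close> in auto)
  have F_norm: "norm0 h N F \<le> \<tau> powr (1 - \<alpha>) * \<kappa> *
     (l * (\<Sum>s\<le>j. frac_coeff \<alpha> (j - s) * a s) + sqrt l * S0 / \<tau> * frac_coeff \<alpha> j)"
  proof -
    define c where "c n = frac_coeff \<alpha> n" for n
    have c0: "c n \<ge> 0" for n using frac_coeff_nonneg \<alpha> by (simp add: c_def)
    have inc: "(compact_op (y (s + 1)) i - compact_op (y s) i) / \<tau>
        = compact_op (w s) i + (- \<iota> s / \<tau>) * compact_op (y 0) i" for s i
    proof -
      have "w s = (\<lambda>i. 1 / \<tau> * y (s + 1) i + 1 * (- 1 / \<tau> * y s i + \<iota> s / \<tau> * y 0 i))"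
        by (simp add: w_def fun_eq_iff z_def \<iota>_def diff_divide_distrib)
      then have "compact_op (w s) i = compact_op (y (s + 1)) i / \<tau> - compact_op (y s) i / \<tau> + \<iota> s / \<tau> * compact_op (y 0) i"
        by (simp only: compact_op_lin) simp
      then show ?thesis by (simp add: diff_divide_distrib)
    qed
    have F_eq: "F i = \<tau> powr (1 - \<alpha>) * \<kappa> * ((\<Sum>s\<le>j. c (j - s) * compact_op (w s) i) + (- c j / \<tau>) * compact_op (y 0) i)" for i
    proof -
      \<comment> \<open>Only the first increment differs between \<open>y\<close> and
        \<open>z\<close>; a single summand survives, with the coefficient
        \<open>c j\<close>.\<close>
      have "(\<Sum>s\<le>j. c (j - s) * ((- \<iota> s / \<tau>) * compact_op (y 0) i))
         = (\<Sum>s\<le>j. if s = 0 then (- c j / \<tau>) * compact_op (y 0) i else 0)"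
        by (intro sum.cong) (auto simp: \<iota>_def)
      also have "\<dots> = (- c j / \<tau>) * compact_op (y 0) i" by simp
      finally show ?thesis
        unfolding F_def scheme_lhs_def frac_diff_increments inc c_def[symmetric] distrib_left sum.distrib
        by (simp add: \<kappa>_def distrib_left)
    qed
    have "norm0 h N F = \<bar>\<tau> powr (1 - \<alpha>) * \<kappa>\<bar> *
      norm0 h N (\<lambda>i. (\<Sum>s\<le>j. c (j - s) * compact_op (w s) i) + (- c j / \<tau>) * compact_op (y 0) i)"
      unfolding norm0_scale[symmetric] by (rule arg_cong[where f = "norm0 h N"], rule ext, rule F_eq)
    also have "\<bar>\<tau> powr (1 - \<alpha>) * \<kappa>\<bar> = \<tau> powr (1 - \<alpha>) * \<kappa>" using \<kappa>0 by simp
    also have "\<tau> powr (1 - \<alpha>) * \<kappa> * norm0 h N (\<lambda>i. (\<Sum>s\<le>j. c (j - s) * compact_op (w s) i) + (- c j / \<tau>) * compact_op (y 0) i)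
       \<le> \<tau> powr (1 - \<alpha>) * \<kappa> * (norm0 h N (\<lambda>i. \<Sum>s\<le>j. c (j - s) * compact_op (w s) i)
         + c j / \<tau> * norm0 h N (compact_op (y 0)))"
    proof (rule mult_left_mono)
      have "\<bar>- c j / \<tau>\<bar> = c j / \<tau>" using c0[of j] \<tau> by simp
      then show "norm0 h N (\<lambda>i. (\<Sum>s\<le>j. c (j - s) * compact_op (w s) i) + (- c j / \<tau>) * compact_op (y 0) i)
        \<le> norm0 h N (\<lambda>i. \<Sum>s\<le>j. c (j - s) * compact_op (w s) i) + c j / \<tau> * norm0 h N (compact_op (y 0))"
        using norm0_triangle[OF h0, of N "\<lambda>i. \<Sum>s\<le>j. c (j - s) * compact_op (w s) i" "\<lambda>i. (- c j / \<tau>) * compact_op (y 0) i"]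
        unfolding norm0_scale by metis
    qed (use \<kappa>0 in auto)
    also have "\<dots> \<le> \<tau> powr (1 - \<alpha>) * \<kappa> * (l * (\<Sum>s\<le>j. c (j - s) * a s) + c j / \<tau> * (sqrt l * S0))"
    proof (intro mult_left_mono add_mono)
      have "norm0 h N (\<lambda>i. \<Sum>s\<le>j. c (j - s) * compact_op (w s) i)
         \<le> (\<Sum>s\<le>j. norm0 h N (\<lambda>i. c (j - s) * compact_op (w s) i))"
        by (rule norm0_sum[OF h0])
      also have "\<dots> = (\<Sum>s\<le>j. c (j - s) * norm0 h N (compact_op (w s)))"
        using c0 by (simp add: norm0_scale)
      also have "\<dots> \<le> (\<Sum>s\<le>j. c (j - s) * (l * a s))"
      proof (intro sum_mono mult_left_mono c0)
        fix s assume "s \<in> {..j}"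
        then have "norm0 h N (compact_op (w s)) \<le> sqrt (real N * h) * (sqrt (real N * h) * norm_x h N (w s))"
          using w_bd h h0 by (intro norm0_compact_op_le_sup sup_le_norm_x) (auto simp: norm_x_nonneg)
        then show "norm0 h N (compact_op (w s)) \<le> l * a s"
          using h \<open>l > 0\<close> by (simp add: a_w flip: mult.assoc)
      qed
      finally show "norm0 h N (\<lambda>i. \<Sum>s\<le>j. c (j - s) * compact_op (w s) i) \<le> l * (\<Sum>s\<le>j. c (j - s) * a s)"
        by (simp add: sum_distrib_left mult_ac)
      show "norm0 h N (compact_op (y 0)) \<le> sqrt l * S0"
        using norm0_compact_op_le_sup[of h S0 N "y 0"] S0 S0_nonneg h h0 by simp
    qed (use c0 \<tau> \<kappa>0 in auto)
    finally show ?thesis by (simp add: c_def mult_ac)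
  qed
  have L_norm: "norm0 h N L \<le> sqrt l * (32 * real m * c1 * (sqrt l * \<tau> * A + \<iota> j * (S0 / 2)))"
  proof -
    define B where "B = sqrt l * \<tau> * A + \<iota> j * (S0 / 2)"
    have "A \<ge> 0" unfolding A_def using a0 by (simp add: sum_nonneg)
    then have "B \<ge> 0" unfolding B_def using \<open>l > 0\<close> \<tau> S0_nonneg by (simp add: \<iota>_def)
    have "norm0 h N L \<le> sqrt (real N * h) * (32 * real m * c1 * B)"
      unfolding L_def
    proof (rule norm0_compact_op_le_sup[OF h0])
      show "0 \<le> 32 * real m * c1 * B" using \<open>B \<ge> 0\<close> c1 by simp
      show "\<bar>\<Sum>k = 1..m. q k (real r * h) ((real j + 1/2) * \<tau>) * cubic_interp h (time_avg y j) (ik k) (xs k)\<bar>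
          \<le> 32 * real m * c1 * B" if "r \<le> N" for r
        unfolding h_def \<tau>_def
        by (rule load_le_sup[OF \<open>l > 0\<close> \<open>T > 0\<close> \<open>m \<ge> 1\<close> xs q adm that j]) (unfold B_def, rule avg_sup)
    qed
    then show ?thesis using h by (simp add: B_def)
  qed
  have "norm0 h N g \<le> norm0 h N F + (norm0 h N L + norm0 h N \<rho>)"
  proof -
    have "norm0 h N g \<le> norm0 h N F + norm0 h N (\<lambda>i. (-1) * (L i + \<rho> i))"
      unfolding g_def by (rule norm0_triangle[OF h0])
    also have "norm0 h N (\<lambda>i. (-1) * (L i + \<rho> i)) = norm0 h N (\<lambda>i. L i + \<rho> i)"
      unfolding norm0_scale by simp
    also have "\<dots> \<le> norm0 h N L + norm0 h N \<rho>" by (rule norm0_triangle[OF h0])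
    finally show ?thesis by simp
  qed
  then have "norm0 h N g \<le> \<tau> powr (1 - \<alpha>) * \<kappa> * (l * (\<Sum>s\<le>j. frac_coeff \<alpha> (j - s) * a s) + sqrt l * S0 / \<tau> * frac_coeff \<alpha> j)
       + sqrt l * (32 * real m * c1 * (sqrt l * \<tau> * A + \<iota> j * (S0 / 2))) + norm0 h N \<rho>"
    using F_norm L_norm by linarith
  then have "\<mu> * a j \<le> \<tau> * A + \<iota> j * ((1 / 2 + \<mu> / \<tau>) * norm_x h N (y 0)) +
    l * (\<tau> powr (1 - \<alpha>) * \<kappa> * (l * (\<Sum>s\<le>j. frac_coeff \<alpha> (j - s) * a s) + sqrt l * S0 / \<tau> * frac_coeff \<alpha> j)
       + sqrt l * (32 * real m * c1 * (sqrt l * \<tau> * A + \<iota> j * (S0 / 2))) + norm0 h N \<rho>)"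
    using energy p_norm h \<open>l > 0\<close> mult_left_mono[of "norm0 h N g" _ l] unfolding a_w[of j] by fastforce
  then show ?thesis unfolding A_def \<iota>_def by (cases "j = 0") simp_all
qed

text \<open>\<open>increment_bound\<close> gives the recursion that \<open>weighted_gronwall\<close>
  solves, with the kernel mass supplied by \<open>kernel_sum_small\<close>. As layer 0 of
  \<open>z\<close> is zero, each later layer is \<open>\<tau>\<close> times the sum of the
  increments before it, so a bound on the sum of their norms is all that is required.\<close>

lemma residual_estimate:
  fixes \<alpha> \<mu> l T c1 :: real
  assumes \<alpha>: "0 < \<alpha>" "\<alpha> < 1" and "\<mu> > 0" "l > 0" "T > 0" "m \<ge> 1"
    and xs: "\<forall>k\<in>{1..<m}. xs k < xs (k + 1)"
    and q: "\<forall>k\<in>{1..m}. \<forall>x\<in>{0..l}. \<forall>t\<in>{0..T}. \<bar>q k x t\<bar> < c1"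
  shows "\<exists>\<tau>0>0. \<exists>M>0. \<forall>N K ik y \<rho>.
    admissible_grid l m xs N K ik \<and> T / real K \<le> \<tau>0 \<and>
    (\<forall>j<K. \<forall>i\<in>{1..N-1}. scheme_lhs \<alpha> (T / real K) y j i
        = scheme_rhs \<mu> (l / real N) (T / real K) m xs q (\<lambda>_ _. 0) ik y j i + \<rho> j i) \<and>
    (\<forall>j<K. y (j + 1) 0 = 0 \<and> y (j + 1) N = 0) \<longrightarrow>
    (\<forall>j<K. (norm_x (l / real N) N (y (j + 1)))\<^sup>2
       \<le> M * ((\<Sum>j' = 0..j. (norm0 (l / real N) N (\<rho> j'))\<^sup>2 * (T / real K))
              + (norm0 (l / real N) N (y 0))\<^sup>2 + (norm_x (l / real N) N (y 0))\<^sup>2))"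
proof -
  define \<kappa> where "\<kappa> = 1 / Gamma (2 - \<alpha>)"
  define Q where "Q = 32 * real m * c1"
  have \<kappa>0: "\<kappa> > 0" unfolding \<kappa>_def using \<alpha> by (simp add: Gamma_real_pos)
  have c1: "c1 > 0" using q \<open>m \<ge> 1\<close> \<open>l > 0\<close> \<open>T > 0\<close>
    by (metis abs_ge_zero atLeastAtMost_iff le_less_trans less_imp_le order_refl)
  then have Q0: "Q \<ge> 0" by (simp add: Q_def)
  \<comment> \<open>One summand for each source of memory: the time average of the solution, the
    loads, and the fractional derivative; the division by \<open>\<mu>\<close> comes from the energy
    inequality.\<close>
  define C where "C = (1 + l * l * Q + l * l * \<kappa>) / \<mu>"
  have C0: "C \<ge> 0" using Q0 \<kappa>0 \<open>l > 0\<close> \<open>\<mu> > 0\<close> by (simp add: C_def)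
  obtain \<tau>0 \<nu> where \<tau>0: "\<tau>0 > 0" and \<nu>0: "\<nu> \<ge> 0"
    and small: "\<And>\<tau> J. 0 < \<tau> \<Longrightarrow> \<tau> \<le> \<tau>0 \<Longrightarrow> real J * \<tau> \<le> T \<Longrightarrow>
      (\<Sum>n\<le>J. C * (\<tau> + \<tau> powr (1 - \<alpha>) * frac_coeff \<alpha> n) * exp (- \<nu> * \<tau>) ^ n) \<le> 1 / 2"
    using kernel_sum_small[OF \<alpha> \<open>T > 0\<close> C0] by blast
  \<comment> \<open>\<open>exp (\<nu> * T)\<close> undoes the weight, 2 comes from the absorption,
    and the bracket collects the coefficients of the data after \<open>\<tau>\<close> times
    summation over the layers.\<close>
  define D where "D = exp (\<nu> * T) * (2 / \<mu>) * (T / 2 + \<mu> + l * \<kappa> * sqrt l * T powr (1 - \<alpha>) + l * sqrt l * Q * T + l)"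
  have D0: "D \<ge> 0" unfolding D_def using \<open>l > 0\<close> \<open>\<mu> > 0\<close> \<open>T > 0\<close> \<kappa>0 Q0 by simp
  define Cs where "Cs = sqrt (2 / l) + sqrt l"
  have Cs0: "Cs \<ge> 0" using \<open>l > 0\<close> by (simp add: Cs_def)
  define P where "P = D * (1 + Cs + sqrt T)"
  have P0: "P \<ge> 0" using D0 Cs0 \<open>T > 0\<close> by (simp add: P_def)
  have main: "(norm_x (l / real N) N (y (J + 1)))\<^sup>2
       \<le> (3 * P\<^sup>2 + 1) * ((\<Sum>j' = 0..J. (norm0 (l / real N) N (\<rho> j'))\<^sup>2 * (T / real K))
              + (norm0 (l / real N) N (y 0))\<^sup>2 + (norm_x (l / real N) N (y 0))\<^sup>2)"
    if adm: "admissible_grid l m xs N K ik" and \<tau>\<tau>0: "T / real K \<le> \<tau>0"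
      and eq: "\<forall>j<K. \<forall>i\<in>{1..N-1}. scheme_lhs \<alpha> (T / real K) y j i
        = scheme_rhs \<mu> (l / real N) (T / real K) m xs q (\<lambda>_ _. 0) ik y j i + \<rho> j i"
      and bd: "\<forall>j<K. y (j + 1) 0 = 0 \<and> y (j + 1) N = 0"
      and J: "J < K" for N K ik y \<rho> J
  proof -
    define h where "h = l / real N"
    define \<tau> where "\<tau> = T / real K"
    have "N \<ge> 3" "K \<ge> 1" using admissible_gridD[OF adm \<open>l > 0\<close> \<open>m \<ge> 1\<close> xs, of 1] \<open>m \<ge> 1\<close> by auto
    have h: "h > 0" "real N * h = l" and \<tau>: "\<tau> > 0" and K: "real K * \<tau> = T"
      using \<open>N \<ge> 3\<close> \<open>K \<ge> 1\<close> \<open>l > 0\<close> \<open>T > 0\<close> by (auto simp: h_def \<tau>_def)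
    have h0: "h \<ge> 0" using h by simp
    have JT: "(real J + 1) * \<tau> \<le> T"
      unfolding K[symmetric] using J \<tau> by (intro mult_right_mono) auto
    have \<tau>T: "\<tau> \<le> T" using JT \<tau> mult_right_mono[of 1 "real J + 1" \<tau>] by linarith
    define n0 where "n0 = norm0 h N (y 0)"
    define Z0 where "Z0 = norm_x h N (y 0)"
    define S0 where "S0 = Cs * (n0 + Z0)"
    have n0: "n0 \<ge> 0" and Z0: "Z0 \<ge> 0"
      using h0 by (auto simp: n0_def Z0_def norm0_nonneg norm_x_nonneg)
    have S0_nonneg: "S0 \<ge> 0" using n0 Z0 Cs0 by (simp add: S0_def)
    have S0: "\<bar>y 0 i\<bar> \<le> S0" if "i \<le> N" for i
    proof -
      have "\<bar>y 0 i\<bar> \<le> sqrt (2 / l) * n0 + sqrt l * Z0"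
        using sup_le_norm0_norm_x[of h i N "y 0"] h that \<open>N \<ge> 3\<close> by (simp add: n0_def Z0_def)
      also have "\<dots> \<le> S0"
        unfolding S0_def Cs_def using n0 Z0 \<open>l > 0\<close> by (simp add: algebra_simps)
      finally show ?thesis .
    qed
    define z where "z = (\<lambda>s. if s = 0 then (\<lambda>_. 0) else y s)"
    define a where "a = (\<lambda>s. norm_x h N (\<lambda>i. (z (s + 1) i - z s i) / \<tau>))"
    have a0: "a s \<ge> 0" for s using h0 by (simp add: a_def norm_x_nonneg)
    define c where "c n = frac_coeff \<alpha> n" for n
    have c0: "c n \<ge> 0" for n using frac_coeff_nonneg \<alpha> by (simp add: c_def)
    define k where "k n = C * (\<tau> + \<tau> powr (1 - \<alpha>) * c n)" for n
    have k0: "k n \<ge> 0" for n unfolding k_def using C0 \<tau> c0 by simp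
    define r where "r j = norm0 h N (\<rho> j)" for j
    have r0: "r j \<ge> 0" for j using h0 by (simp add: r_def norm0_nonneg)
    \<comment> \<open>The data blow up as \<open>\<tau>\<close> tends to 0, like
      \<open>1 / \<tau>\<close> at \<open>j = 0\<close> and like
      \<open>\<tau> powr (- \<alpha>) * c j\<close> in general. The first occurs once and the second
      sums to a power of time, so \<open>\<tau>\<close> times the sum of \<open>b\<close> stays
      bounded.\<close>
    define b where "b j = (1 / \<mu>) * ((if j = 0 then (1 / 2 + \<mu> / \<tau>) * Z0 + l * sqrt l * Q * S0 else 0)
       + l * \<kappa> * sqrt l * S0 * (\<tau> powr (1 - \<alpha>) / \<tau> * c j) + l * r j)" for j
    have b0: "b j \<ge> 0" for j
      unfolding b_def using Z0 S0_nonneg Q0 \<kappa>0 c0 r0 \<tau> \<open>l > 0\<close> \<open>\<mu> > 0\<close> by auto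
    have rec: "a j \<le> (\<Sum>s\<le>j. k (j - s) * a s) + b j" if "j \<le> J" for j
    proof -
      define A where "A = (\<Sum>s\<le>j. a s)"
      define X where "X = \<tau> powr (1 - \<alpha>) * (\<Sum>s\<le>j. c (j - s) * a s)"
      have "A \<ge> 0" "X \<ge> 0" unfolding A_def X_def using a0 c0 by (auto intro!: sum_nonneg mult_nonneg_nonneg)
      have "\<mu> * a j \<le> \<tau> * A + (if j = 0 then (1 / 2 + \<mu> / \<tau>) * Z0 else 0)
        + l * (\<tau> powr (1 - \<alpha>) * \<kappa> * (l * (\<Sum>s\<le>j. c (j - s) * a s) + sqrt l * S0 / \<tau> * c j)
         + sqrt l * (Q * (sqrt l * \<tau> * A + (if j = 0 then S0 / 2 else 0))) + r j)"
        unfolding A_def Q_def r_def c_def Z0_def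
        using that J eq bd
        by (intro increment_bound[OF \<alpha> \<open>\<mu> > 0\<close> \<open>l > 0\<close> \<open>T > 0\<close> \<open>m \<ge> 1\<close> xs q adm h_def \<tau>_def _ _ _ S0 z_def a_def \<kappa>_def])
           (auto simp: h_def \<tau>_def)
      also have "\<dots> = \<tau> * A + l * l * Q * (\<tau> * A) + l * l * \<kappa> * X +
          ((if j = 0 then (1 / 2 + \<mu> / \<tau>) * Z0 + l * sqrt l * Q * (S0 / 2) else 0)
          + l * \<kappa> * sqrt l * S0 * (\<tau> powr (1 - \<alpha>) / \<tau> * c j) + l * r j)"
      proof -
        have ss: "sqrt l * (Q * (sqrt l * \<tau> * A)) = l * Q * (\<tau> * A)"
          using \<open>l > 0\<close> by (simp add: mult_ac flip: mult.assoc[of "sqrt l" "sqrt l"])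
        show ?thesis unfolding distrib_left ss X_def by (simp add: algebra_simps)
      qed
      also have "\<dots> \<le> (1 + l * l * Q + l * l * \<kappa>) * (\<tau> * A + X) + \<mu> * b j"
      proof (rule add_mono)
        have "0 \<le> l * l * \<kappa> * (\<tau> * A)" "0 \<le> (1 + l * l * Q) * X"
          using \<open>A \<ge> 0\<close> \<open>X \<ge> 0\<close> \<tau> \<kappa>0 Q0 by auto
        then show "\<tau> * A + l * l * Q * (\<tau> * A) + l * l * \<kappa> * X
            \<le> (1 + l * l * Q + l * l * \<kappa>) * (\<tau> * A + X)"
          by (simp add: algebra_simps)
        have "l * sqrt l * Q * (S0 / 2) \<le> l * sqrt l * Q * S0"
          using \<open>l > 0\<close> Q0 S0_nonneg by (intro mult_left_mono) auto
        then show "(if j = 0 then (1 / 2 + \<mu> / \<tau>) * Z0 + l * sqrt l * Q * (S0 / 2) else 0)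
          + l * \<kappa> * sqrt l * S0 * (\<tau> powr (1 - \<alpha>) / \<tau> * c j) + l * r j \<le> \<mu> * b j"
          unfolding b_def using \<open>\<mu> > 0\<close> by simp
      qed
      also have "\<dots> = \<mu> * (C * (\<tau> * A + X) + b j)"
        using \<open>\<mu> > 0\<close> by (simp add: C_def distrib_left)
      finally have "a j \<le> C * (\<tau> * A + X) + b j" using \<open>\<mu> > 0\<close> by simp
      moreover have "C * (\<tau> * A + X) = (\<Sum>s\<le>j. k (j - s) * a s)"
        unfolding A_def X_def k_def by (simp add: sum_distrib_left sum.distrib distrib_left distrib_right mult_ac)
      ultimately show ?thesis by simp
    qed
    define E where "E = exp (- \<nu> * \<tau>)"
    have E: "E > 0" "E \<le> 1" unfolding E_def using \<nu>0 \<tau> by auto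
    have "(\<Sum>n\<le>J. k n * E ^ n) \<le> 1 / 2"
      unfolding k_def c_def E_def using \<tau> \<tau>\<tau>0 JT
      by (intro small) (auto simp: \<tau>_def[symmetric] algebra_simps)
    then have gron: "(\<Sum>j\<le>J. E ^ j * a j) \<le> 2 * (\<Sum>j\<le>J. E ^ j * b j)"
      using a0 k0 E rec by (intro weighted_gronwall) auto
    \<comment> \<open>The weights are simply dropped on the data side, as \<open>E \<le> 1\<close>;
      on the other side they are bounded below by \<open>exp (- \<nu> * T)\<close>.\<close>
    have "(\<Sum>j\<le>J. E ^ j * b j) \<le> (\<Sum>j\<le>J. 1 * b j)"
      using E b0 by (intro sum_mono mult_right_mono power_le_one) auto
    with gron have gron': "(\<Sum>j\<le>J. E ^ j * a j) \<le> 2 * (\<Sum>j\<le>J. b j)" by simp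
    define R where "R = (\<Sum>j\<le>J. \<tau> * r j)"
    have R0: "R \<ge> 0" unfolding R_def using \<tau> r0 by (auto intro!: sum_nonneg)
    have b_sum: "\<tau> * (\<Sum>j\<le>J. b j) \<le> (1 / \<mu>) * ((T / 2 + \<mu> + l * \<kappa> * sqrt l * T powr (1 - \<alpha>) + l * sqrt l * Q * T + l) * (Z0 + S0 + R))"
    proof -
      \<comment> \<open>The trace of the initial layer in the fractional derivative: the
        coefficients telescope to the power of the time
        \<open>(J + 1/2) * \<tau> \<le> T\<close>.\<close>
      have csum: "\<tau> powr (1 - \<alpha>) * (\<Sum>j\<le>J. c j) \<le> T powr (1 - \<alpha>)"
      proof -
        have "\<tau> powr (1 - \<alpha>) * (\<Sum>j\<le>J. c j) = (\<tau> * (real J + 1/2)) powr (1 - \<alpha>)"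
          unfolding c_def sum_frac_coeff using \<tau> by (simp add: powr_mult)
        also have "\<dots> \<le> T powr (1 - \<alpha>)"
          using \<tau> JT \<alpha> by (intro powr_mono2) (auto simp: algebra_simps)
        finally show ?thesis .
      qed
      have "\<tau> * (\<Sum>j\<le>J. b j) = (1 / \<mu>) * (\<tau> * ((1 / 2 + \<mu> / \<tau>) * Z0 + l * sqrt l * Q * S0)
         + l * \<kappa> * sqrt l * S0 * (\<tau> powr (1 - \<alpha>) * (\<Sum>j\<le>J. c j)) + l * R)"
      proof -
        have "(\<Sum>j\<le>J. b j) = (1 / \<mu>) * ((1 / 2 + \<mu> / \<tau>) * Z0 + l * sqrt l * Q * S0
         + l * \<kappa> * sqrt l * S0 * (\<tau> powr (1 - \<alpha>) / \<tau> * (\<Sum>j\<le>J. c j)) + l * (\<Sum>j\<le>J. r j))"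
          unfolding b_def sum_distrib_left[symmetric] sum.distrib by (simp add: sum_distrib_left)
        then show ?thesis using \<tau> by (simp add: R_def distrib_left flip: sum_distrib_left)
      qed
      also have "\<dots> \<le> (1 / \<mu>) * ((T / 2 + \<mu>) * Z0 + l * sqrt l * Q * T * S0
         + l * \<kappa> * sqrt l * T powr (1 - \<alpha>) * S0 + l * R)"
      proof (intro mult_left_mono add_mono order_refl)
        have "\<tau> * ((1 / 2 + \<mu> / \<tau>) * Z0 + l * sqrt l * Q * S0)
          = (\<tau> / 2 + \<mu>) * Z0 + \<tau> * (l * sqrt l * Q * S0)"
          using \<tau> by (simp add: field_simps)
        also have "\<dots> \<le> (T / 2 + \<mu>) * Z0 + T * (l * sqrt l * Q * S0)"
          using \<tau>T Z0 Q0 S0_nonneg \<open>l > 0\<close> by (intro add_mono mult_right_mono) auto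
        finally show "\<tau> * ((1 / 2 + \<mu> / \<tau>) * Z0 + l * sqrt l * Q * S0)
           \<le> (T / 2 + \<mu>) * Z0 + l * sqrt l * Q * T * S0" by (simp add: mult_ac)
        have "l * \<kappa> * sqrt l * S0 * (\<tau> powr (1 - \<alpha>) * (\<Sum>j\<le>J. c j)) \<le> l * \<kappa> * sqrt l * S0 * T powr (1 - \<alpha>)"
          using csum \<open>l > 0\<close> \<kappa>0 S0_nonneg by (intro mult_left_mono) auto
        then show "l * \<kappa> * sqrt l * S0 * (\<tau> powr (1 - \<alpha>) * (\<Sum>j\<le>J. c j))
          \<le> l * \<kappa> * sqrt l * T powr (1 - \<alpha>) * S0" by (simp add: mult_ac)
      qed (use \<open>\<mu> > 0\<close> \<open>l > 0\<close> in auto)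
      also have "\<dots> \<le> (1 / \<mu>) * ((T / 2 + \<mu> + l * \<kappa> * sqrt l * T powr (1 - \<alpha>) + l * sqrt l * Q * T + l) * (Z0 + S0 + R))"
      proof (rule mult_left_mono)
        define u1 where "u1 = T / 2 + \<mu>"
        define u2 where "u2 = l * \<kappa> * sqrt l * T powr (1 - \<alpha>)"
        define u3 where "u3 = l * sqrt l * Q * T"
        have u: "u1 \<ge> 0" "u2 \<ge> 0" "u3 \<ge> 0"
          unfolding u1_def u2_def u3_def using \<open>T > 0\<close> \<open>\<mu> > 0\<close> \<open>l > 0\<close> \<kappa>0 Q0 by auto
        have "u1 * Z0 + u3 * S0 + u2 * S0 + l * R \<le> (u1 + u2 + u3 + l) * (Z0 + S0 + R)"
        proof -
          have "0 \<le> u1 * (S0 + R) + u2 * (Z0 + R) + u3 * (Z0 + R) + l * (Z0 + S0)"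
            using u Z0 S0_nonneg R0 \<open>l > 0\<close> by simp
          then show ?thesis by (simp add: algebra_simps)
        qed
        then show "(T / 2 + \<mu>) * Z0 + l * sqrt l * Q * T * S0
         + l * \<kappa> * sqrt l * T powr (1 - \<alpha>) * S0 + l * R
         \<le> (T / 2 + \<mu> + l * \<kappa> * sqrt l * T powr (1 - \<alpha>) + l * sqrt l * Q * T + l) * (Z0 + S0 + R)"
          by (simp add: u1_def u2_def u3_def)
      qed (use \<open>\<mu> > 0\<close> in auto)
      finally show ?thesis .
    qed
    have EJ: "1 \<le> exp (\<nu> * T) * E ^ s" if "s \<le> J" for s
    proof -
      have "real s * \<tau> \<le> (real J + 1) * \<tau>" using that \<tau> by (intro mult_right_mono) auto
      then have "real s * \<tau> \<le> T" using JT by linarith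
      then have "\<nu> * (real s * \<tau>) \<le> \<nu> * T" using \<nu>0 by (intro mult_left_mono)
      then show ?thesis unfolding E_def by (simp add: exp_of_nat_mult[symmetric] exp_add[symmetric] algebra_simps)
    qed
    have "norm_x h N (y (J + 1)) \<le> D * (Z0 + S0 + R)"
    proof -
      \<comment> \<open>The telescoping starts from zero, since layer 0 of \<open>z\<close> is zero;
        this is exact although \<open>y 0\<close> is not zero.\<close>
      have "y (J + 1) = (\<lambda>i. \<Sum>s\<le>J. \<tau> * ((z (s + 1) i - z s i) / \<tau>))"
        using \<tau> sum_lessThan_telescope[of "\<lambda>s. z s _" "J + 1"]
        by (simp add: z_def fun_eq_iff lessThan_Suc_atMost)
      then have "norm_x h N (y (J + 1)) \<le> (\<Sum>s\<le>J. norm_x h N (\<lambda>i. \<tau> * ((z (s + 1) i - z s i) / \<tau>)))"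
        using norm_x_sum[OF h0, of N "\<lambda>s i. \<tau> * ((z (s + 1) i - z s i) / \<tau>)" "{..J}"] by simp
      also have "\<dots> = \<tau> * (\<Sum>s\<le>J. a s)"
        unfolding norm_x_scale a_def using \<tau> by (simp add: sum_distrib_left)
      also have "(\<Sum>s\<le>J. a s) \<le> (\<Sum>s\<le>J. exp (\<nu> * T) * E ^ s * a s)"
        using EJ a0 by (intro sum_mono) (use mult_right_mono in fastforce)
      also have "\<dots> = exp (\<nu> * T) * (\<Sum>s\<le>J. E ^ s * a s)" by (simp add: sum_distrib_left mult_ac)
      also have "\<dots> \<le> exp (\<nu> * T) * (2 * (\<Sum>j\<le>J. b j))" using gron' by (intro mult_left_mono) auto
      finally have "norm_x h N (y (J + 1)) \<le> exp (\<nu> * T) * 2 * (\<tau> * (\<Sum>j\<le>J. b j))"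
        using \<tau> by (simp add: mult_ac)
      also have "\<dots> \<le> exp (\<nu> * T) * 2 * ((1 / \<mu>) * ((T / 2 + \<mu> + l * \<kappa> * sqrt l * T powr (1 - \<alpha>) + l * sqrt l * Q * T + l) * (Z0 + S0 + R)))"
        using b_sum by (intro mult_left_mono) auto
      also have "\<dots> = D * (Z0 + S0 + R)" by (simp add: D_def)
      finally show ?thesis .
    qed
    also have "\<dots> \<le> P * (n0 + Z0 + sqrt (\<Sum>j\<le>J. (r j)\<^sup>2 * \<tau>))"
    proof -
      define W where "W = sqrt (\<Sum>j\<le>J. (r j)\<^sup>2 * \<tau>)"
      have W0: "W \<ge> 0" unfolding W_def using \<tau> by (simp add: sum_nonneg)
      have "R \<le> sqrt T * W"
      proof -
        \<comment> \<open>Cauchy-Schwarz in time with the weight \<open>\<tau>\<close> split into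
          two roots; the factor \<open>sqrt T\<close> is the root of the elapsed time.\<close>
        have "R = (\<Sum>j\<le>J. \<bar>sqrt \<tau>\<bar> * \<bar>sqrt \<tau> * r j\<bar>)"
          unfolding R_def using \<tau> r0 by (simp add: abs_mult flip: mult.assoc)
        also have "\<dots> \<le> L2_set (\<lambda>_. sqrt \<tau>) {..J} * L2_set (\<lambda>j. sqrt \<tau> * r j) {..J}"
          by (rule L2_set_mult_ineq)
        also have "L2_set (\<lambda>j. sqrt \<tau> * r j) {..J} = W"
          using \<tau> by (simp add: L2_set_def W_def power_mult_distrib mult_ac)
        also have "L2_set (\<lambda>_. sqrt \<tau>) {..J} = sqrt ((real J + 1) * \<tau>)"
          using \<tau> by (simp add: L2_set_def algebra_simps)
        also have "sqrt ((real J + 1) * \<tau>) * W \<le> sqrt T * W"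
          using JT W0 by (intro mult_right_mono) auto
        finally show ?thesis .
      qed
      define Y where "Y = n0 + Z0 + W"
      have Y: "Z0 \<le> Y" "n0 + Z0 \<le> Y" "W \<le> Y"
        using n0 Z0 W0 by (auto simp: Y_def)
      then have "S0 \<le> Cs * Y" "sqrt T * W \<le> sqrt T * Y"
        unfolding S0_def using Cs0 \<open>T > 0\<close> by (auto intro!: mult_left_mono)
      with \<open>R \<le> sqrt T * W\<close> Y have "Z0 + S0 + R \<le> (1 + Cs + sqrt T) * Y"
        unfolding distrib_right by linarith
      then show ?thesis unfolding P_def W_def[symmetric] Y_def[symmetric] mult.assoc using D0 by (intro mult_left_mono)
    qed
    finally have fin: "norm_x h N (y (J + 1)) \<le> P * (n0 + Z0 + sqrt (\<Sum>j\<le>J. (r j)\<^sup>2 * \<tau>))" .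
    define V where "V = (\<Sum>j\<le>J. (r j)\<^sup>2 * \<tau>)"
    have V0: "V \<ge> 0" unfolding V_def using \<tau> by (simp add: sum_nonneg)
    have "(norm_x h N (y (J + 1)))\<^sup>2 \<le> (P * (n0 + Z0 + sqrt V))\<^sup>2"
      using fin h0 unfolding V_def[symmetric] by (intro power_mono) (auto simp: norm_x_nonneg)
    also have "\<dots> \<le> P\<^sup>2 * (3 * (n0\<^sup>2 + Z0\<^sup>2 + V))"
    proof -
      have "(n0 + Z0 + sqrt V)\<^sup>2 \<le> 3 * (n0\<^sup>2 + Z0\<^sup>2 + (sqrt V)\<^sup>2)"
      proof -
        have "0 \<le> (n0 - Z0)\<^sup>2 + (Z0 - sqrt V)\<^sup>2 + (n0 - sqrt V)\<^sup>2" by simp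
        then show ?thesis by (simp add: power2_eq_square algebra_simps)
      qed
      then show ?thesis using V0 by (simp add: power_mult_distrib mult_left_mono)
    qed
    also have "\<dots> \<le> (3 * P\<^sup>2 + 1) * (V + n0\<^sup>2 + Z0\<^sup>2)"
      using V0 by (simp add: algebra_simps)
    finally show ?thesis
      by (simp add: V_def r_def n0_def Z0_def h_def \<tau>_def atLeast0AtMost)
  qed
  \<comment> \<open>The 3 comes from squaring a sum of three terms; the 1 makes the constant
    positive even if \<open>P\<close> vanishes.\<close>
  have "3 * P\<^sup>2 + 1 > 0" using zero_le_power2[of P] by linarith
  with \<tau>0 show ?thesis
    by (intro exI[of _ \<tau>0] exI[of _ "3 * P\<^sup>2 + 1"] conjI allI impI) (assumption, assumption, elim conjE, rule main)
qed

section \<open>Taylor estimates for the difference operators\<close>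

text \<open>The Taylor theorem on convex sets, with one-sided derivatives at the ends of the
  interval. The remainder carries \<open>fact n\<close> instead of \<open>fact (Suc n)\<close>,
  which affects constants and no orders.\<close>

lemma real_Taylor:
  fixes f :: "nat \<Rightarrow> real \<Rightarrow> real"
  assumes "\<And>i x. x \<in> {a..b} \<Longrightarrow> i \<le> n \<Longrightarrow> (f i has_real_derivative f (Suc i) x) (at x within {a..b})"
    and "\<And>x. x \<in> {a..b} \<Longrightarrow> \<bar>f (Suc n) x\<bar> \<le> B"
    and "w \<in> {a..b}" "z \<in> {a..b}"
  shows "\<bar>f 0 z - (\<Sum>i\<le>n. f i w * (z - w) ^ i / fact i)\<bar> \<le> B * \<bar>z - w\<bar> ^ Suc n / fact n"
  using field_Taylor[of "{a..b}" n f B w z] assms by simp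

lemma mean_value_bound:
  fixes f :: "nat \<Rightarrow> real \<Rightarrow> real"
  assumes "\<And>x. x \<in> {a..b} \<Longrightarrow> (f 0 has_real_derivative f 1 x) (at x within {a..b})"
    and "\<And>x. x \<in> {a..b} \<Longrightarrow> \<bar>f 1 x\<bar> \<le> B" "w \<in> {a..b}" "z \<in> {a..b}"
  shows "\<bar>f 0 z - f 0 w\<bar> \<le> B * \<bar>z - w\<bar>"
  using real_Taylor[of a b 0 f B w z] assms by simp

text \<open>The weights \<open>1/12, 10/12, 1/12\<close> are made for this: the average of
  \<open>f 2\<close> and the second difference of \<open>f 0\<close> have the same leading error
  \<open>f 4 x * h\<^sup>2 / 12\<close>, so only Taylor remainders are left. \<open>A\<close> and
  \<open>A'\<close> are these remainders, of orders \<open>h ^ 6\<close> and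
  \<open>h ^ 4\<close>.\<close>

lemma compact_second_difference:
  fixes f :: "nat \<Rightarrow> real \<Rightarrow> real"
  assumes f: "\<And>i x. x \<in> {a..b} \<Longrightarrow> i < 6 \<Longrightarrow> (f i has_real_derivative f (Suc i) x) (at x within {a..b})"
    and B: "\<And>x. x \<in> {a..b} \<Longrightarrow> \<bar>f 6 x\<bar> \<le> B"
    and "h > 0" and x: "x \<in> {a..b}" "x + h \<in> {a..b}" "x - h \<in> {a..b}"
  shows "\<bar>(f 2 (x + h) + 10 * f 2 x + f 2 (x - h)) / 12 - (f 0 (x + h) - 2 * f 0 x + f 0 (x - h)) / h\<^sup>2\<bar> \<le> B * h ^ 4"
proof -
  define A where "A = f 0 (x + h) - 2 * f 0 x + f 0 (x - h) - (f 2 x * h\<^sup>2 + f 4 x * h ^ 4 / 12)"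
  define A' where "A' = f 2 (x + h) + f 2 (x - h) - (2 * f 2 x + f 4 x * h\<^sup>2)"
  have h: "\<bar>h\<bar> = h" "\<bar>- h\<bar> = h" using \<open>h > 0\<close> by auto
  have "B \<ge> 0" using B[OF x(1)] by linarith
  have "\<bar>f 0 (x + h) - (\<Sum>i\<le>5. f i x * h ^ i / fact i)\<bar> \<le> B * h ^ 6 / 120"
    using real_Taylor[of a b 5 f B x "x + h"] f B x h by (simp add: fact_numeral)
  moreover have "\<bar>f 0 (x - h) - (\<Sum>i\<le>5. f i x * (- h) ^ i / fact i)\<bar> \<le> B * h ^ 6 / 120"
    using real_Taylor[of a b 5 f B x "x - h"] f B x h by (simp add: fact_numeral)
  moreover have "A = (f 0 (x + h) - (\<Sum>i\<le>5. f i x * h ^ i / fact i)) + (f 0 (x - h) - (\<Sum>i\<le>5. f i x * (- h) ^ i / fact i))"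
    by (simp add: A_def eval_nat_numeral field_simps)
  ultimately have A: "\<bar>A\<bar> \<le> B * h ^ 6 / 60" by linarith
  have f2: "y \<in> {a..b} \<Longrightarrow> i \<le> 3 \<Longrightarrow> (f (i + 2) has_real_derivative f (Suc i + 2) y) (at y within {a..b})" for i y
    using f[of y "i + 2"] by simp
  have "\<bar>f 2 (x + h) - (\<Sum>i\<le>3. f (i + 2) x * h ^ i / fact i)\<bar> \<le> B * h ^ 4 / 6"
    using real_Taylor[of a b 3 "\<lambda>i. f (i + 2)" B x "x + h", OF f2] B x h by (simp add: fact_numeral del: add_2_eq_Suc')
  moreover have "\<bar>f 2 (x - h) - (\<Sum>i\<le>3. f (i + 2) x * (- h) ^ i / fact i)\<bar> \<le> B * h ^ 4 / 6"
    using real_Taylor[of a b 3 "\<lambda>i. f (i + 2)" B x "x - h", OF f2] B x h by (simp add: fact_numeral del: add_2_eq_Suc')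
  moreover have "A' = (f 2 (x + h) - (\<Sum>i\<le>3. f (i + 2) x * h ^ i / fact i)) + (f 2 (x - h) - (\<Sum>i\<le>3. f (i + 2) x * (- h) ^ i / fact i))"
    by (simp add: A'_def eval_nat_numeral field_simps)
  ultimately have A': "\<bar>A'\<bar> \<le> B * h ^ 4 / 3" by linarith
  have "(f 2 (x + h) + 10 * f 2 x + f 2 (x - h)) / 12 - (f 0 (x + h) - 2 * f 0 x + f 0 (x - h)) / h\<^sup>2 = A' / 12 - A / h\<^sup>2"
    using \<open>h > 0\<close> by (simp add: A_def A'_def field_simps power2_eq_square power4_eq_xxxx)
  moreover have "\<bar>A / h\<^sup>2\<bar> \<le> B * h ^ 4 / 60"
  proof -
    have "h ^ 6 = h ^ 4 * h\<^sup>2" by (simp flip: power_add)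
    then show ?thesis using A \<open>h > 0\<close> by (simp add: field_simps abs_divide)
  qed
  moreover have "0 \<le> B * h ^ 4" using \<open>B \<ge> 0\<close> \<open>h > 0\<close> by simp
  ultimately show ?thesis using A' by linarith
qed

lemma second_difference_bound:
  fixes f :: "nat \<Rightarrow> real \<Rightarrow> real"
  assumes f: "\<And>i x. x \<in> {a..b} \<Longrightarrow> i < 2 \<Longrightarrow> (f i has_real_derivative f (Suc i) x) (at x within {a..b})"
    and B: "\<And>x. x \<in> {a..b} \<Longrightarrow> \<bar>f 2 x\<bar> \<le> B"
    and "h > 0" and x: "x \<in> {a..b}" "x + h \<in> {a..b}" "x - h \<in> {a..b}"
  shows "\<bar>(f 0 (x + h) - 2 * f 0 x + f 0 (x - h)) / h\<^sup>2\<bar> \<le> 2 * B"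
proof -
  have "\<bar>f 0 (x + h) - (f 0 x + f 1 x * h)\<bar> \<le> B * h\<^sup>2"
    using real_Taylor[of a b 1 f B x "x + h"] f B x \<open>h > 0\<close> by (simp add: numeral_2_eq_2)
  moreover have "\<bar>f 0 (x - h) - (f 0 x - f 1 x * h)\<bar> \<le> B * h\<^sup>2"
    using real_Taylor[of a b 1 f B x "x - h"] f B x \<open>h > 0\<close> by (simp add: numeral_2_eq_2)
  ultimately have "\<bar>f 0 (x + h) - 2 * f 0 x + f 0 (x - h)\<bar> \<le> 2 * B * h\<^sup>2" by linarith
  then show ?thesis using \<open>h > 0\<close> by (simp add: abs_divide divide_le_eq)
qed

lemma midpoint_average_bound:
  fixes f :: "nat \<Rightarrow> real \<Rightarrow> real"
  assumes f: "\<And>i x. x \<in> {a..b} \<Longrightarrow> i < 2 \<Longrightarrow> (f i has_real_derivative f (Suc i) x) (at x within {a..b})"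
    and B: "\<And>x. x \<in> {a..b} \<Longrightarrow> \<bar>f 2 x\<bar> \<le> B"
    and "h > 0" and x: "x \<in> {a..b}" "x + h \<in> {a..b}" "x - h \<in> {a..b}"
  shows "\<bar>(f 0 (x + h) + f 0 (x - h)) / 2 - f 0 x\<bar> \<le> B * h\<^sup>2"
proof -
  have "\<bar>f 0 (x + h) - 2 * f 0 x + f 0 (x - h)\<bar> \<le> 2 * B * h\<^sup>2"
    using second_difference_bound[OF f B \<open>h > 0\<close> x] \<open>h > 0\<close> by (simp add: abs_divide divide_le_eq)
  moreover have "\<bar>u - 2 * v + w\<bar> \<le> 2 * B * h\<^sup>2 \<Longrightarrow> \<bar>(u + w) / 2 - v\<bar> \<le> B * h\<^sup>2" for u v w
    by (simp add: abs_le_iff field_simps)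
  ultimately show ?thesis by blast
qed

lemma central_difference_bound:
  fixes f :: "nat \<Rightarrow> real \<Rightarrow> real"
  assumes f: "\<And>i x. x \<in> {a..b} \<Longrightarrow> i < 3 \<Longrightarrow> (f i has_real_derivative f (Suc i) x) (at x within {a..b})"
    and B: "\<And>x. x \<in> {a..b} \<Longrightarrow> \<bar>f 3 x\<bar> \<le> B"
    and "h > 0" and x: "x \<in> {a..b}" "x + h \<in> {a..b}" "x - h \<in> {a..b}"
  shows "\<bar>(f 0 (x + h) - f 0 (x - h)) / (2 * h) - f 1 x\<bar> \<le> B * h\<^sup>2"
proof -
  have "B \<ge> 0" using B[OF x(1)] by linarith
  have "\<bar>f 0 (x + h) - (f 0 x + f 1 x * h + f 2 x * h\<^sup>2 / 2)\<bar> \<le> B * h ^ 3 / 2"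
    using real_Taylor[of a b 2 f B x "x + h"] f B x \<open>h > 0\<close> by (simp add: eval_nat_numeral)
  moreover have "\<bar>f 0 (x - h) - (f 0 x - f 1 x * h + f 2 x * h\<^sup>2 / 2)\<bar> \<le> B * h ^ 3 / 2"
    using real_Taylor[of a b 2 f B x "x - h"] f B x \<open>h > 0\<close> by (simp add: eval_nat_numeral)
  ultimately have "\<bar>f 0 (x + h) - f 0 (x - h) - 2 * (f 1 x * h)\<bar> \<le> B * h ^ 3" by linarith
  moreover have "(f 0 (x + h) - f 0 (x - h)) / (2 * h) - f 1 x = (f 0 (x + h) - f 0 (x - h) - 2 * (f 1 x * h)) / (2 * h)"
    using \<open>h > 0\<close> by (simp add: field_simps)
  moreover have "B * h ^ 3 \<le> B * h\<^sup>2 * (2 * h)"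
    using \<open>h > 0\<close> \<open>B \<ge> 0\<close> by (simp add: eval_nat_numeral)
  ultimately show ?thesis using \<open>h > 0\<close> by (simp add: abs_divide divide_le_eq)
qed

section \<open>Cubic Lagrange interpolation\<close>

lemma cubic_interp_explicit:
  assumes "h \<noteq> 0" "x = (real p + s) * h"
  shows "cubic_interp h V (Suc p) x =
    V p * (- (s - 1) * (s - 2) * (s - 3) / 6) + V (p + 1) * (s * (s - 2) * (s - 3) / 2)
    + V (p + 2) * (- s * (s - 1) * (s - 3) / 2) + V (p + 3) * (s * (s - 1) * (s - 2) / 6)"
proof -
  have S: "{Suc p - 1..Suc p + 2} = {p, p + 1, p + 2, p + 3}" by auto
  have *: "(x - real b * h) / (real a * h - real b * h) = (real p + s - real b) / (real a - real b)" for a b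
    using assms by (simp flip: left_diff_distrib)
  have D: "{p, p + 1, p + 2, p + 3} - {p} = {p + 1, p + 2, p + 3}"
     "{p, p + 1, p + 2, p + 3} - {p + 1} = {p, p + 2, p + 3}"
     "{p, p + 1, p + 2, p + 3} - {p + 2} = {p, p + 1, p + 3}"
     "{p, p + 1, p + 2, p + 3} - {p + 3} = {p, p + 1, p + 2}" by auto
  show ?thesis
    unfolding cubic_interp_def lagrange_def S * by (simp add: D[simplified] algebra_simps add_divide_distrib diff_divide_distrib)
qed

lemma cubic_interp_lin:
  "cubic_interp h (\<lambda>r. a * U r + b * V r) i x = a * cubic_interp h U i x + b * cubic_interp h V i x"
  by (simp add: cubic_interp_def lagrange_def sum.distrib sum_distrib_left algebra_simps)

text \<open>In the variable \<open>s\<close>, the distance of \<open>x\<close> from the first node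
  in units of \<open>h\<close>, this is a polynomial identity. The cubic is centred at
  \<open>x\<close>, so its value there is just \<open>c0\<close> and a Taylor polynomial about
  \<open>x\<close> fits directly.\<close>

lemma cubic_interp_reproduces_cubics:
  assumes "h \<noteq> 0" "i \<ge> 1"
  shows "cubic_interp h (\<lambda>r. c0 + c1 * (real r * h - x) + c2 * (real r * h - x)\<^sup>2 + c3 * (real r * h - x) ^ 3) i x = c0"
proof -
  obtain p where p: "i = Suc p" using assms(2) by (cases i) auto
  define s where "s = x / h - real p"
  have x: "x = (real p + s) * h" using assms(1) by (simp add: s_def)
  have *: "real r * h - x = (real r - real p - s) * h" for r by (simp add: x algebra_simps)
  show ?thesis
    unfolding p cubic_interp_explicit[OF assms(1) x] * 
    by (simp add: field_simps power2_eq_square power3_eq_cube)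
qed

text \<open>Interpolation is exact on the Taylor cubic about \<open>x\<close>, so the error is the
  interpolant of the remainder. At nodes within \<open>2 * h\<close> the remainder is at most
  \<open>B * (2 * h) ^ 4 / 6 \<le> 3 * B * h ^ 4\<close>; the Lebesgue bound 32 turns 3 into
  96.\<close>

lemma cubic_interp_error:
  fixes f :: "nat \<Rightarrow> real \<Rightarrow> real"
  assumes f: "\<And>i x. x \<in> {a..b} \<Longrightarrow> i < 4 \<Longrightarrow> (f i has_real_derivative f (Suc i) x) (at x within {a..b})"
    and B: "\<And>x. x \<in> {a..b} \<Longrightarrow> \<bar>f 4 x\<bar> \<le> B"
    and "h > 0" "i \<ge> 1" "real i * h \<le> x" "x \<le> real (i + 1) * h" "x \<in> {a..b}"
    and nodes: "\<And>r. r \<in> {i - 1..i + 2} \<Longrightarrow> real r * h \<in> {a..b}"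
  shows "\<bar>cubic_interp h (\<lambda>r. f 0 (real r * h)) i x - f 0 x\<bar> \<le> 96 * B * h ^ 4"
proof -
  have "B \<ge> 0" using B[OF \<open>x \<in> {a..b}\<close>] by linarith
  define P where "P y = f 0 x + f 1 x * (y - x) + f 2 x / 2 * (y - x)\<^sup>2 + f 3 x / 6 * (y - x) ^ 3" for y
  have err: "\<bar>1 * f 0 (real r * h) + (-1) * P (real r * h)\<bar> \<le> 3 * B * h ^ 4" if r: "r \<in> {i - 1..i + 2}" for r
  proof -
    let ?y = "real r * h"
    have "\<bar>f 0 ?y - P ?y\<bar> \<le> B * \<bar>?y - x\<bar> ^ 4 / 6"
    proof -
      have "(\<Sum>i\<le>3. f i x * d ^ i / fact i) = f 0 x + f 1 x * d + f 2 x / 2 * d\<^sup>2 + f 3 x / 6 * d ^ 3" for d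
        by (simp add: eval_nat_numeral)
      from this[of "?y - x"] show ?thesis
        using real_Taylor[of a b 3 f B x ?y] f B nodes[OF r] \<open>x \<in> {a..b}\<close>
        by (simp add: P_def fact_numeral)
    qed
    also have "\<dots> \<le> B * (2 * h) ^ 4 / 6"
    proof -
      have "real i - 1 \<le> real r" "real r \<le> real i + 2" using r \<open>i \<ge> 1\<close> by auto
      then have "(real i - 1) * h \<le> ?y" "?y \<le> (real i + 2) * h"
        using \<open>h > 0\<close> by (auto intro: mult_right_mono simp del: mult_le_cancel_right_pos)
      then have "\<bar>?y - x\<bar> \<le> 2 * h" using assms(5,6) by (auto simp: abs_le_iff algebra_simps)
      then show ?thesis using \<open>B \<ge> 0\<close> by (intro divide_right_mono mult_left_mono power_mono) auto
    qed
    also have "\<dots> \<le> 3 * B * h ^ 4" using \<open>B \<ge> 0\<close> \<open>h > 0\<close> by (simp add: power_mult_distrib)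
    finally show ?thesis by simp
  qed
  have "\<bar>cubic_interp h (\<lambda>r. 1 * f 0 (real r * h) + (-1) * P (real r * h)) i x\<bar> \<le> 32 * (3 * B * h ^ 4)"
    using assms(3-6) err by (intro cubic_interp_le_sup) auto
  moreover have "cubic_interp h (\<lambda>r. P (real r * h)) i x = f 0 x"
    unfolding P_def using assms(3,4) by (intro cubic_interp_reproduces_cubics) auto
  ultimately show ?thesis unfolding cubic_interp_lin by simp
qed

section \<open>Quadrature of the Caputo derivative\<close>

text \<open>The case \<open>b = t\<close>, where the integrand may be singular, is included: the
  primitive is still continuous up to \<open>t\<close>, and the fundamental theorem asks for its
  derivative in the open interval only.\<close>

lemma has_integral_powr_kernel:
  fixes \<alpha> t :: real
  assumes "\<alpha> < 1" "a \<le> b" "b \<le> t"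
  shows "((\<lambda>\<eta>. (t - \<eta>) powr (- \<alpha>)) has_integral
    ((t - a) powr (1 - \<alpha>) - (t - b) powr (1 - \<alpha>)) / (1 - \<alpha>)) {a..b}"
proof -
  define F where "F \<eta> = - ((t - \<eta>) powr (1 - \<alpha>) / (1 - \<alpha>))" for \<eta>
  have "((\<lambda>\<eta>. (t - \<eta>) powr (- \<alpha>)) has_integral (F b - F a)) {a..b}"
  proof (rule fundamental_theorem_of_calculus_interior)
    show "continuous_on {a..b} F"
      unfolding F_def using assms by (intro continuous_intros continuous_on_powr') auto
    fix x assume x: "x \<in> {a<..<b}"
    have "(F has_real_derivative (t - x) powr (- \<alpha>)) (at x)"
    proof -
      have "((\<lambda>\<eta>. t - \<eta>) has_real_derivative - 1) (at x)"
        by (auto intro!: derivative_eq_intros)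
      from DERIV_cdivide[OF DERIV_fun_powr[OF this, of "1 - \<alpha>"], of "\<alpha> - 1"]
      have "((\<lambda>\<eta>. (t - \<eta>) powr (1 - \<alpha>) / (\<alpha> - 1)) has_real_derivative
          (1 - \<alpha>) * (t - x) powr (1 - \<alpha> - of_nat 1) * - 1 / (\<alpha> - 1)) (at x)"
        using x assms by simp
      moreover have "(1 - \<alpha>) * (t - x) powr (1 - \<alpha> - of_nat 1) * - 1 / (\<alpha> - 1) = (t - x) powr (- \<alpha>)"
        using assms by (simp add: field_simps)
      moreover have "F = (\<lambda>\<eta>. (t - \<eta>) powr (1 - \<alpha>) / (\<alpha> - 1))"
        using assms by (auto simp: F_def fun_eq_iff field_simps)
      ultimately show ?thesis by simp
    qed
    then show "(F has_vector_derivative (t - x) powr (- \<alpha>)) (at x)"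
      by (simp add: has_real_derivative_iff_has_vector_derivative)
  qed (use assms in auto)
  then show ?thesis by (simp add: F_def diff_divide_distrib)
qed

text \<open>Both function and secant are compared with the tangent at \<open>a\<close>, whose slope
  is within \<open>B * (b - a)\<close> of the secant slope. The second order bound is for cells away
  from the singularity, the first order bound on the slope for the cell containing it.\<close>

lemma linear_interpolation_error:
  fixes f :: "nat \<Rightarrow> real \<Rightarrow> real"
  assumes f: "\<And>i x. x \<in> {a..b} \<Longrightarrow> i < 2 \<Longrightarrow> (f i has_real_derivative f (Suc i) x) (at x within {a..b})"
    and B: "\<And>x. x \<in> {a..b} \<Longrightarrow> \<bar>f 2 x\<bar> \<le> B"
    and "a < b" "x \<in> {a..b}"
  shows "\<bar>f 0 x - f 0 a - (x - a) * ((f 0 b - f 0 a) / (b - a))\<bar> \<le> 2 * B * (b - a)\<^sup>2"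
    and "\<bar>f 1 x - (f 0 b - f 0 a) / (b - a)\<bar> \<le> 2 * B * (b - a)"
proof -
  have "B \<ge> 0" using B[OF \<open>x \<in> {a..b}\<close>] by linarith
  define p where "p = (f 0 b - f 0 a) / (b - a)"
  have f0b: "f 0 b = f 0 a + p * (b - a)" using \<open>a < b\<close> by (simp add: p_def)
  have T: "\<bar>f 0 y - f 0 a - f 1 a * (y - a)\<bar> \<le> B * (y - a)\<^sup>2" if "y \<in> {a..b}" for y
    using real_Taylor[of a b 1 f B a y] f B that \<open>a < b\<close> by (simp add: numeral_2_eq_2 diff_diff_eq)
  have p: "\<bar>p - f 1 a\<bar> \<le> B * (b - a)"
  proof -
    have "\<bar>(p - f 1 a) * (b - a)\<bar> \<le> B * (b - a) * (b - a)"
      using T[of b] \<open>a < b\<close> by (simp add: f0b algebra_simps power2_eq_square)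
    then show ?thesis using \<open>a < b\<close> by (simp add: abs_mult)
  qed
  have "\<bar>f 0 x - f 0 a - (x - a) * p\<bar> \<le> \<bar>f 0 x - f 0 a - f 1 a * (x - a)\<bar> + \<bar>(p - f 1 a) * (x - a)\<bar>"
  proof -
    have "f 0 x - f 0 a - (x - a) * p = (f 0 x - f 0 a - f 1 a * (x - a)) - (p - f 1 a) * (x - a)"
      by (simp add: algebra_simps)
    then show ?thesis by simp
  qed
  also have "\<dots> \<le> B * (b - a)\<^sup>2 + B * (b - a) * (b - a)"
  proof (rule add_mono)
    have "B * (x - a)\<^sup>2 \<le> B * (b - a)\<^sup>2"
      using \<open>B \<ge> 0\<close> \<open>x \<in> {a..b}\<close> by (intro mult_left_mono power_mono) auto
    then show "\<bar>f 0 x - f 0 a - f 1 a * (x - a)\<bar> \<le> B * (b - a)\<^sup>2"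
      using T[OF \<open>x \<in> {a..b}\<close>] by linarith
    show "\<bar>(p - f 1 a) * (x - a)\<bar> \<le> B * (b - a) * (b - a)"
      unfolding abs_mult using p \<open>x \<in> {a..b}\<close> by (intro mult_mono) auto
  qed
  finally show "\<bar>f 0 x - f 0 a - (x - a) * ((f 0 b - f 0 a) / (b - a))\<bar> \<le> 2 * B * (b - a)\<^sup>2"
    unfolding p_def by (simp add: power2_eq_square)
  have "\<bar>f 1 x - f 1 a\<bar> \<le> B * \<bar>x - a\<bar>"
    using mean_value_bound[of a b "\<lambda>i. f (Suc i)" B a x] f[of _ 1] B \<open>x \<in> {a..b}\<close> \<open>a < b\<close>
    by (simp add: numeral_2_eq_2)
  also have "\<dots> \<le> B * (b - a)" using \<open>B \<ge> 0\<close> \<open>x \<in> {a..b}\<close> by (intro mult_left_mono) auto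
  finally show "\<bar>f 1 x - (f 0 b - f 0 a) / (b - a)\<bar> \<le> 2 * B * (b - a)"
    using p unfolding p_def[symmetric] by linarith
qed

text \<open>
  Away from the singularity, integration by parts moves the derivative from the interpolation
  error, which vanishes at both nodes, to the kernel.
\<close>

lemma quadrature_error_regular:
  fixes f :: "nat \<Rightarrow> real \<Rightarrow> real" and \<alpha> t :: real
  assumes f: "\<And>i x. x \<in> {a..b} \<Longrightarrow> i < 2 \<Longrightarrow> (f i has_real_derivative f (Suc i) x) (at x within {a..b})"
    and B: "\<And>x. x \<in> {a..b} \<Longrightarrow> \<bar>f 2 x\<bar> \<le> B"
    and "a < b" "b < t" "0 < \<alpha>" "\<alpha> < 1"
    and I: "((\<lambda>\<eta>. f 1 \<eta> * (t - \<eta>) powr (- \<alpha>)) has_integral I) {a..b}"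
  shows "\<bar>I - (f 0 b - f 0 a) / (b - a) * (((t - a) powr (1 - \<alpha>) - (t - b) powr (1 - \<alpha>)) / (1 - \<alpha>))\<bar>
    \<le> 2 * B * (b - a)\<^sup>2 * ((t - b) powr (- \<alpha>) - (t - a) powr (- \<alpha>))"
proof -
  define p where "p = (f 0 b - f 0 a) / (b - a)"
  define e where "e x = f 0 x - f 0 a - (x - a) * p" for x
  define k' where "k' x = \<alpha> * (t - x) powr (- \<alpha> - 1)" for x
  have k: "((\<lambda>x. (t - x) powr (- \<alpha>)) has_real_derivative k' x) (at x within {a..b})" if "x \<in> {a..b}" for x
    unfolding k'_def using that \<open>b < t\<close> by (auto intro!: derivative_eq_intros)
  \<comment> \<open>As \<open>k'\<close> is nonnegative, its integral is the increment of the kernel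
    itself; the errors of adjacent cells will therefore telescope.\<close>
  have k'_int: "(k' has_integral ((t - b) powr (- \<alpha>) - (t - a) powr (- \<alpha>))) {a..b}"
    using k \<open>a < b\<close> by (intro fundamental_theorem_of_calculus) (auto simp: has_real_derivative_iff_has_vector_derivative)
  have e': "(e has_real_derivative f 1 x - p) (at x within {a..b})" if "x \<in> {a..b}" for x
    unfolding e_def using f[OF that, of 0] by (auto intro!: derivative_eq_intros)
  have eb: "e a = 0" "e b = 0" using \<open>a < b\<close> by (auto simp: e_def p_def)
  have "((\<lambda>x. (f 1 x - p) * (t - x) powr (- \<alpha>) + e x * k' x) has_integral
      (e b * (t - b) powr (- \<alpha>) - e a * (t - a) powr (- \<alpha>))) {a..b}"
  proof (rule fundamental_theorem_of_calculus)
    fix x assume x: "x \<in> {a..b}"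
    show "((\<lambda>x. e x * (t - x) powr (- \<alpha>)) has_vector_derivative
        (f 1 x - p) * (t - x) powr (- \<alpha>) + e x * k' x) (at x within {a..b})"
      unfolding has_real_derivative_iff_has_vector_derivative[symmetric]
      using DERIV_mult[OF e'[OF x] k[OF x]] by (simp add: algebra_simps)
  qed (use \<open>a < b\<close> in auto)
  then have 1: "((\<lambda>x. (f 1 x - p) * (t - x) powr (- \<alpha>) + e x * k' x) has_integral 0) {a..b}"
    by (simp add: eb)
  have 2: "((\<lambda>x. (f 1 x - p) * (t - x) powr (- \<alpha>)) has_integral
     (I - p * (((t - a) powr (1 - \<alpha>) - (t - b) powr (1 - \<alpha>)) / (1 - \<alpha>)))) {a..b}"
    using has_integral_diff[OF I has_integral_mult_right[OF has_integral_powr_kernel, of \<alpha> a b t p]]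
      \<open>a < b\<close> \<open>b < t\<close> \<open>\<alpha> < 1\<close> by (simp add: left_diff_distrib)
  have 3: "((\<lambda>x. e x * k' x) has_integral
     - (I - p * (((t - a) powr (1 - \<alpha>) - (t - b) powr (1 - \<alpha>)) / (1 - \<alpha>)))) {a..b}"
    using has_integral_diff[OF 1 2] by simp
  have 4: "((\<lambda>x. 2 * B * (b - a)\<^sup>2 * k' x) has_integral
     2 * B * (b - a)\<^sup>2 * ((t - b) powr (- \<alpha>) - (t - a) powr (- \<alpha>))) {a..b}"
    by (rule has_integral_mult_right[OF k'_int])
  have "norm (integral {a..b} (\<lambda>x. e x * k' x)) \<le> integral {a..b} (\<lambda>x. 2 * B * (b - a)\<^sup>2 * k' x)"
  proof (rule integral_norm_bound_integral)
    fix x assume x: "x \<in> {a..b}"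
    have "\<bar>e x\<bar> \<le> 2 * B * (b - a)\<^sup>2"
      unfolding e_def p_def using f B \<open>a < b\<close> x by (intro linear_interpolation_error) auto
    moreover have "k' x \<ge> 0" using \<open>0 < \<alpha>\<close> by (simp add: k'_def)
    ultimately show "norm (e x * k' x) \<le> 2 * B * (b - a)\<^sup>2 * k' x"
      by (simp add: abs_mult mult_right_mono)
  qed (use 3 4 in blast)+
  then show ?thesis
    unfolding integral_unique[OF 3] integral_unique[OF 4] by (simp add: p_def)
qed

lemma quadrature_error_singular:
  fixes f :: "nat \<Rightarrow> real \<Rightarrow> real" and \<alpha> t :: real
  assumes f: "\<And>i x. x \<in> {a..b} \<Longrightarrow> i < 2 \<Longrightarrow> (f i has_real_derivative f (Suc i) x) (at x within {a..b})"
    and B: "\<And>x. x \<in> {a..b} \<Longrightarrow> \<bar>f 2 x\<bar> \<le> B"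
    and "a < t" "t \<le> b" "\<alpha> < 1"
    and I: "((\<lambda>\<eta>. f 1 \<eta> * (t - \<eta>) powr (- \<alpha>)) has_integral I) {a..t}"
  shows "\<bar>I - (f 0 b - f 0 a) / (b - a) * ((t - a) powr (1 - \<alpha>) / (1 - \<alpha>))\<bar>
    \<le> 2 * B * (b - a) * ((t - a) powr (1 - \<alpha>) / (1 - \<alpha>))"
proof -
  define p where "p = (f 0 b - f 0 a) / (b - a)"
  have K: "((\<lambda>\<eta>. (t - \<eta>) powr (- \<alpha>)) has_integral (t - a) powr (1 - \<alpha>) / (1 - \<alpha>)) {a..t}"
    using has_integral_powr_kernel[of \<alpha> a t t] assms by simp
  have 2: "((\<lambda>x. (f 1 x - p) * (t - x) powr (- \<alpha>)) has_integral
     (I - p * ((t - a) powr (1 - \<alpha>) / (1 - \<alpha>)))) {a..t}"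
    using has_integral_diff[OF I has_integral_mult_right[OF K, of p]] by (simp add: left_diff_distrib)
  have 4: "((\<lambda>x. 2 * B * (b - a) * (t - x) powr (- \<alpha>)) has_integral
     2 * B * (b - a) * ((t - a) powr (1 - \<alpha>) / (1 - \<alpha>))) {a..t}"
    by (rule has_integral_mult_right[OF K])
  have "norm (integral {a..t} (\<lambda>x. (f 1 x - p) * (t - x) powr (- \<alpha>)))
     \<le> integral {a..t} (\<lambda>x. 2 * B * (b - a) * (t - x) powr (- \<alpha>))"
  proof (rule integral_norm_bound_integral)
    fix x assume x: "x \<in> {a..t}"
    have "\<bar>f 1 x - p\<bar> \<le> 2 * B * (b - a)"
      unfolding p_def using f B assms(3,4) x by (intro linear_interpolation_error) auto
    then show "norm ((f 1 x - p) * (t - x) powr (- \<alpha>)) \<le> 2 * B * (b - a) * (t - x) powr (- \<alpha>)"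
      by (simp add: abs_mult mult_right_mono)
  qed (use 2 4 in blast)+
  then show ?thesis
    unfolding integral_unique[OF 2] integral_unique[OF 4] by (simp add: p_def)
qed

text \<open>The discrete derivative is the Caputo integral with \<open>f 1\<close> replaced on each
  cell by its difference quotient. The errors of the full cells telescope to
  \<open>2 * B * \<tau>\<^sup>2 * (E j - E 0)\<close> with
  \<open>E j = (\<tau> / 2) powr (- \<alpha>)\<close>, and the last half cell costs
  \<open>\<tau> * \<tau> powr (1 - \<alpha>)\<close>; both are of order
  \<open>\<tau> powr (2 - \<alpha>)\<close>.\<close>

lemma frac_diff_consistency:
  fixes f :: "nat \<Rightarrow> real \<Rightarrow> real" and \<alpha> \<tau> :: real
  assumes f: "\<And>i x. x \<in> {0..T} \<Longrightarrow> i < 2 \<Longrightarrow> (f i has_real_derivative f (Suc i) x) (at x within {0..T})"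
    and B: "\<And>x. x \<in> {0..T} \<Longrightarrow> \<bar>f 2 x\<bar> \<le> B"
    and \<alpha>: "0 < \<alpha>" "\<alpha> < 1" and \<tau>: "\<tau> > 0" and T: "real (j + 1) * \<tau> \<le> T"
    and t_def: "t = (real j + 1/2) * \<tau>"
    and int: "(\<lambda>\<eta>. f 1 \<eta> * (t - \<eta>) powr (- \<alpha>)) integrable_on {0..t}"
  shows "\<bar>1 / Gamma (1 - \<alpha>) * integral {0..t} (\<lambda>\<eta>. f 1 \<eta> * (t - \<eta>) powr (- \<alpha>))
      - frac_diff \<alpha> \<tau> (\<lambda>s. f 0 (real s * \<tau>)) j\<bar>
    \<le> 1 / Gamma (1 - \<alpha>) * (4 + 2 / (1 - \<alpha>)) * B * \<tau> powr (2 - \<alpha>)"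
proof -
  define g where "g \<eta> = f 1 \<eta> * (t - \<eta>) powr (- \<alpha>)" for \<eta>
  define J where "J n = integral {real n * \<tau>..real (n + 1) * \<tau>} g" for n
  define p where "p n = (f 0 (real (n + 1) * \<tau>) - f 0 (real n * \<tau>)) / \<tau>" for n
  \<comment> \<open>The integral of the kernel over cell \<open>n\<close>, or over its left half if
    \<open>n = j\<close>, as \<open>W_reg\<close> and \<open>W_sing\<close> confirm; this is where
    the half-integer shifts and the special zeroth coefficient come from.\<close>
  define W where "W n = \<tau> powr (1 - \<alpha>) * frac_coeff \<alpha> (j - n) / (1 - \<alpha>)" for n
  define L where "L = integral {real j * \<tau>..t} g"
  define E where "E n = (t - real n * \<tau>) powr (- \<alpha>)" for n
  have "B \<ge> 0" using B[of 0] T \<tau> by (smt (verit) atLeastAtMost_iff mult_nonneg_nonneg of_nat_0_le_iff)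
  have sub: "{real n * \<tau>..real (n + 1) * \<tau>} \<subseteq> {0..T}" if "n \<le> j" for n
  proof -
    have "real (n + 1) * \<tau> \<le> real (j + 1) * \<tau>" using that \<tau> by (intro mult_right_mono) auto
    moreover have "0 \<le> real n * \<tau>" using \<tau> by simp
    ultimately show ?thesis using T by auto
  qed
  have f_sub: "(f i has_real_derivative f (Suc i) x) (at x within {real n * \<tau>..real (n + 1) * \<tau>})"
    if "n \<le> j" "x \<in> {real n * \<tau>..real (n + 1) * \<tau>}" "i < 2" for n i x
    using DERIV_subset[OF f sub] sub that by blast
  have tn: "real n * \<tau> \<le> t" if "n \<le> j" for n
    unfolding t_def using that \<tau> by (intro mult_right_mono) auto
  have tn': "real (n + 1) * \<tau> < t" if "n < j" for n
    unfolding t_def using that \<tau> by (intro mult_strict_right_mono) auto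
  have int_sub: "g integrable_on {c..d}" if "0 \<le> c" "d \<le> t" for c d
    using integrable_on_subinterval[OF int, of c d] that by (auto simp: g_def[abs_def])
  have split: "integral {0..real n * \<tau>} g = (\<Sum>s<n. J s)" if "n \<le> j" for n
    using that
  proof (induction n)
    case (Suc n)
    have "integral {0..real n * \<tau>} g + integral {real n * \<tau>..real (Suc n) * \<tau>} g = integral {0..real (Suc n) * \<tau>} g"
      using \<tau> Suc.prems tn[of "Suc n"]
      by (intro Henstock_Kurzweil_Integration.integral_combine int_sub mult_right_mono) auto
    then show ?case using Suc by (simp add: J_def)
  qed simp
  have "integral {0..real j * \<tau>} g + L = integral {0..t} g"
    unfolding L_def using \<tau> tn[of j] by (intro Henstock_Kurzweil_Integration.integral_combine int_sub) auto
  then have total: "integral {0..t} g = (\<Sum>s<j. J s) + L" using split[of j] by simp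
  have W_reg: "W n = ((t - real n * \<tau>) powr (1 - \<alpha>) - (t - real (n + 1) * \<tau>) powr (1 - \<alpha>)) / (1 - \<alpha>)" if "n < j" for n
  proof -
    have "t - real n * \<tau> = \<tau> * (real (j - n) + 1/2)" "t - real (n + 1) * \<tau> = \<tau> * (real (j - n) - 1/2)"
      using that by (auto simp: t_def of_nat_diff algebra_simps)
    moreover define d where "d = real (j - n)"
    moreover have "d \<ge> 1" using that by (simp add: d_def)
    moreover have "frac_coeff \<alpha> (j - n) = (d + 1/2) powr (1 - \<alpha>) - (d - 1/2) powr (1 - \<alpha>)"
      using that by (simp add: frac_coeff_def d_def)
    ultimately show ?thesis unfolding W_def using \<tau>
      by (simp only: powr_mult) (simp add: right_diff_distrib)
  qed
  have W_sing: "W j = (t - real j * \<tau>) powr (1 - \<alpha>) / (1 - \<alpha>)"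
    using \<tau> by (simp add: W_def frac_coeff_def t_def algebra_simps powr_divide)
  have reg: "\<bar>J n - p n * W n\<bar> \<le> 2 * B * \<tau>\<^sup>2 * (E (Suc n) - E n)" if "n < j" for n
  proof -
    have len: "real (n + 1) * \<tau> - real n * \<tau> = \<tau>" by (simp add: algebra_simps)
    have "(g has_integral J n) {real n * \<tau>..real (n + 1) * \<tau>}"
      unfolding J_def using \<tau> tn'[OF that] by (intro integrable_integral int_sub) auto
    then have "((\<lambda>\<eta>. f 1 \<eta> * (t - \<eta>) powr (- \<alpha>)) has_integral J n) {real n * \<tau>..real (n + 1) * \<tau>}"
      by (simp add: g_def[abs_def])
    moreover have "real n * \<tau> < real (n + 1) * \<tau>" using \<tau> by (intro mult_strict_right_mono) auto
    moreover have "\<bar>f 2 x\<bar> \<le> B" if "x \<in> {real n * \<tau>..real (n + 1) * \<tau>}" for x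
      using sub[of n] that \<open>n < j\<close> by (intro B) auto
    moreover have "(f i has_real_derivative f (Suc i) x) (at x within {real n * \<tau>..real (n + 1) * \<tau>})"
      if "x \<in> {real n * \<tau>..real (n + 1) * \<tau>}" "i < 2" for i x
      using f_sub[of n x i] that \<open>n < j\<close> by simp
    ultimately show ?thesis
      using quadrature_error_regular[of "real n * \<tau>" "real (n + 1) * \<tau>" f B t \<alpha> "J n", unfolded len]
        tn'[OF that] \<alpha>
      unfolding W_reg[OF that] E_def p_def Suc_eq_plus1 by blast
  qed
  have sing: "\<bar>L - p j * W j\<bar> \<le> 2 * B * \<tau> * W j"
  proof -
    have len: "real (j + 1) * \<tau> - real j * \<tau> = \<tau>" by (simp add: algebra_simps)
    have "(g has_integral L) {real j * \<tau>..t}"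
      unfolding L_def using \<tau> by (intro integrable_integral int_sub) auto
    then have I: "((\<lambda>\<eta>. f 1 \<eta> * (t - \<eta>) powr (- \<alpha>)) has_integral L) {real j * \<tau>..t}"
      by (simp add: g_def[abs_def])
    have "real j * \<tau> < t" "t \<le> real (j + 1) * \<tau>" using \<tau> by (auto simp: t_def algebra_simps)
    moreover have "\<bar>f 2 x\<bar> \<le> B" if "x \<in> {real j * \<tau>..real (j + 1) * \<tau>}" for x
      using sub[of j] that by (intro B) auto
    ultimately show ?thesis
      using quadrature_error_singular[of "real j * \<tau>" "real (j + 1) * \<tau>" f B t \<alpha> L, unfolded len]
        f_sub[of j] I \<alpha>
      unfolding W_sing p_def by blast
  qed
  have Ej: "E j = 2 powr \<alpha> * \<tau> powr (- \<alpha>)"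
  proof -
    have "t - real j * \<tau> = \<tau> / 2" by (simp add: t_def algebra_simps)
    then have "E j = (\<tau> / 2) powr (- \<alpha>)" by (simp only: E_def)
    also have "\<dots> = 2 powr \<alpha> * \<tau> powr (- \<alpha>)" by (simp add: powr_divide powr_minus field_simps)
    finally show ?thesis .
  qed
  have "\<bar>integral {0..t} g - (\<Sum>s\<le>j. p s * W s)\<bar> \<le> (\<Sum>s<j. 2 * B * \<tau>\<^sup>2 * (E (Suc s) - E s)) + 2 * B * \<tau> * W j"
  proof -
    have "integral {0..t} g - (\<Sum>s\<le>j. p s * W s) = (\<Sum>s<j. J s - p s * W s) + (L - p j * W j)"
      unfolding total by (simp add: sum_subtractf lessThan_Suc_atMost[symmetric])
    moreover have "\<bar>\<Sum>s<j. J s - p s * W s\<bar> \<le> (\<Sum>s<j. 2 * B * \<tau>\<^sup>2 * (E (Suc s) - E s))"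
      by (intro order_trans[OF sum_abs] sum_mono reg) auto
    ultimately show ?thesis using sing by linarith
  qed
  also have "(\<Sum>s<j. 2 * B * \<tau>\<^sup>2 * (E (Suc s) - E s)) = 2 * B * \<tau>\<^sup>2 * (E j - E 0)"
    by (simp add: sum_distrib_left[symmetric] sum_lessThan_telescope)
  also have "2 * B * \<tau>\<^sup>2 * (E j - E 0) \<le> 4 * B * \<tau> powr (2 - \<alpha>)"
  proof -
    have "2 powr \<alpha> \<le> (2::real) powr 1" using \<alpha> by (intro powr_mono) auto
    then have "E j \<le> 2 * \<tau> powr (- \<alpha>)" unfolding Ej by (intro mult_right_mono) auto
    moreover have "E 0 \<ge> 0" by (simp add: E_def)
    ultimately have "2 * B * \<tau>\<^sup>2 * (E j - E 0) \<le> 2 * B * \<tau>\<^sup>2 * (2 * \<tau> powr (- \<alpha>))"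
      using \<open>B \<ge> 0\<close> by (intro mult_left_mono) auto
    also have "\<dots> = 4 * B * \<tau> powr (2 - \<alpha>)"
      using \<tau> powr_add[of \<tau> 2 "- \<alpha>"] by simp
    finally show ?thesis .
  qed
  also have "2 * B * \<tau> * W j \<le> 2 / (1 - \<alpha>) * B * \<tau> powr (2 - \<alpha>)"
  proof -
    have "\<tau> * \<tau> powr (1 - \<alpha>) = \<tau> powr (2 - \<alpha>)" using \<tau> powr_add[of \<tau> 1 "1 - \<alpha>"] by simp
    moreover have "frac_coeff \<alpha> 0 \<le> 1" using \<alpha> ge_one_powr_ge_zero[of 2 "1 - \<alpha>"] by (simp add: frac_coeff_def)
    then have "2 * B * (\<tau> * \<tau> powr (1 - \<alpha>)) * frac_coeff \<alpha> 0 / (1 - \<alpha>) \<le> 2 * B * (\<tau> * \<tau> powr (1 - \<alpha>)) * 1 / (1 - \<alpha>)"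
      using \<open>B \<ge> 0\<close> \<tau> \<alpha> by (intro divide_right_mono mult_left_mono) auto
    moreover have "2 * B * \<tau> * W j = 2 * B * (\<tau> * \<tau> powr (1 - \<alpha>)) * frac_coeff \<alpha> 0 / (1 - \<alpha>)"
      by (simp add: W_def mult_ac)
    ultimately show ?thesis by (simp add: mult_ac)
  qed
  finally have main: "\<bar>integral {0..t} g - (\<Sum>s\<le>j. p s * W s)\<bar> \<le> (4 + 2 / (1 - \<alpha>)) * B * \<tau> powr (2 - \<alpha>)"
    by (simp add: distrib_right)
  \<comment> \<open>The functional equation of \<open>Gamma\<close> reconciles the two
    normalisations: the factor \<open>1 - \<alpha>\<close> is the denominator of
    \<open>W\<close>.\<close>
  have "1 - \<alpha> \<notin> \<int>\<^sub>\<le>\<^sub>0" using \<alpha> by (auto elim!: nonpos_Ints_cases)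
  then have G: "Gamma (2 - \<alpha>) = (1 - \<alpha>) * Gamma (1 - \<alpha>)"
    using Gamma_plus1[of "1 - \<alpha>"] by (simp add: algebra_simps)
  have "Gamma (1 - \<alpha>) > 0" using \<alpha> by (simp add: Gamma_real_pos)
  have fd: "frac_diff \<alpha> \<tau> (\<lambda>s. f 0 (real s * \<tau>)) j = 1 / Gamma (1 - \<alpha>) * (\<Sum>s\<le>j. p s * W s)"
    unfolding frac_diff_def G atLeast0AtMost sum_distrib_left p_def W_def
    by (intro sum.cong refl) (simp add: mult_ac)
  have "1 / Gamma (1 - \<alpha>) * integral {0..t} g - frac_diff \<alpha> \<tau> (\<lambda>s. f 0 (real s * \<tau>)) j
    = 1 / Gamma (1 - \<alpha>) * (integral {0..t} g - (\<Sum>s\<le>j. p s * W s))"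
    unfolding fd by (simp add: right_diff_distrib)
  then have "\<bar>1 / Gamma (1 - \<alpha>) * integral {0..t} g - frac_diff \<alpha> \<tau> (\<lambda>s. f 0 (real s * \<tau>)) j\<bar>
    = 1 / Gamma (1 - \<alpha>) * \<bar>integral {0..t} g - (\<Sum>s\<le>j. p s * W s)\<bar>"
    using \<open>Gamma (1 - \<alpha>) > 0\<close> by (simp add: abs_mult)
  also have "\<dots> \<le> 1 / Gamma (1 - \<alpha>) * ((4 + 2 / (1 - \<alpha>)) * B * \<tau> powr (2 - \<alpha>))"
    using \<open>Gamma (1 - \<alpha>) > 0\<close> main by (intro mult_left_mono) auto
  finally show ?thesis by (simp add: g_def[abs_def] mult.assoc)
qed

section \<open>Order of approximation\<close>

lemma vector_derivative_eq_on_interval: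
  fixes g :: "real \<Rightarrow> real"
  assumes "a < b" "x \<in> {a..b}" "(f has_real_derivative f') (at x within {a..b})"
    and "\<And>y. y \<in> {a..b} \<Longrightarrow> g y = f y"
  shows "vector_derivative g (at x within {a..b}) = f'"
  using assms
  by (intro vector_derivative_within_closed_interval has_vector_derivative_transform[of x "{a..b}" g f])
     (auto simp: has_real_derivative_iff_has_vector_derivative)

text \<open>
  The equation holds only at interior points, while the compact operator also uses the end points;
  these are reached by continuity of the discrete quantities, without continuity of the Caputo derivative.
\<close>

lemma time_consistency:
  fixes \<alpha> \<mu> l T :: real and D :: "nat \<Rightarrow> nat \<Rightarrow> real \<Rightarrow> real \<Rightarrow> real"
  assumes \<alpha>: "0 < \<alpha>" "\<alpha> < 1" and "l > 0" "T > 0"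
    and sol: "differential_solution \<alpha> \<mu> l T m xs q f u0 u"
    and D0: "\<forall>x\<in>{0..l}. \<forall>t\<in>{0..T}. D 0 0 x t = u x t"
    and D_cont: "\<forall>p\<le>6. \<forall>r\<le>3. continuous_on ({0..l} \<times> {0..T}) (\<lambda>(x, t). D p r x t)"
    and Dx: "\<forall>p<6. \<forall>r\<le>3. \<forall>x\<in>{0..l}. \<forall>t\<in>{0..T}.
           ((\<lambda>\<xi>. D p r \<xi> t) has_real_derivative D (Suc p) r x t) (at x within {0..l})"
    and Dt: "\<forall>p\<le>6. \<forall>r<3. \<forall>x\<in>{0..l}. \<forall>t\<in>{0..T}.
           ((\<lambda>\<eta>. D p r x \<eta>) has_real_derivative D p (Suc r) x t) (at t within {0..T})"
    and B: "\<And>x t. x \<in> {0..l} \<Longrightarrow> t \<in> {0..T} \<Longrightarrow> \<bar>D 0 2 x t\<bar> \<le> B"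
    and f: "continuous_on ({0..l} \<times> {0..T}) (\<lambda>(x, t). f x t)"
    and q: "\<forall>k\<in>{1..m}. continuous_on ({0..l} \<times> {0..T}) (\<lambda>(x, t). q k x t)"
    and xs: "\<And>k. k \<in> {1..m} \<Longrightarrow> xs k \<in> {0..l}"
    and \<tau>: "\<tau> > 0" "real (j + 1) * \<tau> \<le> T" and t_def: "t = (real j + 1/2) * \<tau>"
    and x: "x \<in> {0..l}"
  shows "\<bar>D 2 0 x t + \<mu> * D 2 1 x t + (\<Sum>k = 1..m. q k x t * D 0 0 (xs k) t) + f x t
      - frac_diff \<alpha> \<tau> (\<lambda>s. D 0 0 x (real s * \<tau>)) j\<bar>
    \<le> 1 / Gamma (1 - \<alpha>) * (4 + 2 / (1 - \<alpha>)) * B * \<tau> powr (2 - \<alpha>)"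
proof -
  have t: "0 < t" unfolding t_def using \<tau> by (intro mult_pos_pos) auto
  have "t \<le> real (j + 1) * \<tau>" unfolding t_def using \<tau> by (intro mult_right_mono) auto
  note t = t order_trans[OF this \<tau>(2)]
  \<comment> \<open>The derivatives are identified on the whole closed rectangle, since each further
    one-sided derivative within the interval needs equality on all of that interval.\<close>
  have px: "partial_x l u x t = D 1 0 x t" if "x \<in> {0..l}" "t \<in> {0..T}" for x t
    unfolding partial_x_def using Dx[rule_format, of 0 0 x t] D0 that \<open>l > 0\<close>
    by (intro vector_derivative_eq_on_interval[where f = "\<lambda>\<xi>. D 0 0 \<xi> t"]) auto
  have pxx: "partial_x l (partial_x l u) x t = D 2 0 x t" if "x \<in> {0..l}" "t \<in> {0..T}" for x t
    unfolding partial_x_def[of l "partial_x l u"] using Dx[rule_format, of 1 0 x t] px that \<open>l > 0\<close>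
    by (intro vector_derivative_eq_on_interval[where f = "\<lambda>\<xi>. D 1 0 \<xi> t"]) (auto simp: numeral_2_eq_2)
  have pxxt: "partial_t T (partial_x l (partial_x l u)) x t = D 2 1 x t" if "x \<in> {0..l}" "t \<in> {0..T}" for x t
    unfolding partial_t_def using Dt[rule_format, of 2 0 x t] pxx that \<open>T > 0\<close>
    by (intro vector_derivative_eq_on_interval[where f = "\<lambda>\<eta>. D 2 0 x \<eta>"]) auto
  have pt: "partial_t T u x t = D 0 1 x t" if "x \<in> {0..l}" "t \<in> {0..T}" for x t
    unfolding partial_t_def using Dt[rule_format, of 0 0 x t] D0 that \<open>T > 0\<close>
    by (intro vector_derivative_eq_on_interval[where f = "\<lambda>\<eta>. D 0 0 x \<eta>"]) auto
  define G where "G x = D 2 0 x t + \<mu> * D 2 1 x t + (\<Sum>k = 1..m. q k x t * D 0 0 (xs k) t) + f x t" for x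
  define \<Delta> where "\<Delta> x = frac_diff \<alpha> \<tau> (\<lambda>s. D 0 0 x (real s * \<tau>)) j" for x
  have interior: "\<bar>G y - \<Delta> y\<bar> \<le> 1 / Gamma (1 - \<alpha>) * (4 + 2 / (1 - \<alpha>)) * B * \<tau> powr (2 - \<alpha>)"
    if y: "y \<in> {0<..<l}" for y
  proof -
    have eq: "caputo \<alpha> T u y t = partial_x l (partial_x l u) y t
          + \<mu> * partial_t T (partial_x l (partial_x l u)) y t
          + (\<Sum>k = 1..m. q k y t * u (xs k) t) + f y t"
      and abs: "(\<lambda>\<eta>. partial_t T u y \<eta> * (t - \<eta>) powr (- \<alpha>)) absolutely_integrable_on {0..t}"
      using sol t y unfolding differential_solution_def by auto
    have "(\<Sum>k = 1..m. q k y t * u (xs k) t) = (\<Sum>k = 1..m. q k y t * D 0 0 (xs k) t)"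
      using D0 xs t by (intro sum.cong) auto
    then have "caputo \<alpha> T u y t = G y"
      using eq y t by (simp add: G_def pxx pxxt)
    moreover have "caputo \<alpha> T u y t = 1 / Gamma (1 - \<alpha>) * integral {0..t} (\<lambda>\<eta>. D 0 1 y \<eta> * (t - \<eta>) powr (- \<alpha>))"
      unfolding caputo_def using y t by (intro arg_cong2[where f = "(*)"] refl integral_cong) (auto simp: pt)
    moreover have "(\<lambda>\<eta>. D 0 1 y \<eta> * (t - \<eta>) powr (- \<alpha>)) integrable_on {0..t}"
      using integrable_eq[OF set_lebesgue_integral_eq_integral(1)[OF abs]] y t by (simp add: pt)
    moreover have "(D 0 i y has_real_derivative D 0 (Suc i) y s) (at s within {0..T})"
      if "s \<in> {0..T}" "i < 2" for i s using Dt y that by auto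
    ultimately show ?thesis
      unfolding \<Delta>_def using frac_diff_consistency[of T "\<lambda>i. D 0 i y" B \<alpha> \<tau> j t] B y \<alpha> \<tau> t_def by simp
  qed
  have sect: "continuous_on {0..l} (\<lambda>x. g x s)"
    if "continuous_on ({0..l} \<times> {0..T}) (\<lambda>(x, t). g x t)" "s \<in> {0..T}" for g :: "real \<Rightarrow> real \<Rightarrow> real" and s
  proof -
    have "continuous_on {0..l} (\<lambda>x. (x, s))" by (intro continuous_intros)
    moreover have "(\<lambda>x. (x, s)) ` {0..l} \<subseteq> {0..l} \<times> {0..T}" using that(2) by auto
    ultimately show ?thesis using continuous_on_compose2[OF that(1), of "{0..l}" "\<lambda>x. (x, s)"] by simp
  qed
  have "continuous_on {0..l} G"
    unfolding G_def using D_cont f q t by (intro continuous_intros sect) auto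
  moreover have "continuous_on {0..l} \<Delta>"
    unfolding \<Delta>_def frac_diff_def
  proof (intro continuous_intros sect)
    fix s assume "s \<in> {0..j}"
    then have "real (s + 1) * \<tau> \<le> real (j + 1) * \<tau>" using \<tau> by (intro mult_right_mono) auto
    moreover have "real s * \<tau> \<le> real (s + 1) * \<tau>" using \<tau> by (intro mult_right_mono) auto
    moreover have "0 \<le> real s * \<tau>" using \<tau> by simp
    ultimately show "real (s + 1) * \<tau> \<in> {0..T}" "real s * \<tau> \<in> {0..T}"
      unfolding atLeastAtMost_iff using \<tau>(2) by linarith+
  qed (use D_cont \<tau> in auto)
  ultimately have "continuous_on (closure {0<..<l}) (\<lambda>x. \<bar>G x - \<Delta> x\<bar>)"
    using \<open>l > 0\<close> by (auto intro!: continuous_intros)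
  then have "\<bar>G x - \<Delta> x\<bar> \<le> 1 / Gamma (1 - \<alpha>) * (4 + 2 / (1 - \<alpha>)) * B * \<tau> powr (2 - \<alpha>)"
    by (rule continuous_le_on_closure) (use x \<open>l > 0\<close> interior in simp_all)
  then show ?thesis by (simp add: G_def \<Delta>_def)
qed

section \<open>The residual of a smooth solution in the scheme\<close>

lemma uniform_derivative_bound:
  fixes D :: "nat \<Rightarrow> nat \<Rightarrow> real \<Rightarrow> real \<Rightarrow> real"
  assumes "\<forall>p\<le>a. \<forall>r\<le>b. continuous_on ({0..l} \<times> {0..T}) (\<lambda>(x, t). D p r x t)"
  obtains B where "B \<ge> 0"
    "\<And>p r x t. p \<le> a \<Longrightarrow> r \<le> b \<Longrightarrow> x \<in> {0..l} \<Longrightarrow> t \<in> {0..T} \<Longrightarrow> \<bar>D p r x t\<bar> \<le> B"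
proof -
  have "\<exists>c. \<forall>x\<in>{0..l}. \<forall>t\<in>{0..T}. \<bar>D p r x t\<bar> \<le> c" if "p \<le> a" "r \<le> b" for p r
  proof -
    have "compact ((\<lambda>(x, t). D p r x t) ` ({0..l} \<times> {0..T}))"
      using assms that by (intro compact_continuous_image compact_Times) auto
    then have "bounded ((\<lambda>(x, t). D p r x t) ` ({0..l} \<times> {0..T}))" by (rule compact_imp_bounded)
    then obtain c where "\<forall>y\<in>(\<lambda>(x, t). D p r x t) ` ({0..l} \<times> {0..T}). norm y \<le> c"
      unfolding bounded_iff by blast
    then show ?thesis by (intro exI[of _ c]) force
  qed
  then obtain c where c: "\<And>p r x t. p \<le> a \<Longrightarrow> r \<le> b \<Longrightarrow> x \<in> {0..l} \<Longrightarrow> t \<in> {0..T} \<Longrightarrow> \<bar>D p r x t\<bar> \<le> c p r"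
    by metis
  show ?thesis
  proof (rule that[of "\<Sum>(p, r)\<in>{..a} \<times> {..b}. \<bar>c p r\<bar>"])
    show "0 \<le> (\<Sum>(p, r)\<in>{..a} \<times> {..b}. \<bar>c p r\<bar>)" by (auto intro!: sum_nonneg)
    fix p r x t assume *: "p \<le> a" "r \<le> b" "x \<in> {0..l}" "t \<in> {0..T}"
    then have "\<bar>c p r\<bar> \<le> (\<Sum>(p, r)\<in>{..a} \<times> {..b}. \<bar>c p r\<bar>)"
      using member_le_sum[of "(p, r)" "{..a} \<times> {..b}" "\<lambda>(p, r). \<bar>c p r\<bar>"] by auto
    then show "\<bar>D p r x t\<bar> \<le> (\<Sum>(p, r)\<in>{..a} \<times> {..b}. \<bar>c p r\<bar>)" using c[OF *] by linarith
  qed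
qed

lemma diff_xx_grid:
  assumes "i \<ge> 1"
  shows "diff_xx h (\<lambda>r. g (real r * h)) i
    = (g (real i * h + h) - 2 * g (real i * h) + g (real i * h - h)) / h\<^sup>2"
proof -
  have "real (i + 1) * h = real i * h + h" "real (i - 1) * h = real i * h - h"
    using assms by (auto simp: of_nat_diff algebra_simps)
  then show ?thesis by (simp only: diff_xx_def)
qed

lemma compact_op_grid:
  assumes "i \<ge> 1"
  shows "compact_op (\<lambda>r. g (real r * h)) i
    = (g (real i * h + h) + 10 * g (real i * h) + g (real i * h - h)) / 12"
proof -
  have "real (i + 1) * h = real i * h + h" "real (i - 1) * h = real i * h - h"
    using assms by (auto simp: of_nat_diff algebra_simps)
  then show ?thesis by (simp only: compact_op_def)
qed

lemma frac_diff_lin: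
  "frac_diff \<alpha> \<tau> (\<lambda>s. a * u s + b * v s) j = a * frac_diff \<alpha> \<tau> u j + b * frac_diff \<alpha> \<tau> v j"
proof -
  have "(\<Sum>s = 0..j. frac_coeff \<alpha> (j - s) * ((a * u (s + 1) + b * v (s + 1) - (a * u s + b * v s)) / \<tau>))
     = a * (\<Sum>s = 0..j. frac_coeff \<alpha> (j - s) * ((u (s + 1) - u s) / \<tau>))
     + b * (\<Sum>s = 0..j. frac_coeff \<alpha> (j - s) * ((v (s + 1) - v s) / \<tau>))"
    unfolding sum_distrib_left sum.distrib[symmetric]
    by (intro sum.cong refl) (simp add: algebra_simps add_divide_distrib diff_divide_distrib)
  then show ?thesis unfolding frac_diff_def by (simp only: distrib_left mult.left_commute)
qed

text \<open>Averaging in space commutes with the time operator, so consistency of the fractional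
  derivative can be proved at each point and averaged afterwards.\<close>

lemma frac_diff_compact_op:
  "frac_diff \<alpha> \<tau> (\<lambda>s. compact_op (V s) i) j = compact_op (\<lambda>r. frac_diff \<alpha> \<tau> (\<lambda>s. V s r) j) i"
proof -
  have *: "compact_op w i = 1 / 12 * w (i + 1) + 1 * (10 / 12 * w i + 1 / 12 * w (i - 1))" for w
    by (simp add: compact_op_def)
  show ?thesis unfolding * frac_diff_lin ..
qed

text \<open>Everything is compared at the half layer, where average and difference quotient in time
  are accurate to \<open>\<tau>\<^sup>2\<close>. Six derivatives in \<open>x\<close> serve the
  compact operator, three in \<open>t\<close> the difference quotient of the second space
  derivative.\<close>

lemma smooth_approximation_order:
  fixes \<alpha> \<mu> l T c1 :: real
  assumes \<alpha>: "0 < \<alpha>" "\<alpha> < 1" and "\<mu> > 0" "l > 0" "T > 0" "m \<ge> 1"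
    and xs0: "0 < xs 1" and xs: "\<forall>k\<in>{1..<m}. xs k < xs (k + 1)" and xsl: "xs m < l"
    and q: "\<forall>k\<in>{1..m}. \<forall>x\<in>{0..l}. \<forall>t\<in>{0..T}. \<bar>q k x t\<bar> < c1"
    and sol: "differential_solution \<alpha> \<mu> l T m xs q f u0 u"
    and smooth: "smooth_class 6 3 l T u"
    and f: "continuous_on ({0..l} \<times> {0..T}) (\<lambda>(x, t). f x t)"
    and q_cont: "\<forall>k\<in>{1..m}. continuous_on ({0..l} \<times> {0..T}) (\<lambda>(x, t). q k x t)"
  shows "approximation_order \<alpha> \<mu> l T m xs q f u"
proof -
  obtain D where D0: "\<forall>x\<in>{0..l}. \<forall>t\<in>{0..T}. D 0 0 x t = u x t"
    and D_cont: "\<forall>p\<le>6. \<forall>r\<le>3. continuous_on ({0..l} \<times> {0..T}) (\<lambda>(x, t). D p r x t)"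
    and Dx: "\<forall>p<6. \<forall>r\<le>3. \<forall>x\<in>{0..l}. \<forall>t\<in>{0..T}.
           ((\<lambda>\<xi>. D p r \<xi> t) has_real_derivative D (Suc p) r x t) (at x within {0..l})"
    and Dt: "\<forall>p\<le>6. \<forall>r<3. \<forall>x\<in>{0..l}. \<forall>t\<in>{0..T}.
           ((\<lambda>\<eta>. D p r x \<eta>) has_real_derivative D p (Suc r) x t) (at t within {0..T})"
    using smooth unfolding smooth_class_def by blast
  have dx: "((\<lambda>\<xi>. D p r \<xi> t) has_real_derivative D (Suc p) r x t) (at x within {0..l})"
    if "p < 6" "r \<le> 3" "x \<in> {0..l}" "t \<in> {0..T}" for p r x t
    using Dx that by blast
  obtain B where "B \<ge> 0" and B: "\<And>p r x t. p \<le> 6 \<Longrightarrow> r \<le> 3 \<Longrightarrow> x \<in> {0..l} \<Longrightarrow> t \<in> {0..T} \<Longrightarrow> \<bar>D p r x t\<bar> \<le> B"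
    using uniform_derivative_bound[OF D_cont] by blast
  have c1: "c1 > 0" using q \<open>m \<ge> 1\<close> \<open>l > 0\<close> \<open>T > 0\<close>
    by (metis abs_ge_zero atLeastAtMost_iff le_less_trans less_imp_le order_refl)
  have xs_in: "xs k \<in> {0..l}" if "k \<in> {1..m}" for k
    using xs_mono[OF xs, of 1 k] xs_mono[OF xs, of k m] that xs0 xsl by auto
  define CA where "CA = 1 / Gamma (1 - \<alpha>) * (4 + 2 / (1 - \<alpha>)) * B"
  have CA0: "CA \<ge> 0" using \<alpha> \<open>B \<ge> 0\<close> by (simp add: CA_def Gamma_real_pos less_imp_le)
  define C1 where "C1 = B + \<mu> * B + 96 * real m * c1 * B"
  define C2 where "C2 = B + \<mu> * B + real m * c1 * B"
  have C0: "C1 \<ge> 0" "C2 \<ge> 0" using \<open>B \<ge> 0\<close> \<open>\<mu> > 0\<close> c1 by (auto simp: C1_def C2_def)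
  define C where "C = CA + C1 + C2 * T powr \<alpha>"
  have main: "\<bar>scheme_lhs \<alpha> \<tau> (nodal_values h \<tau> u) j i - scheme_rhs \<mu> h \<tau> m xs q f ik (nodal_values h \<tau> u) j i\<bar>
      \<le> C * (h ^ 4 + \<tau> powr (2 - \<alpha>))"
    if adm: "admissible_grid l m xs N K ik" and h_def: "h = l / real N" and \<tau>_def: "\<tau> = T / real K"
      and j: "j < K" and i: "i \<in> {1..N - 1}" for N K ik h \<tau> j i
  proof -
    have NK: "N \<ge> 3" "K \<ge> 1" using admissible_gridD[OF adm \<open>l > 0\<close> \<open>m \<ge> 1\<close> xs, of 1] \<open>m \<ge> 1\<close> by auto
    have h: "h > 0" "real N * h = l" and \<tau>: "\<tau> > 0" and K: "real K * \<tau> = T"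
      using NK \<open>l > 0\<close> \<open>T > 0\<close> by (auto simp: h_def \<tau>_def)
    have layer: "real s * \<tau> \<in> {0..T}" if "s \<le> K" for s
      using that \<tau> unfolding K[symmetric] by (auto intro!: mult_right_mono)
    have node: "real r * h \<in> {0..l}" if "r \<le> N" for r
      using that h(1) unfolding h(2)[symmetric] by (auto intro!: mult_right_mono)
    define x where "x = real i * h"
    have x: "x \<in> {0..l}" "x + h \<in> {0..l}" "x - h \<in> {0..l}" and i1: "i \<ge> 1"
      using i node[of i] node[of "i + 1"] node[of "i - 1"] by (auto simp: x_def algebra_simps of_nat_diff)
    define t where "t = (real j + 1/2) * \<tau>"
    define tm where "tm = real j * \<tau>"
    define tp where "tp = real (j + 1) * \<tau>"
    have t_shift: "t + \<tau> / 2 = tp" "t - \<tau> / 2 = tm" by (auto simp: t_def tm_def tp_def algebra_simps)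
    have tpm: "tp \<in> {0..T}" "tm \<in> {0..T}" using layer[of j] layer[of "j + 1"] j by (auto simp: tp_def tm_def)
    have t: "t \<in> {0..T}" using tpm t_shift \<tau> by auto
    note t_ball = t tpm(1)[folded t_shift] tpm(2)[folded t_shift]
    have tpT: "real (j + 1) * \<tau> \<le> T" using tpm by (simp add: tp_def)
    \<comment> \<open>Second order errors in time are weakened to the order of the fractional
      quadrature, at the price of a power of \<open>T\<close>.\<close>
    have \<tau>2: "\<tau>\<^sup>2 \<le> T powr \<alpha> * \<tau> powr (2 - \<alpha>)"
    proof -
      have "\<tau> \<le> T" using tpT \<tau> mult_right_mono[of 1 "real (j + 1)" \<tau>] by linarith
      then have "\<tau> powr \<alpha> \<le> T powr \<alpha>" using \<tau> \<alpha> by (intro powr_mono2) auto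
      then have "\<tau> powr \<alpha> * \<tau> powr (2 - \<alpha>) \<le> T powr \<alpha> * \<tau> powr (2 - \<alpha>)" by (intro mult_right_mono) auto
      moreover have "\<tau> powr \<alpha> * \<tau> powr (2 - \<alpha>) = \<tau>\<^sup>2" using \<tau> by (simp flip: powr_add)
      ultimately show ?thesis by simp
    qed
    define U where "U = nodal_values h \<tau> u"
    define v where "v y = (D 0 0 y tp + D 0 0 y tm) / 2" for y
    have U: "U s r = D 0 0 (real r * h) (real s * \<tau>)" if "r \<le> N" "s \<le> K" for r s
      using D0 node[OF that(1)] layer[OF that(2)] by (simp add: U_def nodal_values_def)
    have avg: "time_avg U j r = v (real r * h)" if "r \<le> N" for r
      using U[of r j] U[of r "j + 1"] that j by (simp add: time_avg_def v_def tp_def tm_def)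
    have nb: "i - 1 \<le> N" "i \<le> N" "i + 1 \<le> N" using i by auto
    define L where "L y = (\<Sum>k = 1..m. q k y t * D 0 0 (xs k) t)" for y
    define L' where "L' y = (\<Sum>k = 1..m. q k y t * cubic_interp h (time_avg U j) (ik k) (xs k))" for y
    define \<Delta> where "\<Delta> y = frac_diff \<alpha> \<tau> (\<lambda>s. D 0 0 y (real s * \<tau>)) j" for y
    define G where "G y = D 2 0 y t + \<mu> * D 2 1 y t + L y + f y t" for y
    have lhs: "scheme_lhs \<alpha> \<tau> U j i = compact_op (\<lambda>r. \<Delta> (real r * h)) i"
    proof -
      have "compact_op (U s) i = compact_op (\<lambda>r. D 0 0 (real r * h) (real s * \<tau>)) i" if "s \<le> K" for s
        using U[OF nb(1) that] U[OF nb(2) that] U[OF nb(3) that] by (simp add: compact_op_def)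
      then have "scheme_lhs \<alpha> \<tau> U j i = frac_diff \<alpha> \<tau> (\<lambda>s. compact_op (\<lambda>r. D 0 0 (real r * h) (real s * \<tau>)) i) j"
        unfolding scheme_lhs_def frac_diff_def using j
        by (intro arg_cong2[where f = "(*)"] refl sum.cong) auto
      also have "\<dots> = compact_op (\<lambda>r. \<Delta> (real r * h)) i"
        unfolding \<Delta>_def by (rule frac_diff_compact_op)
      finally show ?thesis .
    qed
    have rhs: "scheme_rhs \<mu> h \<tau> m xs q f ik U j i =
      diff_xx h (\<lambda>r. v (real r * h)) i
      + \<mu> * diff_xx h (\<lambda>r. (D 0 0 (real r * h) tp - D 0 0 (real r * h) tm) / \<tau>) i
      + compact_op (\<lambda>r. L' (real r * h)) i + compact_op (\<lambda>r. f (real r * h) t) i"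
    proof -
      have "diff_xx h (time_avg U j) i = diff_xx h (\<lambda>r. v (real r * h)) i"
        using avg[OF nb(1)] avg[OF nb(2)] avg[OF nb(3)] by (simp add: diff_xx_def)
      moreover have "diff_xx h (U (j + 1)) i = diff_xx h (\<lambda>r. D 0 0 (real r * h) tp) i"
        using U[OF nb(1), of "j + 1"] U[OF nb(2), of "j + 1"] U[OF nb(3), of "j + 1"] j by (simp add: diff_xx_def tp_def)
      moreover have "diff_xx h (U j) i = diff_xx h (\<lambda>r. D 0 0 (real r * h) tm) i"
        using U[OF nb(1), of j] U[OF nb(2), of j] U[OF nb(3), of j] j by (simp add: diff_xx_def tm_def)
      moreover have "diff_xx h (\<lambda>r. (D 0 0 (real r * h) tp - D 0 0 (real r * h) tm) / \<tau>) i
         = (diff_xx h (\<lambda>r. D 0 0 (real r * h) tp) i - diff_xx h (\<lambda>r. D 0 0 (real r * h) tm) i) / \<tau>"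
        using diff_xx_lin[of h "1 / \<tau>" "\<lambda>r. D 0 0 (real r * h) tp" "- 1 / \<tau>" "\<lambda>r. D 0 0 (real r * h) tm" i]
        by (simp add: diff_divide_distrib)
      ultimately show ?thesis by (simp add: scheme_rhs_def t_def[symmetric] L'_def)
    qed
    have time: "\<bar>compact_op (\<lambda>r. \<Delta> (real r * h)) i - compact_op (\<lambda>r. G (real r * h)) i\<bar> \<le> CA * \<tau> powr (2 - \<alpha>)"
    proof -
      have "\<bar>1 * \<Delta> (real r * h) + (-1) * G (real r * h)\<bar> \<le> CA * \<tau> powr (2 - \<alpha>)" if "r \<le> N" for r
        using time_consistency[OF \<alpha> \<open>l > 0\<close> \<open>T > 0\<close> sol D0 D_cont Dx Dt B[of 0 2] f q_cont xs_in \<tau> tpT t_def node[OF that]]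
        by (simp add: \<Delta>_def G_def L_def CA_def abs_minus_commute)
      then have "\<bar>compact_op (\<lambda>r. 1 * \<Delta> (real r * h) + (-1) * G (real r * h)) i\<bar> \<le> CA * \<tau> powr (2 - \<alpha>)"
        using i by (intro compact_op_le_sup)
      then show ?thesis unfolding compact_op_lin by simp
    qed
    have space: "\<bar>compact_op (\<lambda>r. D 2 s (real r * h) t) i - diff_xx h (\<lambda>r. D 0 s (real r * h) t) i\<bar> \<le> B * h ^ 4" if "s \<le> 3" for s
      unfolding compact_op_grid[OF i1, of "\<lambda>y. D 2 s y t"] diff_xx_grid[OF i1, of h "\<lambda>y. D 0 s y t"] x_def[symmetric]
      using compact_second_difference[of 0 l "\<lambda>p y. D p s y t" B h x] Dx B x t h that by simp
    have E3: "\<bar>diff_xx h (\<lambda>r. D 0 0 (real r * h) t) i - diff_xx h (\<lambda>r. v (real r * h)) i\<bar> \<le> B * \<tau>\<^sup>2"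
    proof -
      \<comment> \<open>A bound on the averaging error itself would be divided by
        \<open>h\<^sup>2\<close>. Instead the second difference is bounded by the second space
        derivative \<open>g 2\<close>, which is again an averaging error in time, now of
        \<open>D 2\<close>.\<close>
      define g where "g p y = (D p 0 y tp + D p 0 y tm) / 2 - D p 0 y t" for p y
      have "\<bar>(g 0 (x + h) - 2 * g 0 x + g 0 (x - h)) / h\<^sup>2\<bar> \<le> 2 * (B * (\<tau> / 2)\<^sup>2)"
      proof (rule second_difference_bound[of 0 l g "B * (\<tau> / 2)\<^sup>2" h x])
        fix p y assume "y \<in> {0..l}" "p < (2::nat)"
        then show "(g p has_real_derivative g (Suc p) y) (at y within {0..l})"
          using DERIV_diff[OF DERIV_cdivide[OF DERIV_add[OF dx[of p 0 y tp] dx[of p 0 y tm]], of 2] dx[of p 0 y t]] t tpm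
          by (simp add: g_def[abs_def])
      next
        fix y assume y: "y \<in> {0..l}"
        show "\<bar>g 2 y\<bar> \<le> B * (\<tau> / 2)\<^sup>2"
          unfolding g_def t_shift[symmetric] using Dt B y t_ball \<tau>
          by (intro midpoint_average_bound[of 0 T "\<lambda>r. D 2 r y"]) auto
      qed (use h x in auto)
      moreover have "diff_xx h (\<lambda>r. g 0 (real r * h)) i = diff_xx h (\<lambda>r. v (real r * h)) i - diff_xx h (\<lambda>r. D 0 0 (real r * h) t) i"
        using diff_xx_lin[of h 1 "\<lambda>r. v (real r * h)" "-1" "\<lambda>r. D 0 0 (real r * h) t" i] by (simp add: g_def v_def)
      moreover have "2 * (B * (\<tau> / 2)\<^sup>2) \<le> B * \<tau>\<^sup>2" using \<open>B \<ge> 0\<close> by (simp add: power_divide)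
      ultimately show ?thesis
        unfolding diff_xx_grid[OF i1, of h "g 0"] x_def[symmetric] by linarith
    qed
    have E4: "\<bar>diff_xx h (\<lambda>r. D 0 1 (real r * h) t) i - diff_xx h (\<lambda>r. (D 0 0 (real r * h) tp - D 0 0 (real r * h) tm) / \<tau>) i\<bar> \<le> B * \<tau>\<^sup>2"
    proof -
      define g where "g p y = (D p 0 y tp - D p 0 y tm) / \<tau> - D p 1 y t" for p y
      have "\<bar>(g 0 (x + h) - 2 * g 0 x + g 0 (x - h)) / h\<^sup>2\<bar> \<le> 2 * (B * (\<tau> / 2)\<^sup>2)"
      proof (rule second_difference_bound[of 0 l g "B * (\<tau> / 2)\<^sup>2" h x])
        fix p y assume "y \<in> {0..l}" "p < (2::nat)"
        then show "(g p has_real_derivative g (Suc p) y) (at y within {0..l})"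
          using DERIV_diff[OF DERIV_cdivide[OF DERIV_diff[OF dx[of p 0 y tp] dx[of p 0 y tm]], of \<tau>] dx[of p 1 y t]] t tpm
          by (simp add: g_def[abs_def])
      next
        fix y assume y: "y \<in> {0..l}"
        show "\<bar>g 2 y\<bar> \<le> B * (\<tau> / 2)\<^sup>2"
          unfolding g_def t_shift[symmetric]
          using central_difference_bound[of 0 T "\<lambda>r. D 2 r y" B "\<tau> / 2" t] Dt B y t_ball \<tau> by simp
      qed (use h x in auto)
      moreover have "diff_xx h (\<lambda>r. g 0 (real r * h)) i
        = diff_xx h (\<lambda>r. (D 0 0 (real r * h) tp - D 0 0 (real r * h) tm) / \<tau>) i - diff_xx h (\<lambda>r. D 0 1 (real r * h) t) i"
        using diff_xx_lin[of h 1 "\<lambda>r. (D 0 0 (real r * h) tp - D 0 0 (real r * h) tm) / \<tau>" "-1" "\<lambda>r. D 0 1 (real r * h) t" i]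
        by (simp add: g_def)
      moreover have "2 * (B * (\<tau> / 2)\<^sup>2) \<le> B * \<tau>\<^sup>2" using \<open>B \<ge> 0\<close> by (simp add: power_divide)
      ultimately show ?thesis
        unfolding diff_xx_grid[OF i1, of h "g 0"] x_def[symmetric] by linarith
    qed
    have E5: "\<bar>compact_op (\<lambda>r. L (real r * h)) i - compact_op (\<lambda>r. L' (real r * h)) i\<bar>
      \<le> real m * c1 * (96 * B * h ^ 4 + B * \<tau>\<^sup>2)"
    proof -
      \<comment> \<open>Two errors, separated by \<open>v (xs k)\<close>: interpolation in space of
        the averaged solution, and averaging in time at the loading point.\<close>
      have interp: "\<bar>D 0 0 (xs k) t - cubic_interp h (time_avg U j) (ik k) (xs k)\<bar> \<le> 96 * B * h ^ 4 + B * \<tau>\<^sup>2"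
        if k: "k \<in> {1..m}" for k
      proof -
        note g = admissible_gridD[OF adm \<open>l > 0\<close> \<open>m \<ge> 1\<close> xs k]
        have "cubic_interp h (time_avg U j) (ik k) (xs k) = cubic_interp h (\<lambda>r. v (real r * h)) (ik k) (xs k)"
          unfolding cubic_interp_def lagrange_def using avg g(2) by (intro sum.cong) auto
        moreover have "\<bar>cubic_interp h (\<lambda>r. v (real r * h)) (ik k) (xs k) - v (xs k)\<bar> \<le> 96 * B * h ^ 4"
        proof -
          define w where "w p y = (D p 0 y tp + D p 0 y tm) / 2" for p y
          have "\<bar>cubic_interp h (\<lambda>r. w 0 (real r * h)) (ik k) (xs k) - w 0 (xs k)\<bar> \<le> 96 * B * h ^ 4"
          proof (rule cubic_interp_error[of 0 l])
            fix p y assume "y \<in> {0..l}" "p < (4::nat)"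
            then show "(w p has_real_derivative w (Suc p) y) (at y within {0..l})"
              using DERIV_cdivide[OF DERIV_add[OF dx[of p 0 y tp] dx[of p 0 y tm]], of 2] tpm
              by (simp add: w_def[abs_def])
          next
            fix y assume y: "y \<in> {0..l}"
            show "\<bar>w 4 y\<bar> \<le> B"
              unfolding w_def using B[of 4 0 y tp] B[of 4 0 y tm] y tpm by simp
          next
            fix r assume "r \<in> {ik k - 1..ik k + 2}"
            then show "real r * h \<in> {0..l}" using g(2) by (intro node) auto
          qed (use g h xs_in[OF k] in \<open>auto simp: h_def\<close>)
          then show ?thesis by (simp add: w_def v_def)
        qed
        moreover have "\<bar>v (xs k) - D 0 0 (xs k) t\<bar> \<le> B * \<tau>\<^sup>2"
        proof -
          have "\<bar>v (xs k) - D 0 0 (xs k) t\<bar> \<le> B * (\<tau> / 2)\<^sup>2"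
            unfolding v_def t_shift[symmetric] using Dt B xs_in[OF k] t_ball \<tau>
            by (intro midpoint_average_bound[of 0 T "\<lambda>r. D 0 r (xs k)"]) auto
          also have "\<dots> \<le> B * \<tau>\<^sup>2" using \<open>B \<ge> 0\<close> by (simp add: power_divide)
          finally show ?thesis .
        qed
        ultimately show ?thesis by linarith
      qed
      have "\<bar>1 * L (real r * h) + (-1) * L' (real r * h)\<bar> \<le> real m * c1 * (96 * B * h ^ 4 + B * \<tau>\<^sup>2)" if r: "r \<le> N" for r
      proof -
        have "1 * L (real r * h) + (-1) * L' (real r * h)
          = (\<Sum>k = 1..m. q k (real r * h) t * (D 0 0 (xs k) t - cubic_interp h (time_avg U j) (ik k) (xs k)))"
          by (simp add: L_def L'_def right_diff_distrib sum_subtractf)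
        also have "\<bar>\<dots>\<bar> \<le> (\<Sum>k = 1..m. c1 * (96 * B * h ^ 4 + B * \<tau>\<^sup>2))"
        proof (intro order_trans[OF sum_abs] sum_mono)
          fix k assume k: "k \<in> {1..m}"
          have "\<bar>q k (real r * h) t\<bar> \<le> c1" using q k node[OF r] t by (auto intro: less_imp_le)
          then show "\<bar>q k (real r * h) t * (D 0 0 (xs k) t - cubic_interp h (time_avg U j) (ik k) (xs k))\<bar>
              \<le> c1 * (96 * B * h ^ 4 + B * \<tau>\<^sup>2)"
            unfolding abs_mult using interp[OF k] by (intro mult_mono) auto
        qed
        finally show ?thesis by (simp add: mult.assoc)
      qed
      then have "\<bar>compact_op (\<lambda>r. 1 * L (real r * h) + (-1) * L' (real r * h)) i\<bar> \<le> real m * c1 * (96 * B * h ^ 4 + B * \<tau>\<^sup>2)"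
        using i by (intro compact_op_le_sup)
      then show ?thesis unfolding compact_op_lin by simp
    qed
    have G_split: "compact_op (\<lambda>r. G (real r * h)) i = compact_op (\<lambda>r. D 2 0 (real r * h) t) i
       + \<mu> * compact_op (\<lambda>r. D 2 1 (real r * h) t) i + compact_op (\<lambda>r. L (real r * h)) i + compact_op (\<lambda>r. f (real r * h) t) i"
      by (simp add: G_def compact_op_def algebra_simps add_divide_distrib)
    \<comment> \<open>\<open>e1\<close> and \<open>e2\<close> are the compact space errors,
      \<open>e3\<close> and \<open>e4\<close> the centred time errors, \<open>e5\<close> the error
      of the loads, and \<open>e6\<close> that of the fractional derivative, into which the
      differential equation has been inserted.\<close>
    define e1 where "e1 = compact_op (\<lambda>r. D 2 0 (real r * h) t) i - diff_xx h (\<lambda>r. D 0 0 (real r * h) t) i"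
    define e2 where "e2 = compact_op (\<lambda>r. D 2 1 (real r * h) t) i - diff_xx h (\<lambda>r. D 0 1 (real r * h) t) i"
    define e3 where "e3 = diff_xx h (\<lambda>r. D 0 0 (real r * h) t) i - diff_xx h (\<lambda>r. v (real r * h)) i"
    define e4 where "e4 = diff_xx h (\<lambda>r. D 0 1 (real r * h) t) i - diff_xx h (\<lambda>r. (D 0 0 (real r * h) tp - D 0 0 (real r * h) tm) / \<tau>) i"
    define e5 where "e5 = compact_op (\<lambda>r. L (real r * h)) i - compact_op (\<lambda>r. L' (real r * h)) i"
    define e6 where "e6 = compact_op (\<lambda>r. \<Delta> (real r * h)) i - compact_op (\<lambda>r. G (real r * h)) i"
    have "scheme_lhs \<alpha> \<tau> U j i - scheme_rhs \<mu> h \<tau> m xs q f ik U j i = e6 + (e1 + e3) + \<mu> * (e2 + e4) + e5"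
      unfolding lhs rhs e1_def e2_def e3_def e4_def e5_def e6_def G_split by (simp add: algebra_simps)
    also have "\<bar>\<dots>\<bar> \<le> \<bar>e6\<bar> + (\<bar>e1\<bar> + \<bar>e3\<bar>) + \<mu> * (\<bar>e2\<bar> + \<bar>e4\<bar>) + \<bar>e5\<bar>"
    proof -
      have "\<bar>\<mu> * (e2 + e4)\<bar> \<le> \<mu> * (\<bar>e2\<bar> + \<bar>e4\<bar>)"
        unfolding abs_mult using \<open>\<mu> > 0\<close> by (intro mult_mono) auto
      then show ?thesis by linarith
    qed
    also have "\<dots> \<le> CA * \<tau> powr (2 - \<alpha>) + (B * h ^ 4 + B * \<tau>\<^sup>2) + \<mu> * (B * h ^ 4 + B * \<tau>\<^sup>2)
        + real m * c1 * (96 * B * h ^ 4 + B * \<tau>\<^sup>2)"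
    proof -
      have "\<bar>e6\<bar> \<le> CA * \<tau> powr (2 - \<alpha>)" using time by (simp add: e6_def)
      moreover have "\<bar>e1\<bar> \<le> B * h ^ 4" "\<bar>e2\<bar> \<le> B * h ^ 4" using space[of 0] space[of 1] by (auto simp: e1_def e2_def)
      moreover have "\<bar>e3\<bar> \<le> B * \<tau>\<^sup>2" "\<bar>e4\<bar> \<le> B * \<tau>\<^sup>2" using E3 E4 by (auto simp: e3_def e4_def)
      moreover have "\<bar>e5\<bar> \<le> real m * c1 * (96 * B * h ^ 4 + B * \<tau>\<^sup>2)" using E5 by (simp add: e5_def)
      ultimately show ?thesis using \<open>\<mu> > 0\<close> by (intro add_mono mult_left_mono) auto
    qed
    also have "\<dots> = CA * \<tau> powr (2 - \<alpha>) + C1 * h ^ 4 + C2 * \<tau>\<^sup>2"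
      by (simp add: C1_def C2_def algebra_simps)
    also have "\<dots> \<le> CA * \<tau> powr (2 - \<alpha>) + C1 * h ^ 4 + C2 * (T powr \<alpha> * \<tau> powr (2 - \<alpha>))"
      using \<tau>2 C0 by (intro add_mono mult_left_mono order_refl) auto
    also have "\<dots> \<le> C * (h ^ 4 + \<tau> powr (2 - \<alpha>))"
    proof -
      have "0 \<le> CA * h ^ 4 + C1 * \<tau> powr (2 - \<alpha>) + C2 * T powr \<alpha> * h ^ 4"
        using CA0 C0 h by simp
      then show ?thesis by (simp add: C_def algebra_simps)
    qed
    finally show ?thesis by (simp only: U_def)
  qed
  show ?thesis
    unfolding approximation_order_def Let_def
    by (intro exI[of _ C] allI impI ballI) (rule main[OF _ refl refl])
qed

section \<open>Uniqueness, stability and convergence\<close>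

lemma scheme_lhs_diff:
  "scheme_lhs \<alpha> \<tau> (\<lambda>j i. y j i - z j i) j i = scheme_lhs \<alpha> \<tau> y j i - scheme_lhs \<alpha> \<tau> z j i"
proof -
  have "compact_op (\<lambda>i. y s i - z s i) i = 1 * compact_op (y s) i + (-1) * compact_op (z s) i" for s
    by (simp add: compact_op_def field_simps)
  then show ?thesis unfolding scheme_lhs_def by (simp only: frac_diff_lin)
qed

text \<open>The loads are linear in the grid function, so the sources separate from the rest. Taking
  \<open>f = g\<close> covers the comparison with nodal values, where the second function satisfies
  the scheme only up to its truncation error.\<close>

lemma scheme_rhs_diff:
  "scheme_rhs \<mu> h \<tau> m xs q (\<lambda>_ _. 0) ik (\<lambda>j i. y j i - z j i) j i
    + compact_op (\<lambda>r. f (real r * h) ((real j + 1/2) * \<tau>) - g (real r * h) ((real j + 1/2) * \<tau>)) i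
   = scheme_rhs \<mu> h \<tau> m xs q f ik y j i - scheme_rhs \<mu> h \<tau> m xs q g ik z j i"
proof -
  have c: "compact_op (\<lambda>r. U r - V r) i = compact_op U i - compact_op V i" for U V
    by (simp add: compact_op_def field_simps)
  have d: "diff_xx h (\<lambda>r. U r - V r) i = diff_xx h U i - diff_xx h V i" for U V
    using diff_xx_lin[of h 1 U "-1" V i] by simp
  have a: "time_avg (\<lambda>j i. y j i - z j i) j = (\<lambda>r. time_avg y j r - time_avg z j r)"
    by (simp add: time_avg_def fun_eq_iff field_simps)
  have k: "cubic_interp h (\<lambda>r. U r - V r) i x = cubic_interp h U i x - cubic_interp h V i x" for U V i x
    using cubic_interp_lin[of h 1 U "-1" V i x] by simp
  have "compact_op (\<lambda>_. 0) i = 0" by (simp add: compact_op_def)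
  then show ?thesis
    unfolding scheme_rhs_def a c d k right_diff_distrib sum_subtractf
    by (simp add: algebra_simps diff_divide_distrib add_divide_distrib)
qed

theorem mainTheorem3:
  fixes \<alpha> \<mu> l T c1 :: real
    and m :: nat
    and xs :: "nat \<Rightarrow> real"
    and q :: "nat \<Rightarrow> real \<Rightarrow> real \<Rightarrow> real"
  assumes "0 < \<alpha>" "\<alpha> < 1" "\<mu> > 0" "l > 0" "T > 0"
    and "m \<ge> 1"
    and "0 < xs 1" "\<forall>k\<in>{1..<m}. xs k < xs (k + 1)" "xs m < l"
    and "\<forall>k\<in>{1..m}. \<forall>x\<in>{0..l}. \<forall>t\<in>{0..T}. \<bar>q k x t\<bar> < c1"
  shows "\<exists>\<tau>0 > 0. \<exists>MT > 0.
    \<comment> \<open>a priori estimate\<close>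
    (\<forall>f u0 N K ik y.
       admissible_grid l m xs N K ik \<and> T / real K \<le> \<tau>0 \<and>
       difference_solution \<alpha> \<mu> l T m xs q f u0 N K ik y \<longrightarrow>
       (let h = l / real N; \<tau> = T / real K;
            \<phi> = (\<lambda>j i. f (real i * h) ((real j + 1/2) * \<tau>))
        in \<forall>j<K. (norm_x h N (y (j + 1)))\<^sup>2
             \<le> MT * ((\<Sum>j' = 0..j. (norm0 h N (compact_op (\<phi> j')))\<^sup>2 * \<tau>)
                     + (norm0 h N (y 0))\<^sup>2 + (norm_x h N (y 0))\<^sup>2))) \<and>
    \<comment> \<open>uniqueness\<close>
    (\<forall>f u0 N K ik y z.
       admissible_grid l m xs N K ik \<and> T / real K \<le> \<tau>0 \<and>
       difference_solution \<alpha> \<mu> l T m xs q f u0 N K ik y \<and>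
       difference_solution \<alpha> \<mu> l T m xs q f u0 N K ik z \<longrightarrow>
       (\<forall>j\<le>K. \<forall>i\<le>N. y j i = z j i)) \<and>
    \<comment> \<open>stability with respect to the right-hand side and the initial data\<close>
    (\<forall>f g u0 v0 N K ik y z.
       admissible_grid l m xs N K ik \<and> T / real K \<le> \<tau>0 \<and>
       difference_solution \<alpha> \<mu> l T m xs q f u0 N K ik y \<and>
       difference_solution \<alpha> \<mu> l T m xs q g v0 N K ik z \<longrightarrow>
       (let h = l / real N; \<tau> = T / real K;
            \<phi> = (\<lambda>j i. f (real i * h) ((real j + 1/2) * \<tau>)
                      - g (real i * h) ((real j + 1/2) * \<tau>))
        in \<forall>j<K. (norm_x h N (\<lambda>i. y (j + 1) i - z (j + 1) i))\<^sup>2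
             \<le> MT * ((\<Sum>j' = 0..j. (norm0 h N (compact_op (\<phi> j')))\<^sup>2 * \<tau>)
                     + (norm0 h N (\<lambda>i. y 0 i - z 0 i))\<^sup>2
                     + (norm_x h N (\<lambda>i. y 0 i - z 0 i))\<^sup>2))) \<and>
    \<comment> \<open>order of approximation on smooth solutions\<close>
    (\<forall>f u0 u.
       differential_solution \<alpha> \<mu> l T m xs q f u0 u \<and> smooth_class 6 3 l T u \<and>
       continuous_on ({0..l} \<times> {0..T}) (\<lambda>(x, t). f x t) \<and>
       (\<forall>k\<in>{1..m}. continuous_on ({0..l} \<times> {0..T}) (\<lambda>(x, t). q k x t)) \<longrightarrow>
       approximation_order \<alpha> \<mu> l T m xs q f u) \<and>
    \<comment> \<open>convergence\<close>
    (\<forall>f u0 u.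
       differential_solution \<alpha> \<mu> l T m xs q f u0 u \<and>
       approximation_order \<alpha> \<mu> l T m xs q f u \<longrightarrow>
       (\<exists>C > 0. \<forall>N K ik y.
          admissible_grid l m xs N K ik \<and> T / real K \<le> \<tau>0 \<and>
          difference_solution \<alpha> \<mu> l T m xs q f u0 N K ik y \<longrightarrow>
          (let h = l / real N; \<tau> = T / real K
           in \<forall>j<K. norm_x h N (\<lambda>i. y (j + 1) i - nodal_values h \<tau> u (j + 1) i)
                \<le> C * (h ^ 4 + \<tau> powr (2 - \<alpha>)))))"
proof -
  have adm_ge: "N \<ge> 3" "K \<ge> 1" if "admissible_grid l m xs N K ik" for N K ik
    using admissible_gridD[OF that \<open>l > 0\<close> \<open>m \<ge> 1\<close> assms(8), of 1] \<open>m \<ge> 1\<close> by auto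
  obtain \<tau>0 M where "\<tau>0 > 0" "M > 0" and est': "\<forall>N K ik y \<rho>.
    admissible_grid l m xs N K ik \<and> T / real K \<le> \<tau>0 \<and>
    (\<forall>j<K. \<forall>i\<in>{1..N-1}. scheme_lhs \<alpha> (T / real K) y j i
        = scheme_rhs \<mu> (l / real N) (T / real K) m xs q (\<lambda>_ _. 0) ik y j i + \<rho> j i) \<and>
    (\<forall>j<K. y (j + 1) 0 = 0 \<and> y (j + 1) N = 0) \<longrightarrow>
    (\<forall>j<K. (norm_x (l / real N) N (y (j + 1)))\<^sup>2
       \<le> M * ((\<Sum>j' = 0..j. (norm0 (l / real N) N (\<rho> j'))\<^sup>2 * (T / real K))
              + (norm0 (l / real N) N (y 0))\<^sup>2 + (norm_x (l / real N) N (y 0))\<^sup>2))"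
    using residual_estimate[OF assms(1-6) assms(8) assms(10)] by (elim exE conjE)
  have est: "(norm_x (l / real N) N (y (j + 1)))\<^sup>2
       \<le> M * ((\<Sum>j' = 0..j. (norm0 (l / real N) N (\<rho> j'))\<^sup>2 * (T / real K))
              + (norm0 (l / real N) N (y 0))\<^sup>2 + (norm_x (l / real N) N (y 0))\<^sup>2)"
    if "admissible_grid l m xs N K ik" "T / real K \<le> \<tau>0"
      and "\<And>j i. j < K \<Longrightarrow> i \<in> {1..N-1} \<Longrightarrow> scheme_lhs \<alpha> (T / real K) y j i
        = scheme_rhs \<mu> (l / real N) (T / real K) m xs q (\<lambda>_ _. 0) ik y j i + \<rho> j i"
      and "\<And>j. j < K \<Longrightarrow> y (j + 1) 0 = 0 \<and> y (j + 1) N = 0" and "j < K"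
    for N K ik y \<rho> j
    by (rule est'[rule_format, OF _ \<open>j < K\<close>]) (use that(1-4) in blast)
  have stab: "(norm_x (l / real N) N (\<lambda>i. y (j + 1) i - z (j + 1) i))\<^sup>2
       \<le> M * ((\<Sum>j' = 0..j. (norm0 (l / real N) N (compact_op (\<lambda>i. f (real i * (l / real N)) ((real j' + 1/2) * (T / real K))
              - g (real i * (l / real N)) ((real j' + 1/2) * (T / real K)))))\<^sup>2 * (T / real K))
              + (norm0 (l / real N) N (\<lambda>i. y 0 i - z 0 i))\<^sup>2 + (norm_x (l / real N) N (\<lambda>i. y 0 i - z 0 i))\<^sup>2)"
    if "admissible_grid l m xs N K ik" "T / real K \<le> \<tau>0" "j < K"
      and "difference_solution \<alpha> \<mu> l T m xs q f u0 N K ik y"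
      and "difference_solution \<alpha> \<mu> l T m xs q g v0 N K ik z"
    for f g u0 v0 N K ik y z j
  proof (rule est[OF that(1,2), where y = "\<lambda>j i. y j i - z j i"])
    fix j i assume "j < K" "i \<in> {1..N - 1}"
    then have "scheme_lhs \<alpha> (T / real K) y j i = scheme_rhs \<mu> (l / real N) (T / real K) m xs q f ik y j i"
      "scheme_lhs \<alpha> (T / real K) z j i = scheme_rhs \<mu> (l / real N) (T / real K) m xs q g ik z j i"
      using that(4,5) unfolding difference_solution_def Let_def by blast+
    then show "scheme_lhs \<alpha> (T / real K) (\<lambda>j i. y j i - z j i) j i
      = scheme_rhs \<mu> (l / real N) (T / real K) m xs q (\<lambda>_ _. 0) ik (\<lambda>j i. y j i - z j i) j i
        + compact_op (\<lambda>i. f (real i * (l / real N)) ((real j + 1/2) * (T / real K))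
              - g (real i * (l / real N)) ((real j + 1/2) * (T / real K))) i"
      by (simp only: scheme_lhs_diff scheme_rhs_diff)
  next
    fix j assume "j < K"
    then show "y (j + 1) 0 - z (j + 1) 0 = 0 \<and> y (j + 1) N - z (j + 1) N = 0"
      using that(4,5) unfolding difference_solution_def Let_def by simp
  qed (rule \<open>j < K\<close>)
  have apriori: "(norm_x (l / real N) N (y (j + 1)))\<^sup>2
       \<le> M * ((\<Sum>j' = 0..j. (norm0 (l / real N) N (compact_op (\<lambda>i. f (real i * (l / real N)) ((real j' + 1/2) * (T / real K)))))\<^sup>2 * (T / real K))
              + (norm0 (l / real N) N (y 0))\<^sup>2 + (norm_x (l / real N) N (y 0))\<^sup>2)"
    if "admissible_grid l m xs N K ik" "T / real K \<le> \<tau>0" "j < K"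
      and "difference_solution \<alpha> \<mu> l T m xs q f u0 N K ik y"
    for f u0 N K ik y j
  proof -
    \<comment> \<open>The a priori estimate is stability with respect to the zero solution, which
      solves the scheme with zero data.\<close>
    have "difference_solution \<alpha> \<mu> l T m xs q (\<lambda>_ _. 0) (\<lambda>_. 0) N K ik (\<lambda>_ _. 0)"
      by (simp add: difference_solution_def Let_def scheme_lhs_def scheme_rhs_def frac_diff_def
          compact_op_def diff_xx_def time_avg_def cubic_interp_def lagrange_def)
    from stab[OF that this] show ?thesis by simp
  qed
  have uniq: "y j i = z j i"
    if adm: "admissible_grid l m xs N K ik" and "T / real K \<le> \<tau>0"
      and Y: "difference_solution \<alpha> \<mu> l T m xs q f u0 N K ik y"
      and Z: "difference_solution \<alpha> \<mu> l T m xs q f u0 N K ik z"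
      and "j \<le> K" "i \<le> N"
    for f u0 N K ik y z j i
  proof -
    define h where "h = l / real N"
    have h: "h > 0" using adm_ge[OF adm] \<open>l > 0\<close> by (simp add: h_def)
    have init: "y 0 i = z 0 i" if "i \<le> N" for i
      using Y Z that unfolding difference_solution_def Let_def by simp
    show ?thesis
    proof (cases j)
      case 0
      then show ?thesis using init \<open>i \<le> N\<close> by simp
    next
      case (Suc n)
      define w where "w i = y (n + 1) i - z (n + 1) i" for i
      have "n < K" using Suc \<open>j \<le> K\<close> by simp
      have "norm0 h N (\<lambda>i. y 0 i - z 0 i) = norm0 h N (\<lambda>_. 0)"
        by (rule norm0_cong) (auto simp: init)
      moreover have "norm_x h N (\<lambda>i. y 0 i - z 0 i) = norm_x h N (\<lambda>_. 0)"
        by (rule norm_x_cong) (simp add: init)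
      moreover have "norm0 h N (compact_op (\<lambda>_. 0)) = 0" by (simp add: norm0_def compact_op_def)
      ultimately have "(norm_x h N w)\<^sup>2 \<le> 0"
        using stab[OF adm \<open>T / real K \<le> \<tau>0\<close> \<open>n < K\<close> Y Z] unfolding w_def[abs_def] h_def[symmetric]
        by (simp add: norm0_def norm_x_def diff_x_def)
      then have "norm_x h N w = 0" by simp
      \<comment> \<open>\<open>norm_x\<close> vanishes on constants; the boundary value is what
        makes \<open>w\<close> zero. Layer 0, which has no boundary condition, was settled by the
        initial data.\<close>
      moreover have "w 0 = 0" using Y Z \<open>n < K\<close> unfolding difference_solution_def Let_def w_def by simp
      ultimately have "\<bar>w i\<bar> \<le> 0" using sup_le_norm_x[OF h \<open>i \<le> N\<close>, of w] by simp
      then show ?thesis by (simp add: w_def Suc)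
    qed
  qed
  have conv: "\<exists>C > 0. \<forall>N K ik y.
          admissible_grid l m xs N K ik \<and> T / real K \<le> \<tau>0 \<and>
          difference_solution \<alpha> \<mu> l T m xs q f u0 N K ik y \<longrightarrow>
          (\<forall>j<K. norm_x (l / real N) N (\<lambda>i. y (j + 1) i - nodal_values (l / real N) (T / real K) u (j + 1) i)
                \<le> C * ((l / real N) ^ 4 + (T / real K) powr (2 - \<alpha>)))"
    if sol: "differential_solution \<alpha> \<mu> l T m xs q f u0 u"
      and order: "approximation_order \<alpha> \<mu> l T m xs q f u" for f u0 u
  proof -
    note sol' = sol[unfolded differential_solution_def, THEN conjunct2, THEN conjunct2]
    have bdu: "\<forall>t. 0 \<le> t \<and> t \<le> T \<longrightarrow> u 0 t = 0 \<and> u l t = 0"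
      by (rule sol'[THEN conjunct1])
    have inu: "\<forall>x. 0 \<le> x \<and> x \<le> l \<longrightarrow> u x 0 = u0 x"
      by (rule sol'[THEN conjunct2])
    obtain C where C: "\<forall>N K ik. admissible_grid l m xs N K ik \<longrightarrow> (\<forall>j<K. \<forall>i\<in>{1..N - 1}.
        \<bar>scheme_lhs \<alpha> (T / real K) (nodal_values (l / real N) (T / real K) u) j i
           - scheme_rhs \<mu> (l / real N) (T / real K) m xs q f ik (nodal_values (l / real N) (T / real K) u) j i\<bar>
          \<le> C * ((l / real N) ^ 4 + (T / real K) powr (2 - \<alpha>)))"
      using order unfolding approximation_order_def Let_def by (elim exE)
    \<comment> \<open>\<open>T\<close> comes from summing over the layers and \<open>l\<close> from
      passing from the maximum to \<open>norm0\<close>. The constant \<open>C\<close> of the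
      approximation order has no known sign, hence the absolute value and the added 1.\<close>
    define C' where "C' = sqrt (M * (T * l)) * \<bar>C\<bar> + 1"
    have "C' > 0" using \<open>M > 0\<close> \<open>T > 0\<close> \<open>l > 0\<close> by (simp add: C'_def add_nonneg_pos)
    have main: "norm_x (l / real N) N (\<lambda>i. y (j + 1) i - nodal_values (l / real N) (T / real K) u (j + 1) i)
                \<le> C' * ((l / real N) ^ 4 + (T / real K) powr (2 - \<alpha>))"
      if adm: "admissible_grid l m xs N K ik" and \<tau>0: "T / real K \<le> \<tau>0"
        and Y: "difference_solution \<alpha> \<mu> l T m xs q f u0 N K ik y" and "j < K" for N K ik y j
    proof -
      define h where "h = l / real N"
      define \<tau> where "\<tau> = T / real K"
      have h: "h > 0" "real N * h = l" and \<tau>: "\<tau> > 0" "real K * \<tau> = T"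
        using adm_ge[OF adm] \<open>l > 0\<close> \<open>T > 0\<close> by (auto simp: h_def \<tau>_def)
      define V where "V = nodal_values h \<tau> u"
      \<comment> \<open>The numerical solution satisfies the scheme exactly, so the error
        \<open>y - V\<close> has minus the truncation error of \<open>V\<close> as its
        residual.\<close>
      define \<rho> where "\<rho> j i = - (scheme_lhs \<alpha> \<tau> V j i - scheme_rhs \<mu> h \<tau> m xs q f ik V j i)" for j i
      define \<epsilon> where "\<epsilon> = h ^ 4 + \<tau> powr (2 - \<alpha>)"
      have "\<epsilon> \<ge> 0" using h by (simp add: \<epsilon>_def)
      have \<rho>: "norm0 h N (\<rho> j) \<le> sqrt l * (\<bar>C\<bar> * \<epsilon>)" if "j < K" for j
      proof -
        have "\<bar>\<rho> j i\<bar> \<le> \<bar>C\<bar> * \<epsilon>" if "i \<in> {1..N - 1}" for i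
        proof -
          have "\<bar>\<rho> j i\<bar> \<le> C * \<epsilon>"
            using C[rule_format, OF adm \<open>j < K\<close> that] unfolding h_def[symmetric] \<tau>_def[symmetric]
            by (simp add: \<rho>_def V_def \<epsilon>_def)
          also have "\<dots> \<le> \<bar>C\<bar> * \<epsilon>" using \<open>\<epsilon> \<ge> 0\<close> by (intro mult_right_mono) auto
          finally show ?thesis .
        qed
        then show ?thesis using norm0_le_sup[of h "\<bar>C\<bar> * \<epsilon>" N "\<rho> j"] h \<open>\<epsilon> \<ge> 0\<close> by simp
      qed
      \<comment> \<open>The error vanishes on the whole initial layer, end points included, which
        removes both initial norms from the estimate.\<close>
      have init: "y 0 i - V 0 i = 0" if "i \<le> N" for i
      proof -
        have "real i * h \<in> {0..l}" using that h(1) unfolding h(2)[symmetric] by (auto intro!: mult_right_mono)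
        then have "u (real i * h) 0 = u0 (real i * h)" using inu by simp
        moreover have "y 0 i = u0 (real i * h)"
          using Y that unfolding difference_solution_def Let_def h_def by blast
        ultimately show ?thesis by (simp add: V_def nodal_values_def)
      qed
      have "norm0 h N (\<lambda>i. y 0 i - V 0 i) = norm0 h N (\<lambda>_. 0)"
        by (rule norm0_cong, rule init) auto
      then have i1: "norm0 h N (\<lambda>i. y 0 i - V 0 i) = 0" by (simp add: norm0_def)
      have "norm_x h N (\<lambda>i. y 0 i - V 0 i) = norm_x h N (\<lambda>_. 0)"
        by (rule norm_x_cong) (rule init)
      then have i2: "norm_x h N (\<lambda>i. y 0 i - V 0 i) = 0" by (simp add: norm_x_def diff_x_def)
      have "(norm_x h N (\<lambda>i. y (j + 1) i - V (j + 1) i))\<^sup>2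
         \<le> M * ((\<Sum>j' = 0..j. (norm0 h N (\<rho> j'))\<^sup>2 * \<tau>)
              + (norm0 h N (\<lambda>i. y 0 i - V 0 i))\<^sup>2 + (norm_x h N (\<lambda>i. y 0 i - V 0 i))\<^sup>2)"
        unfolding h_def \<tau>_def
      proof (rule est[OF adm \<tau>0, where y = "\<lambda>j i. y j i - V j i"])
        fix j i assume "j < K" "i \<in> {1..N - 1}"
        then have "scheme_lhs \<alpha> \<tau> y j i = scheme_rhs \<mu> h \<tau> m xs q f ik y j i"
          using Y unfolding difference_solution_def Let_def h_def \<tau>_def by blast
        moreover have "compact_op (\<lambda>_. 0) i = 0" by (simp add: compact_op_def)
        ultimately have "scheme_lhs \<alpha> \<tau> (\<lambda>j i. y j i - V j i) j i
          = scheme_rhs \<mu> h \<tau> m xs q (\<lambda>_ _. 0) ik (\<lambda>j i. y j i - V j i) j i + \<rho> j i"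
          using scheme_rhs_diff[of \<mu> h \<tau> m xs q ik y V j i f f] by (simp add: scheme_lhs_diff \<rho>_def)
        then show "scheme_lhs \<alpha> (T / real K) (\<lambda>j i. y j i - V j i) j i
          = scheme_rhs \<mu> (l / real N) (T / real K) m xs q (\<lambda>_ _. 0) ik (\<lambda>j i. y j i - V j i) j i + \<rho> j i"
          by (simp only: h_def \<tau>_def)
      next
        fix j assume "j < K"
        then have "real (j + 1) * \<tau> \<le> T" unfolding \<tau>(2)[symmetric] using \<tau>(1) by (intro mult_right_mono) auto
        then have "u 0 (real (j + 1) * \<tau>) = 0" "u l (real (j + 1) * \<tau>) = 0"
          using bdu \<tau>(1) by auto
        then have "V (j + 1) 0 = 0" "V (j + 1) N = 0"
          unfolding V_def nodal_values_def h(2) by simp_all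
        then show "y (j + 1) 0 - V (j + 1) 0 = 0 \<and> y (j + 1) N - V (j + 1) N = 0"
          using Y \<open>j < K\<close> unfolding difference_solution_def Let_def by simp
      qed (rule \<open>j < K\<close>)
      also have "\<dots> = M * (\<Sum>j' = 0..j. (norm0 h N (\<rho> j'))\<^sup>2 * \<tau>)" by (simp add: i1 i2)
      also have "\<dots> \<le> M * (\<Sum>j' = 0..j. (sqrt l * (\<bar>C\<bar> * \<epsilon>))\<^sup>2 * \<tau>)"
        using \<rho> \<open>j < K\<close> \<open>M > 0\<close> \<tau>(1) h(1)
        by (intro mult_left_mono sum_mono mult_right_mono power_mono) (auto simp: norm0_nonneg)
      also have "\<dots> = M * ((real (j + 1) * \<tau>) * (sqrt l * (\<bar>C\<bar> * \<epsilon>))\<^sup>2)" by simp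
      also have "\<dots> \<le> M * (T * (sqrt l * (\<bar>C\<bar> * \<epsilon>))\<^sup>2)"
      proof -
        have "real (j + 1) * \<tau> \<le> T" unfolding \<tau>(2)[symmetric] using \<open>j < K\<close> \<tau>(1) by (intro mult_right_mono) auto
        then show ?thesis using \<open>M > 0\<close> by (intro mult_left_mono mult_right_mono) auto
      qed
      also have "\<dots> = (sqrt (M * (T * l)) * \<bar>C\<bar> * \<epsilon>)\<^sup>2"
        using \<open>M > 0\<close> \<open>T > 0\<close> \<open>l > 0\<close> by (simp add: power_mult_distrib)
      finally have sq: "(norm_x h N (\<lambda>i. y (j + 1) i - V (j + 1) i))\<^sup>2 \<le> (sqrt (M * (T * l)) * \<bar>C\<bar> * \<epsilon>)\<^sup>2" .
      have "0 \<le> sqrt (M * (T * l)) * \<bar>C\<bar> * \<epsilon>"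
        using \<open>M > 0\<close> \<open>T > 0\<close> \<open>l > 0\<close> \<open>\<epsilon> \<ge> 0\<close> by simp
      with sq have "norm_x h N (\<lambda>i. y (j + 1) i - V (j + 1) i) \<le> sqrt (M * (T * l)) * \<bar>C\<bar> * \<epsilon>"
        by (rule power2_le_imp_le)
      also have "\<dots> \<le> C' * \<epsilon>" using \<open>\<epsilon> \<ge> 0\<close> by (simp add: C'_def distrib_right)
      finally show ?thesis by (simp only: V_def \<epsilon>_def h_def \<tau>_def)
    qed
    show ?thesis
    proof (rule exI[of _ C'], rule conjI[OF \<open>C' > 0\<close>], intro allI impI, elim conjE)
      fix N K ik y j
      assume "admissible_grid l m xs N K ik" "T / real K \<le> \<tau>0"
        "difference_solution \<alpha> \<mu> l T m xs q f u0 N K ik y" "j < K"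
      then show "norm_x (l / real N) N (\<lambda>i. y (j + 1) i - nodal_values (l / real N) (T / real K) u (j + 1) i)
                \<le> C' * ((l / real N) ^ 4 + (T / real K) powr (2 - \<alpha>))"
        by (rule main)
    qed
  qed
  show ?thesis
    unfolding Let_def
    apply (rule exI[of _ \<tau>0], rule conjI[OF \<open>\<tau>0 > 0\<close>], rule exI[of _ M], rule conjI[OF \<open>M > 0\<close>])
    apply (intro conjI)
    subgoal by (intro allI impI, elim conjE, frule (3) apriori, assumption)
    subgoal by (intro allI impI, elim conjE, frule (5) uniq, assumption)
    subgoal by (intro allI impI, elim conjE, frule (4) stab, assumption)
    subgoal by (intro allI impI, elim conjE)
        (rule smooth_approximation_order[OF assms(1-10)])
    subgoal by (intro allI impI, elim conjE) (rule conv)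
    done
qed

end
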